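(* Let $\Sigma$ be a nonempty $C^{1,1}$ submanifold of the Engel group $\mathbb{E}$, of dimension $p$ with $1\le p\le 4$. Then the degree of $\Sigma$ equals the Hausdorff dimension of $\Sigma$ with respect to the homogeneous distance $\rho$.
   Context: Engel group: $\mathbb{E}=\mathbb{R}^4$ with the Lie group structure having identity $0$ for which the vector fields $X_1=\partial_1$, $X_2=\partial_2+x_1\partial_3+\frac{x_1^2}{2}\partial_4$, $X_3=\partial_3+x_1\partial_4$, $X_4=\partial_4$ form a basis of the left invariant vector fields (the only nontrivial brackets are $[X_1,X_2]=X_3$ and $[X_1,X_3]=X_4$). The dilations $\delta_r(x)=(rx_1,rx_2,r^2x_3,r^3x_4)$, $r>0$, are group automorphisms. $\rho$ is an arbitrary fixed homogeneous distance on $\mathbb{R}^4$, that is, a continuous, left invariant distance with $\rho(\delta_rx,\delta_ry)=r\,\rho(x,y)$ for all $x,y$ and $r>0$ (for instance the Carnot-Carath\'eodory distance associated with $\mathrm{span}\{X_1,X_2\}$). Submanifolds are embedded, without boundary; $C^{1,1}$ means locally parametrized by $C^1$ immersions with locally Lipschitz first derivatives. Degree: set $d_1=d_2=1$, $d_3=2$, $d_4=3$. The $p$-vector $X_{i_1}\wedge\dots\wedge X_{i_p}$, $i_1<\dots<i_p$, has degree $d_{i_1}+\dots+d_{i_p}$; a nonzero $p$-vector has degree equal to the maximum of the degrees of the basis elements $X_{i_1}\wedge\dots\wedge X_{i_p}$ appearing in it with nonzero coefficient. For $x\in\Sigma$, the pointwise degree $d_\Sigma(x)$ is the degree of a nonzero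 tangent $p$-vector of $\Sigma$ at $x$ (the wedge product of a basis of $T_x\Sigma$), written in terms of the $X_i$'s at $x$; the degree of $\Sigma$ is $\max_{x\in\Sigma}d_\Sigma(x)$. *)

theory Defs
  imports "HOL-Analysis.Analysis"
begin

section \<open>The Engel group\<close>

text \<open>
  The group law below is the one determined by the identity \<open>0\<close> and the frame
  \<open>engel_frame\<close>: a left invariant field is \<open>X x = d(L_x)_0 (X 0)\<close>, which fixes the
  differentials of all left translations (see \<open>engel_frame_left_invariant\<close>).
\<close>

definition engel_mult :: "real^4 \<Rightarrow> real^4 \<Rightarrow> real^4" where
  "engel_mult x y = vector
     [x$1 + y$1,
      x$2 + y$2,
      x$3 + y$3 + x$1 * y$2,
      x$4 + y$4 + x$1 * y$3 + (x$1)\<^sup>2 / 2 * y$2]"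

definition engel_dilation :: "real \<Rightarrow> real^4 \<Rightarrow> real^4" where
  "engel_dilation r x = vector [r * x$1, r * x$2, r^2 * x$3, r^3 * x$4]"

text \<open>The frame \<open>X\<^sub>1, \<dots>, X\<^sub>4\<close>, with \<open>axis i 1\<close> in the role of \<open>\<partial>\<^sub>i\<close>. Frame indices are natural
  numbers, because the index type \<open>4\<close> satisfies \<open>4 = 0\<close> and so has the wrong order.\<close>

definition engel_frame :: "nat \<Rightarrow> real^4 \<Rightarrow> real^4" where
  "engel_frame i x =
     (if i = 1 then axis 1 1
      else if i = 2 then axis 2 1 + x$1 *\<^sub>R axis 3 1 + ((x$1)\<^sup>2 / 2) *\<^sub>R axis 4 1
      else if i = 3 then axis 3 1 + x$1 *\<^sub>R axis 4 1
      else if i = 4 then axis 4 1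
      else 0)"

definition engel_weight :: "nat \<Rightarrow> nat" where
  "engel_weight i = (if i = 1 \<or> i = 2 then 1 else if i = 3 then 2 else if i = 4 then 3 else 0)"

lemma vector_4_nth [simp]:
  "(vector [a, b, c, d] :: real^4) $ 1 = a"
  "(vector [a, b, c, d] :: real^4) $ 2 = b"
  "(vector [a, b, c, d] :: real^4) $ 3 = c"
  "(vector [a, b, c, d] :: real^4) $ 4 = d"
  unfolding vector_def by simp_all

lemma engel_mult_nth [simp]:
  "engel_mult x y $ 1 = x$1 + y$1"
  "engel_mult x y $ 2 = x$2 + y$2"
  "engel_mult x y $ 3 = x$3 + y$3 + x$1 * y$2"
  "engel_mult x y $ 4 = x$4 + y$4 + x$1 * y$3 + (x$1)\<^sup>2 / 2 * y$2"
  unfolding engel_mult_def by (rule vector_4_nth)+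

lemma engel_mult_assoc: "engel_mult (engel_mult x y) z = engel_mult x (engel_mult y z)"
  by (simp add: vec_eq_iff forall_4 power2_eq_square algebra_simps add_divide_distrib)

lemma engel_mult_zero_left: "engel_mult 0 x = x"
  by (simp add: vec_eq_iff forall_4)

lemma engel_mult_zero_right: "engel_mult x 0 = x"
  by (simp add: vec_eq_iff forall_4)

lemma engel_mult_inverse: "\<exists>y. engel_mult x y = 0 \<and> engel_mult y x = 0"
proof (intro exI conjI)
  let ?y = "vector [- x$1, - x$2, - x$3 + x$1 * x$2,
                    - x$4 + x$1 * x$3 - (x$1)\<^sup>2 / 2 * x$2] :: real^4"
  show "engel_mult x ?y = 0" "engel_mult ?y x = 0"
    by (simp_all add: vec_eq_iff forall_4 power2_eq_square algebra_simps)
qed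

lemma engel_dilation_mult:
  "engel_dilation r (engel_mult x y) = engel_mult (engel_dilation r x) (engel_dilation r y)"
  by (simp add: engel_dilation_def vec_eq_iff forall_4 power2_eq_square power3_eq_cube
      algebra_simps)

lemma engel_frame_left_invariant:
  "\<exists>D. (engel_mult x has_derivative D) (at y) \<and> D (engel_frame i y) = engel_frame i (engel_mult x y)"
proof (intro exI conjI)
  let ?D = "\<lambda>h::real^4. engel_mult x h - x"
  have "linear ?D"
    by (rule linearI) (simp_all add: vec_eq_iff forall_4 algebra_simps add_divide_distrib)
  then have "bounded_linear ?D"
    by (simp add: linear_conv_bounded_linear)
  then have "(?D has_derivative ?D) (at y)"
    by (rule bounded_linear_imp_has_derivative)
  from has_derivative_add[OF has_derivative_const[of x] this]
  show "(engel_mult x has_derivative ?D) (at y)"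
    by simp
  have "engel_frame i z $ 1 = (if i = 1 then 1 else 0)"
    "engel_frame i z $ 2 = (if i = 2 then 1 else 0)"
    "engel_frame i z $ 3 = (if i = 2 then z$1 else if i = 3 then 1 else 0)"
    "engel_frame i z $ 4 =
       (if i = 2 then (z$1)\<^sup>2 / 2 else if i = 3 then z$1 else if i = 4 then 1 else 0)" for z
    by (simp_all add: engel_frame_def axis_def)
  then show "?D (engel_frame i y) = engel_frame i (engel_mult x y)"
    by (simp add: vec_eq_iff forall_4 power2_eq_square algebra_simps add_divide_distrib)
qed

definition homogeneous_distance :: "(real^4 \<Rightarrow> real^4 \<Rightarrow> real) \<Rightarrow> bool" where
  "homogeneous_distance \<rho> \<longleftrightarrow>
     Metric_space UNIV \<rho> \<and>
     continuous_on UNIV (\<lambda>(x, y). \<rho> x y) \<and>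
     (\<forall>z x y. \<rho> (engel_mult z x) (engel_mult z y) = \<rho> x y) \<and>
     (\<forall>r>0. \<forall>x y. \<rho> (engel_dilation r x) (engel_dilation r y) = r * \<rho> x y)"


section \<open>Embedded submanifolds\<close>

text \<open>Continuity of \<open>\<phi>'\<close> follows from the local Lipschitz condition.\<close>

definition C11_parametrization ::
    "(real^'p) set \<Rightarrow> (real^'p \<Rightarrow> real^'n) \<Rightarrow> (real^'n) set \<Rightarrow> bool" where
  "C11_parametrization U \<phi> W \<longleftrightarrow>
     open U \<and>
     (\<exists>\<psi>. homeomorphism U W \<phi> \<psi>) \<and>
     (\<exists>\<phi>' :: real^'p \<Rightarrow> (real^'p) \<Rightarrow>\<^sub>L (real^'n).
        (\<forall>u\<in>U. (\<phi> has_derivative blinfun_apply (\<phi>' u)) (at u) \<and> inj (blinfun_apply (\<phi>' u))) \<and>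
        (\<forall>u\<in>U. \<exists>e>0. \<exists>L. L-lipschitz_on (ball u e \<inter> U) \<phi>'))"

text \<open>The first argument only carries the dimension \<open>CARD('p)\<close>.\<close>

definition C11_submanifold :: "'p::finite itself \<Rightarrow> (real^'n) set \<Rightarrow> bool" where
  "C11_submanifold (_ :: 'p itself) S \<longleftrightarrow>
     (\<forall>x\<in>S. \<exists>W. x \<in> W \<and> openin (top_of_set S) W \<and>
        (\<exists>(U :: (real^'p) set) \<phi>. C11_parametrization U \<phi> W))"

definition tangent_space :: "(real^'n) set \<Rightarrow> real^'n \<Rightarrow> (real^'n) set" where
  "tangent_space S x =
     {v. \<exists>\<gamma> e. e > 0 \<and> \<gamma> C1_differentiable_on {-e<..<e} \<and> \<gamma> ` {-e<..<e} \<subseteq> S \<and>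
           \<gamma> 0 = x \<and> (\<gamma> has_vector_derivative v) (at 0)}"


section \<open>Multivectors and degree\<close>

text \<open>A \<open>p\<close>-vector is represented by the components, in the coordinate frame \<open>\<partial>\<^sub>1, \<dots>, \<partial>\<^sub>n\<close>, of the
  corresponding alternating contravariant \<open>p\<close>-tensor; only \<open>\<iota> 0, \<dots>, \<iota> (p - 1)\<close> matter.\<close>

definition wedge :: "(real^'n) list \<Rightarrow> (nat \<Rightarrow> 'n) \<Rightarrow> real" where
  "wedge vs \<iota> =
     (\<Sum>\<sigma> | \<sigma> permutes {..<length vs}.
        of_int (sign \<sigma>) * (\<Prod>k<length vs. (vs ! \<sigma> k) $ \<iota> k))"

definition multi_indices :: "nat \<Rightarrow> nat set set" where
  "multi_indices p = {I. I \<subseteq> {1..4} \<and> card I = p}"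

definition frame_wedge :: "real^4 \<Rightarrow> nat set \<Rightarrow> (nat \<Rightarrow> 4) \<Rightarrow> real" where
  "frame_wedge x I = wedge (map (\<lambda>i. engel_frame i x) (sorted_list_of_set I))"

text \<open>The coefficients of a \<open>p\<close>-vector \<open>\<tau>\<close> in the basis \<open>X\<^sub>I\<close> of the \<open>p\<close>-vectors at \<open>x\<close>.\<close>

definition frame_coeff :: "nat \<Rightarrow> real^4 \<Rightarrow> ((nat \<Rightarrow> 4) \<Rightarrow> real) \<Rightarrow> nat set \<Rightarrow> real" where
  "frame_coeff p x \<tau> =
     (THE c. (\<forall>I. I \<notin> multi_indices p \<longrightarrow> c I = 0) \<and>
             \<tau> = (\<lambda>\<iota>. \<Sum>I\<in>multi_indices p. c I * frame_wedge x I \<iota>))"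

definition multivector_degree :: "nat \<Rightarrow> real^4 \<Rightarrow> ((nat \<Rightarrow> 4) \<Rightarrow> real) \<Rightarrow> nat" where
  "multivector_degree p x \<tau> =
     Max {\<Sum>i\<in>I. engel_weight i | I. I \<in> multi_indices p \<and> frame_coeff p x \<tau> I \<noteq> 0}"

definition basis_list :: "(real^'n) set \<Rightarrow> (real^'n) list \<Rightarrow> bool" where
  "basis_list T vs \<longleftrightarrow> distinct vs \<and> independent (set vs) \<and> span (set vs) = T"

text \<open>Two bases have proportional wedge products, so the choice of basis is immaterial.\<close>

definition pointwise_degree :: "(real^4) set \<Rightarrow> real^4 \<Rightarrow> nat" where
  "pointwise_degree S x =
     (let vs = (SOME vs. basis_list (tangent_space S x) vs)
      in multivector_degree (length vs) x (wedge vs))"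

definition submanifold_degree :: "(real^4) set \<Rightarrow> nat" where
  "submanifold_degree S = Max (pointwise_degree S ` S)"


section \<open>Hausdorff dimension with respect to a distance\<close>

definition diam_wrt :: "('a \<Rightarrow> 'a \<Rightarrow> real) \<Rightarrow> 'a set \<Rightarrow> ennreal" where
  "diam_wrt \<rho> E = (SUP x\<in>E. SUP y\<in>E. ennreal (\<rho> x y))"

text \<open>\<open>diam(E)\<^sup>s\<close> with the conventions \<open>diam(\<emptyset>)\<^sup>s = 0\<close> and \<open>0\<^sup>0 = 1\<close> for nonempty \<open>E\<close>
  (whereas \<open>0 powr 0 = 0\<close>); it is applied to sets of finite diameter only.\<close>

definition diam_powr :: "('a \<Rightarrow> 'a \<Rightarrow> real) \<Rightarrow> real \<Rightarrow> 'a set \<Rightarrow> ennreal" where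
  "diam_powr \<rho> s E =
     (if E = {} then 0 else if s = 0 then 1 else ennreal (enn2real (diam_wrt \<rho> E) powr s))"

definition hausdorff_premeasure ::
    "('a \<Rightarrow> 'a \<Rightarrow> real) \<Rightarrow> real \<Rightarrow> real \<Rightarrow> 'a set \<Rightarrow> ennreal" where
  "hausdorff_premeasure \<rho> s \<delta> A =
     Inf {(\<Sum>i. diam_powr \<rho> s (E i)) | E :: nat \<Rightarrow> 'a set.
            A \<subseteq> (\<Union>i. E i) \<and> (\<forall>i. diam_wrt \<rho> (E i) \<le> ennreal \<delta>)}"

definition hausdorff_measure :: "('a \<Rightarrow> 'a \<Rightarrow> real) \<Rightarrow> real \<Rightarrow> 'a set \<Rightarrow> ennreal" where
  "hausdorff_measure \<rho> s A = (SUP \<delta>\<in>{0<..}. hausdorff_premeasure \<rho> s \<delta> A)"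

definition hausdorff_dimension :: "('a \<Rightarrow> 'a \<Rightarrow> real) \<Rightarrow> 'a set \<Rightarrow> ennreal" where
  "hausdorff_dimension \<rho> A = Inf {ennreal s | s. 0 \<le> s \<and> hausdorff_measure \<rho> s A = 0}"

end

theory Submission
  imports Defs
begin

text \<open>
  Left translation by \<open>x\<inverse>\<close> is affine, and its linear part \<open>engel_coords x\<close> reads off the
  coefficients of a vector in the frame at \<open>x\<close>. This one linear map therefore serves two purposes.
  On the metric side \<open>\<rho> x z\<close> is the distance from \<open>0\<close> of the point with coordinates
  \<open>engel_coords x (z - x)\<close>, and by homogeneity the \<open>\<rho>\<close>-ball of radius \<open>r\<close> about \<open>0\<close> is, up to
  constants, the box with side \<open>r ^ engel_weight i\<close> in direction \<open>i\<close> (\<open>homogeneous_distance_le\<close>,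
  \<open>homogeneous_distance_ge\<close>). On the algebraic side the coefficient of \<open>X\<^sub>I\<close> in a tangent \<open>p\<close>-vector
  is a \<open>p \<times> p\<close> minor of frame coefficients (\<open>frame_coeff_wedge\<close>), so the pointwise degree is the
  largest weight of an index set \<open>I\<close> whose \<open>p\<close> coordinates are injective on the tangent space
  (\<open>pointwise_degree_eq\<close>). For a parametrization \<open>\<phi>\<close> and such an \<open>I\<close>, the \<open>I\<close>-coordinates of the
  translated map \<open>t \<mapsto> x\<inverse> \<phi>(t)\<close> form a local diffeomorphism \<open>G\<close> of \<open>\<real>\<^sup>p\<close>, and the Lebesgue
  measure of the \<open>G\<close>-preimage of a box is comparable to that of the box.

  The dimension is at least the degree: the parameters of \<open>\<Sigma> \<inter> B(y,r)\<close> lie in the \<open>G\<close>-preimage of a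
  box of measure comparable to \<open>r ^ index_weight I\<close>, uniformly for \<open>y\<close> near a point of maximal
  degree. Hence the image of Lebesgue measure satisfies the hypothesis of the mass distribution
  principle (\<open>hausdorff_measure_nonzero\<close>, \<open>hausdorff_measure_submanifold_nonzero\<close>).

  The dimension is at most the degree \<open>D\<close>: it suffices that at every single point \<open>x\<close> the image
  measure of \<open>B(x,r)\<close> is at least \<open>c r ^ D\<close> for small \<open>r\<close>, with \<open>c\<close> depending on \<open>x\<close>, because \<open>\<Sigma>\<close>
  then splits into countably many pieces with uniform constants and separated points in a piece can
  be counted (\<open>hausdorff_measure_eq_0_of_density\<close>). To get the density bound (\<open>ball_density\<close>), let
  \<open>I\<close> have maximal weight at \<open>x\<close> and bound the remaining coordinates on the \<open>G\<close>-preimage of a box by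
  second order Taylor estimates, where the Lipschitz derivative is used. Coordinates of
  weight at most two cause no difficulty. The fourth one is harmless if \<open>4 \<in> I\<close>. If
  the contact form \<open>dx\<^sub>4 - x\<^sub>1 dx\<^sub>3 + x\<^sub>1\<^sup>2/2 dx\<^sub>2\<close> vanishes on all of the tangent spaces, it is
  controlled by integration (\<open>flat_curve_estimate\<close>). In the remaining case
  some tangent space has a component along \<open>X\<^sub>4\<close>, so \<open>D\<close> is so large
  (\<open>index_weight_compare\<close>) that a box with the smaller sides \<open>r\<^bsup>3/2\<^esup>\<close> and \<open>r\<^sup>2\<close> is
  enough, and on it the quadratic error is at most a multiple of \<open>r\<^sup>3\<close>.
\<close>

section \<open>Left invariant coordinates and the homogeneous distance\<close>

text \<open>The coefficients of \<open>v\<close> in the frame at \<open>x\<close> (\<open>engel_coords_frame\<close>), and at the same time the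
  linear part of the affine map \<open>z \<mapsto> x\<inverse> z\<close> (\<open>engel_mult_coords\<close>).\<close>

definition engel_coords :: "real^4 \<Rightarrow> real^4 \<Rightarrow> real^4" where
  "engel_coords x v = vector [v$1, v$2, v$3 - x$1 * v$2, v$4 - x$1 * v$3 + (x$1)\<^sup>2 / 2 * v$2]"

lemma engel_coords_nth [simp]:
  "engel_coords x v $ 1 = v$1"
  "engel_coords x v $ 2 = v$2"
  "engel_coords x v $ 3 = v$3 - x$1 * v$2"
  "engel_coords x v $ 4 = v$4 - x$1 * v$3 + (x$1)\<^sup>2 / 2 * v$2"
  unfolding engel_coords_def by (rule vector_4_nth)+

lemma linear_engel_coords: "linear (engel_coords x)"
  by (rule linearI) (simp_all add: vec_eq_iff forall_4 algebra_simps add_divide_distrib)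

lemma bounded_linear_engel_coords: "bounded_linear (engel_coords x)"
  using linear_engel_coords linear_conv_bounded_linear by blast

lemma engel_coords_eq_0_iff [simp]: "engel_coords x v = 0 \<longleftrightarrow> v = 0"
  by (auto simp: vec_eq_iff forall_4)

lemma of_nat_4_simps [simp]:
  "(of_nat (Suc 0) :: 4) = 1" "(of_nat 2 :: 4) = 2" "(of_nat 3 :: 4) = 3" "(of_nat 4 :: 4) = 4"
  by simp_all

lemma atLeastAtMost_1_4: "{1..4::nat} = {1, 2, 3, 4}"
  by auto

lemma inj_on_of_nat_4: "inj_on (of_nat :: nat \<Rightarrow> 4) {1..4}"
  unfolding atLeastAtMost_1_4 by simp

lemma range_of_nat_4: "(of_nat :: nat \<Rightarrow> 4) ` {1..4} = UNIV"
  unfolding atLeastAtMost_1_4 UNIV_4 by simp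

lemma engel_coords_frame:
  assumes "i \<in> {1..4}"
  shows "engel_coords x (engel_frame i x) = axis (of_nat i) 1"
  using assms unfolding atLeastAtMost_1_4
  by (elim insertE) (simp_all add: vec_eq_iff forall_4 engel_frame_def axis_def power2_eq_square)

lemma engel_mult_coords: "engel_mult x (engel_coords x (z - x)) = z"
  by (simp add: vec_eq_iff forall_4 power2_eq_square algebra_simps)

text \<open>Left invariance of the frame, in coordinates centred at \<open>x\<close>.\<close>

lemma engel_coords_shift:
  "engel_coords y v = engel_coords (engel_coords x (y - x)) (engel_coords x v)"
  by (simp add: vec_eq_iff forall_4 power2_eq_square field_simps)

lemma engel_dilation_of_nat:
  assumes "i \<in> {1..4}"
  shows "engel_dilation r x $ of_nat i = r ^ engel_weight i * x $ of_nat i"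
  using assms unfolding atLeastAtMost_1_4
  by (elim insertE) (simp_all add: engel_dilation_def engel_weight_def)

lemma engel_weight_pos: "i \<in> {1..4} \<Longrightarrow> 0 < engel_weight i"
  by (auto simp: engel_weight_def)

lemma vec4_eq_of_nat: "x = (y :: real^4) \<longleftrightarrow> (\<forall>i\<in>{1..4::nat}. x $ of_nat i = y $ of_nat i)"
  unfolding atLeastAtMost_1_4 by (simp add: vec_eq_iff forall_4)

lemma vec4_of_nat_cover: "\<exists>i\<in>{1..4::nat}. m = (of_nat i :: 4)"
  using range_of_nat_4 by blast

lemma homogeneous_distance_coords:
  assumes "homogeneous_distance \<rho>"
  shows "\<rho> x z = \<rho> 0 (engel_coords x (z - x))"
proof -
  have "\<rho> (engel_mult x 0) (engel_mult x (engel_coords x (z - x))) = \<rho> 0 (engel_coords x (z - x))"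
    using assms unfolding homogeneous_distance_def by blast
  then show ?thesis
    by (simp add: engel_mult_coords engel_mult_zero_right)
qed

lemma homogeneous_distance_dilation_0:
  assumes "homogeneous_distance \<rho>" "0 < r"
  shows "\<rho> 0 (engel_dilation r z) = r * \<rho> 0 z"
proof -
  have "engel_dilation r 0 = 0"
    by (simp add: engel_dilation_def vec_eq_iff forall_4)
  then show ?thesis
    using assms unfolding homogeneous_distance_def by metis
qed

lemma continuous_homogeneous_distance_0:
  assumes "homogeneous_distance \<rho>"
  shows "continuous_on A (\<rho> x)"
proof -
  have "continuous_on UNIV (\<lambda>(x, y). \<rho> x y)"
    using assms by (simp add: homogeneous_distance_def)
  then have "continuous_on A ((\<lambda>(x, y). \<rho> x y) \<circ> (\<lambda>z. (x, z)))"
    by (intro continuous_on_compose continuous_intros) (auto elim: continuous_on_subset)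
  then show ?thesis
    by (simp add: o_def)
qed

lemma engel_dilation_reciprocal:
  assumes "0 < r"
  shows "engel_dilation r (engel_dilation (1 / r) z) = z"
  using assms by (simp add: engel_dilation_def vec_eq_iff forall_4 power2_eq_square power3_eq_cube)

text \<open>\<open>\<rho> 0\<close> is bounded on the unit box by compactness, and dilations carry the unit box to all others.\<close>

lemma homogeneous_distance_le:
  assumes \<rho>: "homogeneous_distance \<rho>"
  obtains C where "0 < C"
    "\<And>z r. 0 < r \<Longrightarrow> (\<And>i. i \<in> {1..4} \<Longrightarrow> \<bar>z $ of_nat i\<bar> \<le> r ^ engel_weight i) \<Longrightarrow> \<rho> 0 z \<le> C * r"
proof -
  have "bounded (\<rho> 0 ` cbox (vec (-1)) (vec 1))"
    by (intro compact_imp_bounded compact_continuous_image continuous_homogeneous_distance_0 \<rho>)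
      (rule compact_cbox)
  then obtain C where C: "\<And>z. z \<in> cbox (vec (-1)) (vec 1) \<Longrightarrow> \<bar>\<rho> 0 z\<bar> \<le> C"
    unfolding bounded_iff by auto
  show thesis
  proof (rule that[of "max C 1"])
    fix z :: "real^4" and r :: real assume r: "0 < r" and z: "\<And>i. i \<in> {1..4} \<Longrightarrow> \<bar>z $ of_nat i\<bar> \<le> r ^ engel_weight i"
    define w where "w = engel_dilation (1 / r) z"
    have "\<bar>w $ of_nat i\<bar> \<le> 1" if "i \<in> {1..4}" for i
      using z[OF that] r unfolding w_def
      by (simp add: engel_dilation_of_nat[OF that] abs_mult power_divide)
    then have "w \<in> cbox (vec (-1)) (vec 1)"
      unfolding mem_box_cart using vec4_of_nat_cover by (metis abs_le_iff minus_le_iff vec_component)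
    then have "\<rho> 0 w \<le> max C 1"
      using C[of w] by linarith
    moreover have "\<rho> 0 z = r * \<rho> 0 w"
      using homogeneous_distance_dilation_0[OF \<rho> r, of w] r
      by (simp add: w_def engel_dilation_reciprocal)
    ultimately show "\<rho> 0 z \<le> max C 1 * r"
      using r by (simp add: mult.commute)
  qed simp
qed

text \<open>Every \<open>z \<noteq> 0\<close> is a dilate of a point on the compact boundary of the unit box, where \<open>\<rho> 0\<close> has a
  positive minimum; the dilation factor is the largest of the numbers \<open>root (engel_weight i) \<bar>z\<^sub>i\<bar>\<close>.\<close>

lemma homogeneous_distance_ge:
  assumes \<rho>: "homogeneous_distance \<rho>"
  obtains C where "0 < C"
    "\<And>z r i. \<rho> 0 z \<le> r \<Longrightarrow> i \<in> {1..4} \<Longrightarrow> \<bar>z $ of_nat i\<bar> \<le> (C * r) ^ engel_weight i"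
proof -
  interpret Metric_space UNIV \<rho>
    using \<rho> by (simp add: homogeneous_distance_def)
  \<comment> \<open>the boundary of the unit box\<close>
  define S where "S = cbox (vec (-1)) (vec 1) \<inter> (\<Union>m. {z::real^4. \<bar>z $ m\<bar> = 1})"
  have "closed {z::real^4. \<bar>z $ m\<bar> = 1}" for m
    by (intro closed_Collect_eq continuous_intros)
  then have "compact S"
    unfolding S_def by (intro compact_Int_closed compact_cbox closed_UN) auto
  moreover have "axis 1 1 \<in> S"
    by (auto simp: S_def mem_box_cart axis_def)
  then have "S \<noteq> {}" by blast
  ultimately obtain a where a: "a \<in> S" "\<And>z. z \<in> S \<Longrightarrow> \<rho> 0 a \<le> \<rho> 0 z"
    using continuous_attains_inf[OF _ _ continuous_homogeneous_distance_0[OF \<rho>]] by metis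
  have "a \<noteq> 0"
    using a(1) by (auto simp: S_def)
  then have pos: "0 < \<rho> 0 a"
    using mdist_pos_less[of 0 a] by simp
  show thesis
  proof (rule that[of "1 / \<rho> 0 a"])
    fix z :: "real^4" and r i assume r: "\<rho> 0 z \<le> r" and i: "i \<in> {1..4::nat}"
    define l where "l = Max ((\<lambda>i. root (engel_weight i) \<bar>z $ of_nat i\<bar>) ` {1..4::nat})"
    have le: "root (engel_weight i) \<bar>z $ of_nat i\<bar> \<le> l" if "i \<in> {1..4}" for i
      unfolding l_def using that by (intro Max_ge) auto
    have zl: "\<bar>z $ of_nat i\<bar> \<le> l ^ engel_weight i" if "i \<in> {1..4}" for i
    proof -
      have "\<bar>z $ of_nat i\<bar> = root (engel_weight i) \<bar>z $ of_nat i\<bar> ^ engel_weight i"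
        using engel_weight_pos[OF that] by simp
      also have "\<dots> \<le> l ^ engel_weight i"
        by (intro power_mono le that) (simp add: real_root_ge_zero)
      finally show ?thesis .
    qed
    have "0 \<le> root (engel_weight i) \<bar>z $ of_nat i\<bar>" by (simp add: real_root_ge_zero)
    then have l0: "0 \<le> l" using le[OF i] by linarith
    have "l * \<rho> 0 a \<le> \<rho> 0 z"
    proof (cases "l = 0")
      case False
      then have l: "0 < l" using l0 by simp
      define w where "w = engel_dilation (1 / l) z"
      have wi: "w $ of_nat i = z $ of_nat i / l ^ engel_weight i" if "i \<in> {1..4}" for i
        by (simp add: w_def engel_dilation_of_nat[OF that] power_divide)
      have "\<bar>w $ of_nat i\<bar> \<le> 1" if "i \<in> {1..4}" for i
        using zl[OF that] l by (simp add: wi[OF that])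
      then have "w \<in> cbox (vec (-1)) (vec 1)"
        unfolding mem_box_cart using vec4_of_nat_cover by (metis abs_le_iff minus_le_iff vec_component)
      moreover have "l \<in> (\<lambda>i. root (engel_weight i) \<bar>z $ of_nat i\<bar>) ` {1..4::nat}"
        unfolding l_def by (rule Max_in) auto
      then obtain k where k: "k \<in> {1..4}" "l = root (engel_weight k) \<bar>z $ of_nat k\<bar>"
        by blast
      then have "l ^ engel_weight k = \<bar>z $ of_nat k\<bar>"
        using engel_weight_pos[OF k(1)] by simp
      then have "\<bar>w $ of_nat k\<bar> = 1"
        using l by (simp add: wi[OF k(1)] flip: \<open>l ^ engel_weight k = _\<close>)
      ultimately have "w \<in> S"
        unfolding S_def by blast
      moreover have "\<rho> 0 z = l * \<rho> 0 w"
        using homogeneous_distance_dilation_0[OF \<rho> l, of w] l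
        by (simp add: w_def engel_dilation_reciprocal)
      ultimately show ?thesis
        using a(2) l by simp
    qed simp
    then have "l \<le> 1 / \<rho> 0 a * r"
      using r pos by (simp add: field_simps)
    then have "l ^ engel_weight i \<le> (1 / \<rho> 0 a * r) ^ engel_weight i"
      using l0 by (rule power_mono)
    then show "\<bar>z $ of_nat i\<bar> \<le> (1 / \<rho> 0 a * r) ^ engel_weight i"
      using zl[OF i] by linarith
  qed (use pos in simp)
qed

section \<open>Coefficients of multivectors\<close>

lemma wedge_cong:
  assumes "\<And>k. k < length vs \<Longrightarrow> \<iota> k = \<kappa> k"
  shows "wedge vs \<iota> = wedge vs \<kappa>"
  unfolding wedge_def using assms by (intro sum.cong prod.cong arg_cong2[of _ _ _ _ "(*)"]) auto

lemma wedge_permute: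
  assumes \<pi>: "\<pi> permutes {..<length vs}"
  shows "wedge vs (\<lambda>k. \<iota> (\<pi> k)) = of_int (sign \<pi>) * wedge vs \<iota>"
proof -
  let ?N = "{..<length vs}"
  have "wedge vs (\<lambda>k. \<iota> (\<pi> k))
      = (\<Sum>\<sigma> | \<sigma> permutes ?N. of_int (sign (\<sigma> \<circ> \<pi>)) * (\<Prod>k\<in>?N. (vs ! (\<sigma> \<circ> \<pi>) k) $ \<iota> (\<pi> k)))"
    unfolding wedge_def by (subst sum_permutations_compose_right[OF \<pi>]) simp
  also have "\<dots> = (\<Sum>\<sigma> | \<sigma> permutes ?N. of_int (sign \<pi>) * (of_int (sign \<sigma>) * (\<Prod>k\<in>?N. (vs ! \<sigma> k) $ \<iota> k)))"
  proof (rule sum.cong[OF refl])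
    fix \<sigma> assume "\<sigma> \<in> {\<sigma>. \<sigma> permutes ?N}"
    then have "permutation \<sigma>" "permutation \<pi>"
      using \<pi> permutation_permutes by (auto intro: permutes_imp_permutation[of ?N])
    then have "sign (\<sigma> \<circ> \<pi>) = sign \<sigma> * sign \<pi>"
      by (rule sign_compose)
    moreover have "(\<Prod>k\<in>?N. (vs ! (\<sigma> \<circ> \<pi>) k) $ \<iota> (\<pi> k)) = (\<Prod>k\<in>?N. (vs ! \<sigma> k) $ \<iota> k)"
      using prod.permute[OF \<pi>, of "\<lambda>k. (vs ! \<sigma> k) $ \<iota> k"] by (simp add: o_def)
    ultimately show "of_int (sign (\<sigma> \<circ> \<pi>)) * (\<Prod>k\<in>?N. (vs ! (\<sigma> \<circ> \<pi>) k) $ \<iota> (\<pi> k)) =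
      of_int (sign \<pi>) * (of_int (sign \<sigma>) * (\<Prod>k\<in>?N. (vs ! \<sigma> k) $ \<iota> k))"
      by simp
  qed
  also have "\<dots> = of_int (sign \<pi>) * wedge vs \<iota>"
    unfolding wedge_def by (simp add: sum_distrib_left)
  finally show ?thesis .
qed

lemma wedge_eq_0:
  assumes "\<not> inj_on \<iota> {..<length vs}"
  shows "wedge vs \<iota> = 0"
proof -
  from assms obtain a b where ab: "a < length vs" "b < length vs" "\<iota> a = \<iota> b" "a \<noteq> b"
    unfolding inj_on_def by auto
  have "Transposition.transpose a b permutes {..<length vs}"
    using ab by (intro permutes_swap_id) auto
  then have "wedge vs (\<lambda>k. \<iota> (Transposition.transpose a b k)) = of_int (sign (Transposition.transpose a b)) * wedge vs \<iota>"
    by (rule wedge_permute)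
  moreover have "(\<lambda>k. \<iota> (Transposition.transpose a b k)) = \<iota>"
    using ab(3) by (auto simp: Transposition.transpose_def)
  ultimately show ?thesis
    using ab(4) by (simp add: sign_swap_id)
qed

text \<open>A linear map acts on \<open>p\<close>-vectors by contraction of the tensor with the matrix in each slot. What
  matters is that the right-hand side is linear in \<open>wedge vs\<close>, see \<open>wedge_matrix_sum\<close>.\<close>

lemma wedge_matrix:
  fixes a :: "real^'n^'m"
  shows "wedge (map ((*v) a) vs) \<kappa> =
    (\<Sum>\<iota>\<in>PiE {..<length vs} (\<lambda>_. UNIV). wedge vs \<iota> * (\<Prod>k<length vs. a $ \<kappa> k $ \<iota> k))"
proof -
  let ?N = "{..<length vs}" and ?P = "PiE {..<length vs} (\<lambda>_. UNIV :: 'n set)"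
  have "wedge (map ((*v) a) vs) \<kappa> =
     (\<Sum>\<sigma> | \<sigma> permutes ?N. of_int (sign \<sigma>) * (\<Prod>k\<in>?N. \<Sum>m\<in>UNIV. a $ \<kappa> k $ m * (vs ! \<sigma> k) $ m))"
    unfolding wedge_def length_map
  proof (intro sum.cong prod.cong refl arg_cong2[of _ _ _ _ "(*)"])
    fix \<sigma> k assume "\<sigma> \<in> {\<sigma>. \<sigma> permutes ?N}" "k \<in> ?N"
    then have "\<sigma> k < length vs"
      using permutes_in_image[of \<sigma> ?N k] by auto
    then show "map ((*v) a) vs ! \<sigma> k $ \<kappa> k = (\<Sum>m\<in>UNIV. a $ \<kappa> k $ m * vs ! \<sigma> k $ m)"
      by (simp add: matrix_vector_mult_def)
  qed
  also have "\<dots> = (\<Sum>\<sigma> | \<sigma> permutes ?N. \<Sum>\<iota>\<in>?P. of_int (sign \<sigma>) *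
      (\<Prod>k\<in>?N. (vs ! \<sigma> k) $ \<iota> k) * (\<Prod>k\<in>?N. a $ \<kappa> k $ \<iota> k))"
    by (simp add: prod_sum_PiE sum_distrib_left prod.distrib mult_ac)
  also have "\<dots> = (\<Sum>\<iota>\<in>?P. wedge vs \<iota> * (\<Prod>k\<in>?N. a $ \<kappa> k $ \<iota> k))"
    unfolding wedge_def sum_distrib_right by (rule sum.swap)
  finally show ?thesis .
qed

lemma wedge_matrix_sum:
  fixes a :: "real^'n^'m"
  assumes "wedge vs = (\<lambda>\<iota>. \<Sum>I\<in>F. c I * wedge (ws I) \<iota>)" "\<And>I. I \<in> F \<Longrightarrow> length (ws I) = length vs"
  shows "wedge (map ((*v) a) vs) = (\<lambda>\<iota>. \<Sum>I\<in>F. c I * wedge (map ((*v) a) (ws I)) \<iota>)"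
proof
  fix \<kappa>
  let ?P = "PiE {..<length vs} (\<lambda>_. UNIV :: 'n set)" and ?a = "\<lambda>\<iota>. \<Prod>k<length vs. a $ \<kappa> k $ \<iota> k"
  have "wedge (map ((*v) a) vs) \<kappa> = (\<Sum>\<iota>\<in>?P. \<Sum>I\<in>F. c I * (wedge (ws I) \<iota> * ?a \<iota>))"
    by (simp add: wedge_matrix assms(1) sum_distrib_right mult_ac)
  also have "\<dots> = (\<Sum>I\<in>F. \<Sum>\<iota>\<in>?P. c I * (wedge (ws I) \<iota> * ?a \<iota>))"
    by (rule sum.swap)
  also have "\<dots> = (\<Sum>I\<in>F. c I * wedge (map ((*v) a) (ws I)) \<kappa>)"
    by (intro sum.cong refl) (simp add: wedge_matrix assms(2) sum_distrib_left)
  finally show "wedge (map ((*v) a) vs) \<kappa> = (\<Sum>I\<in>F. c I * wedge (map ((*v) a) (ws I)) \<kappa>)" .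
qed

text \<open>The increasing enumeration of \<open>I\<close>, read as a list of coordinates of \<open>\<real>\<^sup>4\<close>: evaluating a
  \<open>p\<close>-vector on it gives a component in the standard basis.\<close>

definition enum_index :: "nat set \<Rightarrow> nat \<Rightarrow> 4" where
  "enum_index I k = of_nat (sorted_list_of_set I ! k)"

abbreviation axis_list :: "nat set \<Rightarrow> (real^4) list" where
  "axis_list I \<equiv> map (\<lambda>i. axis (of_nat i) 1) (sorted_list_of_set I)"

lemma multi_indices_finite [simp]: "finite (multi_indices p)"
  unfolding multi_indices_def by (rule finite_subset[of _ "Pow {1..4}"]) auto

lemma multi_indices_list:
  assumes "I \<in> multi_indices p"
  shows "finite I" "length (sorted_list_of_set I) = p" "set (sorted_list_of_set I) = I" "I \<subseteq> {1..4}"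
proof -
  show "I \<subseteq> {1..4}"
    using assms by (simp add: multi_indices_def)
  then show "finite I"
    by (rule finite_subset) simp
  then show "length (sorted_list_of_set I) = p" "set (sorted_list_of_set I) = I"
    using assms by (auto simp: multi_indices_def)
qed

lemma nth_sorted_list_image:
  assumes "I \<in> multi_indices p"
  shows "(!) (sorted_list_of_set I) ` {..<p} = I"
  using bij_betw_nth[OF distinct_sorted_list_of_set refl refl, of I] multi_indices_list[OF assms]
  by (simp add: bij_betw_def)

lemma enum_index_bij:
  assumes I: "I \<in> multi_indices p"
  shows "bij_betw (enum_index I) {..<p} (of_nat ` I)"
proof -
  have "bij_betw ((!) (sorted_list_of_set I)) {..<p} I"
    using multi_indices_list[OF I] bij_betw_nth[of "sorted_list_of_set I"] by simp
  moreover have "bij_betw (of_nat :: nat \<Rightarrow> 4) I (of_nat ` I)"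
    using inj_on_subset[OF inj_on_of_nat_4 multi_indices_list(4)[OF I]] by (rule inj_on_imp_bij_betw)
  ultimately have "bij_betw (of_nat \<circ> (!) (sorted_list_of_set I)) {..<p} ((of_nat :: nat \<Rightarrow> 4) ` I)"
    by (rule bij_betw_trans)
  then show ?thesis
    by (simp add: enum_index_def[abs_def] o_def)
qed

lemma wedge_axis:
  assumes I: "I \<in> multi_indices p" and J: "J \<in> multi_indices p"
  shows "wedge (axis_list I) (enum_index J) = (if I = J then 1 else 0)"
proof -
  let ?N = "{..<p}"
  note lI = multi_indices_list[OF I] and lJ = multi_indices_list[OF J]
  have 1: "(\<Prod>k\<in>?N. (axis_list I ! \<sigma> k) $ enum_index J k) = (if I = J \<and> \<sigma> = id then 1 else 0)"
    if \<sigma>: "\<sigma> permutes ?N" for \<sigma>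
  proof (cases "\<forall>k\<in>?N. sorted_list_of_set I ! \<sigma> k = sorted_list_of_set J ! k")
    case True
    have "I = (!) (sorted_list_of_set I) ` (\<sigma> ` ?N)"
      using nth_sorted_list_image[OF I] permutes_image[OF \<sigma>] by simp
    also have "\<dots> = (!) (sorted_list_of_set J) ` ?N"
      unfolding image_image using True by (intro image_cong) auto
    also have "\<dots> = J"
      by (rule nth_sorted_list_image[OF J])
    finally have IJ: "I = J" .
    have "\<sigma> k = k" for k
    proof (cases "k \<in> ?N")
      case k: True
      then have "\<sigma> k \<in> ?N"
        using permutes_in_image[OF \<sigma>] by simp
      then show ?thesis
        using True k lI(2) unfolding IJ
        by (metis distinct_sorted_list_of_set lessThan_iff nth_eq_iff_index_eq)
    qed (use \<sigma> in \<open>simp add: permutes_not_in\<close>)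
    then have "\<sigma> = id" by auto
    then show ?thesis
      using IJ lI(2) by (auto simp: axis_def enum_index_def intro!: prod.neutral)
  next
    case False
    then obtain k where k: "k \<in> ?N" "sorted_list_of_set I ! \<sigma> k \<noteq> sorted_list_of_set J ! k"
      by blast
    have sk: "\<sigma> k < p"
      using k(1) permutes_in_image[OF \<sigma>] by simp
    have "sorted_list_of_set I ! \<sigma> k \<in> {1..4}" "sorted_list_of_set J ! k \<in> {1..4}"
      using lI lJ sk k(1) nth_mem by (metis lessThan_iff subsetD)+
    then have "(of_nat (sorted_list_of_set I ! \<sigma> k) :: 4) \<noteq> of_nat (sorted_list_of_set J ! k)"
      using k(2) inj_on_of_nat_4 by (metis inj_onD)
    then have "(axis_list I ! \<sigma> k) $ enum_index J k = 0"
      using sk lI(2) by (simp add: axis_def enum_index_def)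
    moreover have "\<not> (I = J \<and> \<sigma> = id)"
      using k by auto
    ultimately show ?thesis
      using k(1) by (auto intro!: prod_zero)
  qed
  have "wedge (axis_list I) (enum_index J)
      = (\<Sum>\<sigma> | \<sigma> permutes ?N. if \<sigma> = id then (if I = J then 1 else 0) else 0)"
    unfolding wedge_def length_map lI(2) using 1 by (intro sum.cong) auto
  also have "\<dots> = (if I = J then 1 else 0)"
    by (subst sum.delta) (auto simp: finite_permutations permutes_id)
  finally show ?thesis .
qed

text \<open>Both sides are alternating in \<open>\<iota>\<close>, so it is enough to compare them on increasing \<open>\<iota>\<close>, where
  \<open>wedge_axis\<close> leaves a single term.\<close>

lemma wedge_expand:
  fixes ws :: "(real^4) list"
  assumes p: "length ws = p"
  shows "wedge ws = (\<lambda>\<iota>. \<Sum>I\<in>multi_indices p. wedge ws (enum_index I) * wedge (axis_list I) \<iota>)"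
proof
  fix \<iota> :: "nat \<Rightarrow> 4"
  let ?N = "{..<p}"
  show "wedge ws \<iota> = (\<Sum>I\<in>multi_indices p. wedge ws (enum_index I) * wedge (axis_list I) \<iota>)"
  proof (cases "inj_on \<iota> ?N")
    case False
    have "wedge (axis_list I) \<iota> = 0" if "I \<in> multi_indices p" for I
      using False multi_indices_list(2)[OF that] by (intro wedge_eq_0) simp
    moreover have "wedge ws \<iota> = 0"
      using False p by (intro wedge_eq_0) simp
    ultimately show ?thesis by simp
  next
    case True
    define J where "J = {i \<in> {1..4::nat}. of_nat i \<in> \<iota> ` ?N}"
    have ofJ: "of_nat ` J = \<iota> ` ?N"
    proof
      show "\<iota> ` ?N \<subseteq> of_nat ` J"
      proof
        fix m assume "m \<in> \<iota> ` ?N"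
        moreover obtain i where "i \<in> {1..4::nat}" "m = of_nat i"
          using vec4_of_nat_cover by blast
        ultimately show "m \<in> of_nat ` J"
          by (intro image_eqI[of _ _ i]) (simp_all add: J_def)
      qed
    qed (auto simp: J_def)
    have "card J = card (of_nat ` J :: 4 set)"
      by (rule card_image[symmetric], rule inj_on_subset[OF inj_on_of_nat_4]) (auto simp: J_def)
    then have "card J = p"
      unfolding ofJ using True by (simp add: card_image)
    then have J: "J \<in> multi_indices p"
      by (auto simp: multi_indices_def J_def)
    note bij = enum_index_bij[OF J, unfolded ofJ]
    define \<pi> where "\<pi> k = (if k < p then inv_into ?N (enum_index J) (\<iota> k) else k)" for k
    have "bij_betw \<iota> ?N (\<iota> ` ?N)"
      using True by (rule inj_on_imp_bij_betw)
    from bij_betw_trans[OF this bij_betw_inv_into[OF bij]]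
    have "bij_betw \<pi> ?N ?N"
      by (rule bij_betw_cong[THEN iffD1, rotated]) (simp add: \<pi>_def)
    then have \<pi>: "\<pi> permutes ?N"
      by (rule bij_imp_permutes) (simp add: \<pi>_def)
    have eq: "\<iota> k = enum_index J (\<pi> k)" if "k < p" for k
      using that bij_betw_inv_into_right[OF bij, of "\<iota> k"] by (simp add: \<pi>_def)
    have w: "wedge us \<iota> = of_int (sign \<pi>) * wedge us (enum_index J)" if "length us = p" for us :: "(real^4) list"
      using wedge_permute[of \<pi> us "enum_index J"] wedge_cong[of us \<iota> "\<lambda>k. enum_index J (\<pi> k)"] \<pi> eq that
      by simp
    have "(\<Sum>I\<in>multi_indices p. wedge ws (enum_index I) * wedge (axis_list I) \<iota>)
        = (\<Sum>I\<in>multi_indices p. if I = J then wedge ws (enum_index J) * of_int (sign \<pi>) else 0)"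
    proof (intro sum.cong refl)
      fix I assume I: "I \<in> multi_indices p"
      have "wedge (axis_list I) \<iota> = of_int (sign \<pi>) * (if I = J then 1 else 0)"
        using w[of "axis_list I"] wedge_axis[OF I J] multi_indices_list(2)[OF I] by simp
      then show "wedge ws (enum_index I) * wedge (axis_list I) \<iota> =
          (if I = J then wedge ws (enum_index J) * of_int (sign \<pi>) else 0)"
        by simp
    qed
    also have "\<dots> = wedge ws \<iota>"
      using J by (simp add: w[OF p])
    finally show ?thesis by simp
  qed
qed

text \<open>\<open>engel_coords x\<close> maps the frame at \<open>x\<close> to the standard basis, so the expansion in the frame is the
  pullback of \<open>wedge_expand\<close>; applying the map to any other expansion and evaluating at
  \<open>enum_index J\<close> shows that its coefficients are the same.\<close>

lemma frame_coeff_wedge: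
  assumes p: "length vs = p" and I: "I \<in> multi_indices p"
  shows "frame_coeff p x (wedge vs) I = wedge (map (engel_coords x) vs) (enum_index I)"
proof -
  define A where "A = matrix (engel_coords x)"
  have A: "(*v) A = engel_coords x"
    unfolding A_def using linear_engel_coords by (auto simp: matrix_works)
  have "inj (engel_coords x)"
    using linear_engel_coords by (simp add: linear_injective_0)
  then obtain g where g: "linear g" "g \<circ> engel_coords x = id"
    using linear_injective_left_inverse[OF linear_engel_coords] by blast
  define B where "B = matrix g"
  have B: "(*v) B = g"
    unfolding B_def using g(1) by (auto simp: matrix_works)
  have gA: "g (engel_coords x v) = v" for v
    using g(2) by (metis comp_apply id_apply)
  let ?fr = "\<lambda>I. map (\<lambda>i. engel_frame i x) (sorted_list_of_set I)"
  have frA: "map (engel_coords x) (?fr J) = axis_list J" if "J \<in> multi_indices p" for J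
    using multi_indices_list[OF that] engel_coords_frame by (auto simp: subset_iff)
  have frB: "map g (axis_list J) = ?fr J" if "J \<in> multi_indices p" for J
    unfolding frA[OF that, symmetric] by (simp add: gA o_def)
  define c where "c J = (if J \<in> multi_indices p then wedge (map (engel_coords x) vs) (enum_index J) else 0)" for J
  have "frame_coeff p x (wedge vs) = c"
    unfolding frame_coeff_def
  proof (rule the_equality, intro conjI allI impI)
    have "wedge (map (engel_coords x) vs) = (\<lambda>\<iota>. \<Sum>J\<in>multi_indices p. c J * wedge (axis_list J) \<iota>)"
      using wedge_expand[of "map (engel_coords x) vs" p] p by (simp add: c_def)
    then have "wedge (map g (map (engel_coords x) vs)) = (\<lambda>\<iota>. \<Sum>J\<in>multi_indices p. c J * wedge (map g (axis_list J)) \<iota>)"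
      unfolding B[symmetric] by (rule wedge_matrix_sum) (simp add: multi_indices_def p)
    moreover have "map g (map (engel_coords x) vs) = vs"
      by (simp add: gA o_def map_idI)
    ultimately show "wedge vs = (\<lambda>\<iota>. \<Sum>J\<in>multi_indices p. c J * frame_wedge x J \<iota>)"
      by (simp only: frame_wedge_def frB cong: sum.cong)
  next
    fix d assume d: "(\<forall>I. I \<notin> multi_indices p \<longrightarrow> d I = 0) \<and>
             wedge vs = (\<lambda>\<iota>. \<Sum>I\<in>multi_indices p. d I * frame_wedge x I \<iota>)"
    then have "wedge vs = (\<lambda>\<iota>. \<Sum>I\<in>multi_indices p. d I * wedge (?fr I) \<iota>)"
      by (simp add: frame_wedge_def)
    then have "wedge (map (engel_coords x) vs) = (\<lambda>\<iota>. \<Sum>I\<in>multi_indices p. d I * wedge (map (engel_coords x) (?fr I)) \<iota>)"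
      unfolding A[symmetric] by (rule wedge_matrix_sum) (simp add: multi_indices_def p)
    then have e: "wedge (map (engel_coords x) vs) = (\<lambda>\<iota>. \<Sum>I\<in>multi_indices p. d I * wedge (axis_list I) \<iota>)"
      by (simp only: frA cong: sum.cong)
    have "d J = c J" for J
    proof (cases "J \<in> multi_indices p")
      case True
      then show ?thesis
        by (simp add: c_def e wedge_axis if_distrib cong: if_cong sum.cong)
    qed (use d in \<open>simp add: c_def\<close>)
    then show "d = c" by blast
  qed (simp add: c_def)
  then show ?thesis
    using I by (simp add: c_def)
qed

lemma wedge_eq_det:
  fixes b :: "'q::finite \<Rightarrow> nat" and vs :: "(real^'n) list"
  assumes b: "bij_betw b UNIV {..<length vs}"
  shows "wedge vs \<iota> = det (\<chi> k l. (vs ! b l) $ \<iota> (b k) :: real^'q^'q)"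
proof -
  let ?N = "{..<length vs}"
  have inj: "inj b" using b by (simp add: bij_betw_def)
  have ib: "bij_betw (inv b) ?N UNIV"
    using bij_betw_inv_into[OF b] .
  have "wedge vs \<iota> = (\<Sum>\<sigma> | \<sigma> permutes (UNIV :: 'q set). of_int (sign \<sigma>) *
      (\<Prod>k\<in>UNIV. (vs ! b (\<sigma> k)) $ \<iota> (b k)))"
    unfolding wedge_def
  proof (rule sum.reindex_bij_witness[where j = "map_permutation ?N (inv b)" and i = "map_permutation UNIV b"], goal_cases)
    case (1 \<sigma>)
    then show ?case
      using map_permutation_compose_inv[OF ib, of \<sigma> b] b
      by (auto simp: f_inv_into_f bij_betw_def)
  next
    case (2 \<sigma>)
    then show ?case
      using map_permutation_permutes[OF ib] by auto
  next
    case (3 \<sigma>)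
    then show ?case
      using map_permutation_compose_inv[OF b, of \<sigma> "inv b"] inj by auto
  next
    case (4 \<sigma>)
    then show ?case
      using map_permutation_permutes[OF b] by auto
  next
    case (5 \<sigma>)
    then have \<sigma>: "\<sigma> permutes ?N" by simp
    have "sign (map_permutation ?N (inv b) \<sigma>) = sign \<sigma>"
      using ib \<sigma> by (intro sign_map_permutation) (auto simp: bij_betw_def)
    moreover have "b (map_permutation ?N (inv b) \<sigma> k) = \<sigma> (b k)" for k
    proof -
      have bk: "b k \<in> ?N" using b by (auto simp: bij_betw_def)
      then have "map_permutation ?N (inv b) \<sigma> (inv b (b k)) = inv b (\<sigma> (b k))"
        using ib by (intro map_permutation_apply) (auto simp: bij_betw_def)
      moreover have "\<sigma> (b k) \<in> range b"
        using bk permutes_in_image[OF \<sigma>] b by (auto simp: bij_betw_def)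
      ultimately show ?thesis
        using inj by (simp add: f_inv_into_f)
    qed
    moreover have "(\<Prod>k\<in>?N. (vs ! \<sigma> k) $ \<iota> k) = (\<Prod>k\<in>UNIV. (vs ! \<sigma> (b k)) $ \<iota> (b k))"
      by (rule prod.reindex_bij_betw[OF b, symmetric])
    ultimately show ?case by simp
  qed
  then show ?thesis by (simp add: det_def)
qed

text \<open>A component of \<open>f v\<^sub>1 \<and> \<dots> \<and> f v\<^sub>p\<close> is a determinant, and the kernel of its matrix consists of the
  coefficient vectors of those \<open>v\<close> in the span for which the selected entries of \<open>f v\<close> vanish. Its
  rows and columns are indexed by \<open>'q\<close>.\<close>

lemma wedge_nonzero_iff:
  fixes vs :: "(real^'n) list"
  assumes CARD: "length vs = CARD('q::finite)" and dist: "distinct vs" and indep: "independent (set vs)"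
    and f: "linear f" "inj f"
  shows "wedge (map f vs) \<iota> \<noteq> 0 \<longleftrightarrow>
    (\<forall>v\<in>span (set vs). (\<forall>k<length vs. f v $ \<iota> k = 0) \<longrightarrow> v = 0)"
proof -
  obtain b :: "'q \<Rightarrow> nat" where b: "bij_betw b UNIV {..<length vs}"
    using CARD by (metis card_lessThan finite_class.finite_UNIV finite_lessThan finite_same_card_bij)
  have bl: "b l < length vs" for l
    using b by (auto simp: bij_betw_def)
  define N where "N = (\<chi> k l. f (vs ! b l) $ \<iota> (b k) :: real^'q^'q)"
  define V where "V y = (\<Sum>l\<in>UNIV. y $ l *\<^sub>R vs ! b l)" for y :: "real^'q"
  have "wedge (map f vs) \<iota> = det N"
    unfolding N_def using wedge_eq_det[of b "map f vs" \<iota>] b bl by simp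
  then have 1: "wedge (map f vs) \<iota> \<noteq> 0 \<longleftrightarrow> (\<forall>y. N *v y = 0 \<longrightarrow> y = 0)"
    by (metis invertible_det_nz invertible_left_inverse matrix_left_invertible_ker)
  have bij: "bij_betw (\<lambda>l. vs ! b l) UNIV (set vs)"
    using bij_betw_trans[OF b bij_betw_nth[OF dist refl refl]] by (simp add: o_def)
  have 2: "(N *v y = 0) = (\<forall>k<length vs. f (V y) $ \<iota> k = 0)" for y
  proof -
    have "(N *v y) $ k = f (V y) $ \<iota> (b k)" for k
      unfolding V_def N_def using f(1)
      by (simp add: linear_sum linear_scale matrix_vector_mult_def mult.commute)
    then have "(N *v y = 0) = (\<forall>k\<in>UNIV. f (V y) $ \<iota> (b k) = 0)"
      by (simp add: vec_eq_iff)
    also have "\<dots> = (\<forall>k\<in>b ` UNIV. f (V y) $ \<iota> k = 0)" by blast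
    also have "b ` UNIV = {..<length vs}"
      using b by (simp add: bij_betw_def)
    finally show ?thesis by auto
  qed
  have 3: "V y = 0 \<longleftrightarrow> y = 0" for y
  proof
    assume "V y = 0"
    have inv: "inv_into UNIV (\<lambda>l. vs ! b l) (vs ! b l) = l" for l
      using inv_f_f[of "\<lambda>l. vs ! b l" l] bij by (simp add: bij_betw_def)
    then have "V y = (\<Sum>v\<in>set vs. y $ (inv_into UNIV (\<lambda>l. vs ! b l) v) *\<^sub>R v)"
      unfolding V_def by (subst sum.reindex_bij_betw[OF bij, symmetric]) simp
    with \<open>V y = 0\<close> have z: "y $ (inv_into UNIV (\<lambda>l. vs ! b l) v) = 0" if "v \<in> set vs" for v
      by (intro independentD[OF indep List.finite_set order_refl _ that]) simp
    have "y $ l = 0" for l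
      using z[of "vs ! b l"] bl[of l] by (simp add: inv)
    then show "y = 0" by (simp add: vec_eq_iff)
  qed (simp add: V_def)
  have 4: "span (set vs) = range V"
  proof
    show "span (set vs) \<subseteq> range V"
    proof
      fix v assume "v \<in> span (set vs)"
      then obtain u where "v = (\<Sum>w\<in>set vs. u w *\<^sub>R w)"
        by (auto simp: span_finite)
      also have "\<dots> = (\<Sum>l\<in>UNIV. u (vs ! b l) *\<^sub>R vs ! b l)"
        by (rule sum.reindex_bij_betw[OF bij, symmetric])
      also have "\<dots> = V (\<chi> l. u (vs ! b l))"
        by (simp add: V_def)
      finally show "v \<in> range V" by blast
    qed
    show "range V \<subseteq> span (set vs)"
      unfolding V_def using bl by (auto intro!: span_sum span_scale intro: span_base)
  qed
  show ?thesis
    unfolding 1 2 4 using 3 by auto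
qed

section \<open>Tangent spaces and the pointwise degree\<close>

text \<open>Straight lines in the parameter domain give one inclusion. For the other one, a curve \<open>\<gamma>\<close> in \<open>S\<close> is
  pulled back by the continuous inverse \<open>\<psi>\<close>. Since the derivative of \<open>\<phi>\<close> at \<open>u\<close> is bounded
  below, the parameter moves by at most a multiple of \<open>t\<close>, so \<open>\<gamma>'(0)\<close> is a limit of vectors in the range, which is closed.\<close>

lemma tangent_space_parametrization:
  fixes \<phi> :: "real^'q \<Rightarrow> real^'n" and \<phi>' :: "real^'q \<Rightarrow> (real^'q) \<Rightarrow>\<^sub>L (real^'n)"
  assumes W: "openin (top_of_set S) W" and U: "open U" and hom: "homeomorphism U W \<phi> \<psi>"
    and der: "\<And>u. u \<in> U \<Longrightarrow> (\<phi> has_derivative blinfun_apply (\<phi>' u)) (at u)"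
    and cont: "continuous_on U \<phi>'" and u: "u \<in> U" and inj: "inj (blinfun_apply (\<phi>' u))"
  shows "tangent_space S (\<phi> u) = range (blinfun_apply (\<phi>' u))"
proof
  have WS: "W \<subseteq> S"
    using W openin_imp_subset by blast
  have \<phi>W: "\<phi> y \<in> W" if "y \<in> U" for y
    using hom that by (auto simp: homeomorphism_def)
  show "range (blinfun_apply (\<phi>' u)) \<subseteq> tangent_space S (\<phi> u)"
  proof
    fix v assume "v \<in> range (blinfun_apply (\<phi>' u))"
    then obtain w where v: "v = \<phi>' u w" by blast
    obtain r where r: "0 < r" "ball u r \<subseteq> U"
      using U u openE by blast
    define e where "e = r / (norm w + 1)"
    have "0 < norm w + 1" by (simp add: add_nonneg_pos)
    then have e: "0 < e" using r by (simp add: e_def)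
    have in_U: "u + t *\<^sub>R w \<in> U" if "t \<in> {-e<..<e}" for t
    proof -
      have "\<bar>t\<bar> * norm w \<le> \<bar>t\<bar> * (norm w + 1)" by (intro mult_left_mono) auto
      also have "\<dots> < e * (norm w + 1)"
        using that \<open>0 < norm w + 1\<close> by (intro mult_strict_right_mono) auto
      also have "\<dots> = r" using \<open>0 < norm w + 1\<close> by (simp add: e_def)
      finally show ?thesis using r(2) by (auto simp: dist_norm)
    qed
    define \<gamma> where "\<gamma> t = \<phi> (u + t *\<^sub>R w)" for t
    have d: "(\<gamma> has_vector_derivative \<phi>' (u + t *\<^sub>R w) w) (at t)" if "t \<in> {-e<..<e}" for t
    proof -
      have "((\<lambda>t. u + t *\<^sub>R w) has_derivative (\<lambda>h. h *\<^sub>R w)) (at t)"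
        by (auto intro!: derivative_eq_intros)
      from diff_chain_at[OF this der[OF in_U[OF that]]]
      have "(\<gamma> has_derivative (\<lambda>h. \<phi>' (u + t *\<^sub>R w) (h *\<^sub>R w))) (at t)"
        by (simp add: o_def \<gamma>_def[abs_def])
      then show ?thesis
        by (simp add: has_vector_derivative_def blinfun.scaleR_right)
    qed
    have "continuous_on {-e<..<e} (\<lambda>t. \<phi>' (u + t *\<^sub>R w) w)"
    proof (intro continuous_intros)
      have "continuous_on {-e<..<e} (\<phi>' \<circ> (\<lambda>t. u + t *\<^sub>R w))"
        using in_U by (intro continuous_on_compose continuous_intros continuous_on_subset[OF cont]) auto
      then show "continuous_on {-e<..<e} (\<lambda>t. \<phi>' (u + t *\<^sub>R w))"
        by (simp add: o_def)
    qed
    then have "\<gamma> C1_differentiable_on {-e<..<e}"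
      using d unfolding C1_differentiable_on_def
      by (intro exI[of _ "\<lambda>t. \<phi>' (u + t *\<^sub>R w) w"] conjI ballI)
    moreover have "\<gamma> ` {-e<..<e} \<subseteq> S"
      using in_U \<phi>W WS by (auto simp: \<gamma>_def)
    moreover have "\<gamma> 0 = \<phi> u" "(\<gamma> has_vector_derivative v) (at 0)"
      using d[of 0] e v by (simp_all add: \<gamma>_def)
    ultimately show "v \<in> tangent_space S (\<phi> u)"
      unfolding tangent_space_def using e by blast
  qed
  show "tangent_space S (\<phi> u) \<subseteq> range (blinfun_apply (\<phi>' u))"
  proof
    fix v assume "v \<in> tangent_space S (\<phi> u)"
    then obtain \<gamma> e0 where e0: "0 < e0" and \<gamma>S: "\<gamma> ` {-e0<..<e0} \<subseteq> S" and \<gamma>0: "\<gamma> 0 = \<phi> u"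
      and \<gamma>v: "(\<gamma> has_vector_derivative v) (at 0)"
      unfolding tangent_space_def by blast
    have lin: "linear (blinfun_apply (\<phi>' u))"
      by (rule bounded_linear.linear[OF blinfun.bounded_linear_right])
    obtain B where B: "0 < B" "\<And>h. B * norm h \<le> norm (\<phi>' u h)"
      using linear_inj_bounded_below_pos[OF lin inj] by metis
    have "v \<in> closure (range (blinfun_apply (\<phi>' u)))"
      unfolding closure_approachable
    proof (intro allI impI)
      fix e :: real assume e: "0 < e"
      define K where "K = norm v + 1"
      have K: "0 < K" by (simp add: K_def add_nonneg_pos)
      define \<epsilon> where "\<epsilon> = min (B / 2) (B * e / (4 * K))"
      have \<epsilon>: "0 < \<epsilon>" using B e K by (simp add: \<epsilon>_def)
      obtain d2 where d2: "0 < d2"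
        "\<And>y. norm (y - u) < d2 \<Longrightarrow> norm (\<phi> y - \<phi> u - \<phi>' u (y - u)) \<le> \<epsilon> * norm (y - u)"
        using der[OF u] \<epsilon> unfolding has_derivative_at_alt by blast
      define \<epsilon>1 where "\<epsilon>1 = min 1 (e / 4)"
      have \<epsilon>1: "0 < \<epsilon>1" using e by (simp add: \<epsilon>1_def)
      obtain d1 where d1: "0 < d1" "\<And>t. \<bar>t\<bar> < d1 \<Longrightarrow> norm (\<gamma> t - \<phi> u - t *\<^sub>R v) \<le> \<epsilon>1 * \<bar>t\<bar>"
        using \<gamma>v \<epsilon>1 unfolding has_vector_derivative_def has_derivative_at_alt by (auto simp: \<gamma>0)
      obtain d3 where d3: "0 < d3" "\<And>y. y \<in> W \<Longrightarrow> dist y (\<phi> u) < d3 \<Longrightarrow> dist (\<psi> y) u < d2"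
        using hom \<phi>W[OF u] d2(1) u unfolding homeomorphism_def continuous_on_iff by metis
      obtain T where T: "open T" "W = S \<inter> T"
        using W by (auto simp: openin_open)
      then obtain d4 where d4: "0 < d4" "ball (\<phi> u) d4 \<subseteq> T"
        using \<phi>W[OF u] openE by (metis IntE)
      have "isCont \<gamma> 0"
        using \<gamma>v has_vector_derivative_continuous by blast
      then obtain d5 where d5: "0 < d5" "\<And>t. \<bar>t\<bar> < d5 \<Longrightarrow> dist (\<gamma> t) (\<phi> u) < min d3 d4"
        using \<open>isCont \<gamma> 0\<close>[unfolded continuous_at_eps_delta, rule_format, of "min d3 d4"] d3(1) d4(1)
        by (auto simp: \<gamma>0)
      define t where "t = min (min d1 d5) e0 / 2"
      have t: "0 < t" "t < d1" "t < d5" "t < e0"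
        using d1 d5 e0 by (auto simp: t_def)
      have "\<gamma> t \<in> S" using \<gamma>S t by auto
      moreover have "\<gamma> t \<in> T" using d5(2)[of t] t d4(2) by (auto simp: dist_commute)
      ultimately have \<gamma>W: "\<gamma> t \<in> W" using T by blast
      define h where "h = \<psi> (\<gamma> t) - u"
      have "norm h < d2"
        using d3(2)[OF \<gamma>W] d5(2)[of t] t by (simp add: h_def dist_norm)
      moreover have "\<phi> (u + h) = \<gamma> t"
        using hom \<gamma>W by (simp add: h_def homeomorphism_def)
      ultimately have 1: "norm (\<gamma> t - \<phi> u - \<phi>' u h) \<le> \<epsilon> * norm h"
        using d2(2)[of "u + h"] by simp
      have "\<epsilon> * norm h \<le> B / 2 * norm h"
        by (intro mult_right_mono) (auto simp: \<epsilon>_def)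
      then have hB: "B / 2 * norm h \<le> norm (\<gamma> t - \<phi> u)"
        using 1 B(2)[of h] norm_triangle_ineq2[of "\<phi>' u h" "\<gamma> t - \<phi> u"]
        by (simp add: norm_minus_commute)
      have 2: "norm (\<gamma> t - \<phi> u - t *\<^sub>R v) \<le> \<epsilon>1 * t"
        using d1(2)[of t] t by simp
      have "\<epsilon>1 * t \<le> 1 * t"
        using t by (intro mult_right_mono) (auto simp: \<epsilon>1_def)
      moreover have "K * t = t * norm v + 1 * t"
        by (simp add: K_def algebra_simps)
      moreover have "norm (t *\<^sub>R v) = t * norm v"
        using t by simp
      ultimately have "norm (\<gamma> t - \<phi> u) \<le> K * t"
        using 2 norm_triangle_ineq2[of "\<gamma> t - \<phi> u" "t *\<^sub>R v"] by linarith
      with hB have "B / 2 * norm h \<le> K * t" by linarith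
      then have "norm h \<le> 2 * K * t / B"
        using B(1) by (simp add: field_simps)
      have "\<epsilon> * norm h \<le> (B * e / (4 * K)) * (2 * K * t / B)"
        using \<open>norm h \<le> 2 * K * t / B\<close> \<epsilon> B(1) e K by (intro mult_mono) (auto simp: \<epsilon>_def)
      also have "\<dots> = e * t / 2"
        using B(1) K by (simp add: field_simps)
      finally have 3: "\<epsilon> * norm h \<le> e * t / 2" .
      have "\<epsilon>1 * t \<le> e / 4 * t"
        using t by (intro mult_right_mono) (auto simp: \<epsilon>1_def)
      then have "norm (\<phi>' u h - t *\<^sub>R v) \<le> e * t / 2 + e / 4 * t"
        using 1 2 3 norm_triangle_ineq4[of "\<gamma> t - \<phi> u - t *\<^sub>R v" "\<gamma> t - \<phi> u - \<phi>' u h"]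
        by (simp add: algebra_simps)
      also have "\<dots> = (3 / 4 * e) * t" by simp
      also have "\<dots> < e * t" using e t by simp
      finally have "norm (\<phi>' u h - t *\<^sub>R v) < e * t" .
      moreover have "\<phi>' u h - t *\<^sub>R v = t *\<^sub>R (\<phi>' u ((1 / t) *\<^sub>R h) - v)"
        using t by (simp add: blinfun.scaleR_right scaleR_diff_right)
      ultimately have "dist (\<phi>' u ((1 / t) *\<^sub>R h)) v < e"
        using t by (simp add: dist_norm)
      then show "\<exists>y\<in>range (blinfun_apply (\<phi>' u)). dist y v < e" by blast
    qed
    moreover have "closed (range (blinfun_apply (\<phi>' u)))"
      using lin by (intro closed_subspace linear_subspace_image) auto
    ultimately show "v \<in> range (blinfun_apply (\<phi>' u))" by simp
  qed
qed

definition index_weight :: "nat set \<Rightarrow> nat" where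
  "index_weight I = (\<Sum>i\<in>I. engel_weight i)"

text \<open>The index sets whose frame coordinates at \<open>x\<close> are linear coordinates on the range of \<open>f\<close>; they are
  the \<open>I\<close> with nonzero coefficient in its \<open>p\<close>-vector.\<close>

definition coordinate_sets :: "real^4 \<Rightarrow> (real^'q \<Rightarrow> real^4) \<Rightarrow> nat set set" where
  "coordinate_sets x f = {I \<in> multi_indices CARD('q).
     \<forall>h. (\<forall>i\<in>I. engel_coords x (f h) $ of_nat i = 0) \<longrightarrow> h = 0}"

text \<open>The four coordinate functionals span the dual of the domain, so some of them form a basis of it.\<close>

lemma coordinate_sets_nonempty:
  fixes f :: "real^'q::finite \<Rightarrow> real^4"
  assumes f: "linear f" "inj f"
  shows "coordinate_sets x f \<noteq> {}"
proof -
  define g where "g h = engel_coords x (f h)" for h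
  have g: "linear g"
    using linear_compose[OF f(1) linear_engel_coords] by (simp add: o_def g_def[abs_def])
  have g0: "h = 0" if "g h = 0" for h
    using that f linear_injective_0 unfolding g_def by auto
  define r where "r i = adjoint g (axis (of_nat i) 1)" for i :: nat
  have r: "g h $ of_nat i = h \<bullet> r i" for h i
    using adjoint_works[OF g, of h "axis (of_nat i) 1"] by (simp add: r_def inner_axis)
  obtain B where B: "B \<subseteq> r ` {1..4}" "independent B" "r ` {1..4} \<subseteq> span B"
    using maximal_independent_subset by blast
  have perp: "h = 0" if "\<And>b. b \<in> B \<Longrightarrow> h \<bullet> b = 0" for h
  proof (rule g0)
    have "orthogonal h y" if "y \<in> span B" for y
      by (rule orthogonal_to_span[OF that]) (use \<open>\<And>b. b \<in> B \<Longrightarrow> h \<bullet> b = 0\<close> in \<open>auto simp: orthogonal_def\<close>)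
    then have "g h $ of_nat i = 0" if "i \<in> {1..4}" for i
      using B(3) that by (simp add: r orthogonal_def image_subset_iff)
    then show "g h = 0" by (simp add: vec4_eq_of_nat)
  qed
  have "span B = UNIV"
  proof (rule ccontr)
    assume "span B \<noteq> UNIV"
    then obtain a where "a \<noteq> 0" "\<forall>x\<in>span B. a \<bullet> x = 0"
      using span_not_UNIV_orthogonal by blast
    then show False using perp[of a] span_base by blast
  qed
  then have cB: "card B = CARD('q)"
    using B(2) by (metis dim_UNIV dim_span dim_eq_card_independent DIM_cart DIM_real mult_1_right dim_span_eq_card_independent)
  obtain I where I: "I \<subseteq> {1..4}" "inj_on r I" "B = r ` I"
    using B(1) by (auto dest!: subset_image_inj[THEN iffD1])
  have "I \<in> coordinate_sets x f"
    unfolding coordinate_sets_def multi_indices_def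
    using I cB perp by (auto simp: card_image g_def[symmetric] r)
  then show ?thesis by blast
qed

lemma pointwise_degree_eq:
  fixes f :: "real^'q::finite \<Rightarrow> real^4"
  assumes f: "linear f" "inj f" and T: "tangent_space S x = range f"
  shows "pointwise_degree S x = Max (index_weight ` coordinate_sets x f)"
proof -
  let ?T = "tangent_space S x"
  define vs where "vs = (SOME vs. basis_list ?T vs)"
  obtain B where B: "B \<subseteq> ?T" "independent B" "?T \<subseteq> span B"
    using maximal_independent_subset by blast
  have sub: "subspace ?T"
    unfolding T using f(1) by (intro linear_subspace_image) auto
  have "finite B" using B(2) by (rule independent_imp_finite)
  then obtain bs where "set bs = B" "distinct bs"
    using finite_distinct_list by blast
  moreover have "span B = ?T"
    using B sub by (metis span_minimal subset_antisym)
  ultimately have "basis_list ?T bs"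
    using B by (simp add: basis_list_def)
  then have "basis_list ?T vs"
    unfolding vs_def by (rule someI)
  then have vs: "distinct vs" "independent (set vs)" "span (set vs) = range f"
    by (auto simp: basis_list_def T)
  have "length vs = dim (range f)"
    using vs by (metis distinct_card dim_span dim_eq_card_independent)
  also have "\<dots> = CARD('q)"
    using dim_image_eq[OF f(1), of UNIV] f(2) by (simp add: inj_on_def inj_def)
  finally have len: "length vs = CARD('q)" .
  have iff: "frame_coeff CARD('q) x (wedge vs) I \<noteq> 0 \<longleftrightarrow> I \<in> coordinate_sets x f"
    if I: "I \<in> multi_indices CARD('q)" for I
  proof -
    have "frame_coeff CARD('q) x (wedge vs) I = wedge (map (engel_coords x) vs) (enum_index I)"
      by (rule frame_coeff_wedge[OF len I])
    moreover have "wedge (map (engel_coords x) vs) (enum_index I) \<noteq> 0 \<longleftrightarrow>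
      (\<forall>v\<in>range f. (\<forall>k<length vs. engel_coords x v $ enum_index I k = 0) \<longrightarrow> v = 0)"
      unfolding vs(3)[symmetric] using linear_engel_coords
      by (intro wedge_nonzero_iff[OF len vs(1,2)]) (auto simp: linear_injective_0)
    moreover have "(\<forall>k<length vs. engel_coords x v $ enum_index I k = 0)
        \<longleftrightarrow> (\<forall>i\<in>(!) (sorted_list_of_set I) ` {..<CARD('q)}. engel_coords x v $ of_nat i = 0)" for v
      unfolding enum_index_def len by auto
    note this[unfolded nth_sorted_list_image[OF I]]
    moreover have "f h = 0 \<longleftrightarrow> h = 0" for h
      using f linear_injective_0 linear_0 by metis
    ultimately show ?thesis
      using I by (auto simp: coordinate_sets_def)
  qed
  have "coordinate_sets x f \<subseteq> multi_indices CARD('q)"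
    by (auto simp: coordinate_sets_def)
  then have "{\<Sum>i\<in>I. engel_weight i | I. I \<in> multi_indices CARD('q) \<and> frame_coeff CARD('q) x (wedge vs) I \<noteq> 0}
      = index_weight ` coordinate_sets x f"
    unfolding index_weight_def[abs_def] using iff by blast
  then show ?thesis
    by (simp add: pointwise_degree_def vs_def[symmetric] Let_def len multivector_degree_def)
qed

section \<open>Hausdorff measures with respect to a distance\<close>

lemma diam_wrt_le:
  assumes "x \<in> E" "y \<in> E"
  shows "ennreal (\<rho> x y) \<le> diam_wrt \<rho> E"
  unfolding diam_wrt_def using assms by (meson SUP_upper2 order_refl)

lemma enn2real_diam_wrt_le:
  assumes "x \<in> E" "y \<in> E" "diam_wrt \<rho> E \<le> ennreal \<delta>"
  shows "\<rho> x y \<le> enn2real (diam_wrt \<rho> E)"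
proof -
  have fin: "diam_wrt \<rho> E < top"
    using assms(3) by (rule le_less_trans) (simp add: ennreal_less_top)
  then have "ennreal (\<rho> x y) \<le> ennreal (enn2real (diam_wrt \<rho> E))"
    using diam_wrt_le[OF assms(1,2), of \<rho>] by simp
  then show ?thesis
    by (simp add: ennreal_le_iff)
qed

text \<open>Mass distribution principle. A covering set that meets \<open>f ` K\<close> lies in the closed ball about a
  common point whose radius is the diameter of the set. Radius \<open>0\<close> has to be included, since
  covering sets may be singletons, and \<open>s = 0\<close> has to be treated apart because of the
  convention for \<open>diam_powr\<close>.\<close>

lemma hausdorff_measure_nonzero:
  fixes f :: "'b \<Rightarrow> 'a"
  assumes K: "K \<in> sets M" "emeasure M K \<noteq> 0" and fK: "f ` K \<subseteq> A" and C: "0 < C"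
    and meas: "\<And>t r. t \<in> K \<Longrightarrow> 0 \<le> r \<Longrightarrow> {t' \<in> K. \<rho> (f t) (f t') \<le> r} \<in> sets M"
    and bound: "\<And>t r. t \<in> K \<Longrightarrow> 0 \<le> r \<Longrightarrow> emeasure M {t' \<in> K. \<rho> (f t) (f t') \<le> r} \<le> ennreal (C * r ^ D)"
    and s: "0 \<le> s" "s < real D"
  shows "hausdorff_measure \<rho> s A \<noteq> 0"
proof
  assume "hausdorff_measure \<rho> s A = 0"
  moreover have "hausdorff_premeasure \<rho> s 1 A \<le> hausdorff_measure \<rho> s A"
    unfolding hausdorff_measure_def by (rule SUP_upper) simp
  moreover have "emeasure M K / ennreal C \<le> hausdorff_premeasure \<rho> s 1 A"
    unfolding hausdorff_premeasure_def
  proof (rule Inf_greatest, clarify)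
    fix E :: "nat \<Rightarrow> 'a set" assume E: "A \<subseteq> (\<Union>i. E i)" and diam: "\<forall>i. diam_wrt \<rho> (E i) \<le> ennreal 1"
    define d where "d i = enn2real (diam_wrt \<rho> (E i))" for i
    have d1: "d i \<le> 1" for i
      unfolding d_def using diam by (intro enn2real_leI) auto
    have d0: "0 \<le> d i" for i by (simp add: d_def)
    define N where "N i = (if \<exists>t\<in>K. f t \<in> E i then {t' \<in> K. \<rho> (f (SOME t. t \<in> K \<and> f t \<in> E i)) (f t') \<le> d i} else {})" for i
    have N: "N i \<in> sets M \<and> K \<inter> f -` E i \<subseteq> N i \<and> emeasure M (N i) \<le> ennreal C * diam_powr \<rho> s (E i)" for i
    proof (cases "\<exists>t\<in>K. f t \<in> E i")
      case True
      define t where "t = (SOME t. t \<in> K \<and> f t \<in> E i)"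
      have "\<exists>t. t \<in> K \<and> f t \<in> E i"
        using True by blast
      from someI_ex[OF this] have t: "t \<in> K" "f t \<in> E i"
        by (simp_all add: t_def)
      have Ni: "N i = {t' \<in> K. \<rho> (f t) (f t') \<le> d i}"
        using True by (simp add: N_def t_def)
      have "K \<inter> f -` E i \<subseteq> N i"
        unfolding Ni d_def
        using enn2real_diam_wrt_le[OF t(2) _ diam[rule_format, of i]] by blast
      moreover have "d i ^ D \<le> enn2real (diam_powr \<rho> s (E i))"
      proof (cases "s = 0")
        case True
        then show ?thesis
          using t(2) d0 d1 by (auto simp: diam_powr_def power_le_one)
      next
        case False
        have "d i ^ D \<le> d i powr s"
        proof (cases "d i = 0")
          case True
          then show ?thesis using s False by (simp add: power_0_left)
        next
          case False
          then have "d i ^ D = d i powr real D"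
            using d0[of i] by (simp add: powr_realpow)
          also have "\<dots> \<le> d i powr s"
            using d0[of i] d1[of i] s False by (intro powr_mono') auto
          finally show ?thesis .
        qed
        then show ?thesis
          using t(2) False by (auto simp: diam_powr_def d_def)
      qed
      then have "C * d i ^ D \<le> C * enn2real (diam_powr \<rho> s (E i))"
        using C by simp
      then have "ennreal (C * d i ^ D) \<le> ennreal C * ennreal (enn2real (diam_powr \<rho> s (E i)))"
        using C by (simp add: ennreal_mult[symmetric])
      moreover have "ennreal (enn2real (diam_powr \<rho> s (E i))) = diam_powr \<rho> s (E i)"
        by (simp add: diam_powr_def)
      ultimately show ?thesis
        using meas[OF t(1) d0] bound[OF t(1) d0, of i] unfolding Ni by (auto intro: order_trans)
    qed (auto simp: N_def)
    have "K \<subseteq> (\<Union>i. N i)"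
    proof
      fix t assume t: "t \<in> K"
      then obtain i where "f t \<in> E i" using fK E by blast
      then show "t \<in> (\<Union>i. N i)" using N[of i] t by blast
    qed
    then have "emeasure M K \<le> emeasure M (\<Union>i. N i)"
      using N by (intro emeasure_mono) auto
    also have "\<dots> \<le> (\<Sum>i. emeasure M (N i))"
      using N by (intro emeasure_subadditive_countably) auto
    also have "\<dots> \<le> (\<Sum>i. ennreal C * diam_powr \<rho> s (E i))"
      using N by (intro suminf_le) auto
    also have "\<dots> = ennreal C * (\<Sum>i. diam_powr \<rho> s (E i))"
      by (rule ennreal_suminf_cmult)
    finally have "emeasure M K / ennreal C \<le> ennreal C * (\<Sum>i. diam_powr \<rho> s (E i)) / ennreal C"
      by (rule divide_right_mono_ennreal)
    also have "\<dots> = (\<Sum>i. diam_powr \<rho> s (E i))"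
      using C by (subst mult.commute) (simp add: mult_divide_eq_ennreal)
    finally show "emeasure M K / ennreal C \<le> (\<Sum>i. diam_powr \<rho> s (E i))" .
  qed
  ultimately have "emeasure M K / ennreal C = 0" by auto
  then show False
    using K(2) by (simp add: ennreal_divide_eq_0_iff)
qed

lemma hausdorff_measure_eq_0_iff:
  "hausdorff_measure \<rho> s A = 0 \<longleftrightarrow> (\<forall>\<delta>>0. hausdorff_premeasure \<rho> s \<delta> A = 0)"
  unfolding hausdorff_measure_def by (auto simp: SUP_eq_iff bot_ennreal[symmetric] SUP_bot_conv)

lemma hausdorff_measure_countable_Union:
  assumes "countable F" "\<And>A. A \<in> F \<Longrightarrow> hausdorff_measure \<rho> s A = 0"
  shows "hausdorff_measure \<rho> s (\<Union>F) = 0"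
  unfolding hausdorff_measure_eq_0_iff
proof (intro allI impI)
  fix \<delta> :: real assume \<delta>: "0 < \<delta>"
  define B where "B n = from_nat_into (insert {} F) n" for n
  have diam_empty: "diam_wrt \<rho> {} = 0" "diam_powr \<rho> s {} = 0"
    by (simp_all add: diam_wrt_def diam_powr_def bot_ennreal)
  have pre: "hausdorff_premeasure \<rho> s \<delta> (B n) = 0" for n
  proof -
    have "B n \<in> insert {} F"
      unfolding B_def by (rule from_nat_into) simp
    then consider "B n = {}" | "B n \<in> F" by blast
    then show ?thesis
    proof cases
      case 1
      have "hausdorff_premeasure \<rho> s \<delta> {} \<le> (\<Sum>i::nat. diam_powr \<rho> s {})"
        unfolding hausdorff_premeasure_def
        by (rule Inf_lower, rule CollectI, rule exI[of _ "\<lambda>_. {}"]) (simp add: diam_empty)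
      then show ?thesis by (simp add: 1 diam_empty)
    next
      case 2
      then show ?thesis
        using assms(2)[OF 2] \<delta> by (simp add: hausdorff_measure_eq_0_iff)
    qed
  qed
  show "hausdorff_premeasure \<rho> s \<delta> (\<Union>F) = 0"
  proof (rule ccontr)
    assume "hausdorff_premeasure \<rho> s \<delta> (\<Union>F) \<noteq> 0"
    then have "0 < hausdorff_premeasure \<rho> s \<delta> (\<Union>F)"
      by (simp add: zero_less_iff_neq_zero)
    then obtain e where e: "0 < e" "ennreal e < hausdorff_premeasure \<rho> s \<delta> (\<Union>F)"
      by (metis ennreal_less_zero_iff ennreal_cases dense ennreal_top_neq_zero not_less_zero top.not_eq_extremum order_less_imp_not_less)
    have "\<exists>E :: nat \<Rightarrow> _ set. B n \<subseteq> (\<Union>i. E i) \<and> (\<forall>i. diam_wrt \<rho> (E i) \<le> ennreal \<delta>) \<and>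
       (\<Sum>i. diam_powr \<rho> s (E i)) < ennreal (e * (1/2) ^ Suc n)" for n
    proof -
      have "hausdorff_premeasure \<rho> s \<delta> (B n) < ennreal (e * (1/2) ^ Suc n)"
        using e(1) by (simp add: pre)
      then show ?thesis
        unfolding hausdorff_premeasure_def Inf_less_iff by blast
    qed
    then obtain E :: "nat \<Rightarrow> nat \<Rightarrow> _ set" where E: "\<And>n. B n \<subseteq> (\<Union>i. E n i)"
      "\<And>n i. diam_wrt \<rho> (E n i) \<le> ennreal \<delta>"
      "\<And>n. (\<Sum>i. diam_powr \<rho> s (E n i)) < ennreal (e * (1/2) ^ Suc n)"
      by metis
    define G where "G k = (case prod_decode k of (n, i) \<Rightarrow> E n i)" for k
    have "\<Union>F \<subseteq> (\<Union>n. B n)"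
    proof -
      have "range B = insert {} F"
        unfolding B_def using assms(1) by (intro range_from_nat_into) auto
      then show ?thesis by blast
    qed
    also have "\<dots> \<subseteq> (\<Union>k. G k)"
    proof
      fix x assume "x \<in> (\<Union>n. B n)"
      then obtain n i where "x \<in> E n i" using E(1) by blast
      then have "x \<in> G (prod_encode (n, i))" by (simp add: G_def)
      then show "x \<in> (\<Union>k. G k)" by blast
    qed
    finally have "\<Union>F \<subseteq> (\<Union>k. G k)" .
    then have "hausdorff_premeasure \<rho> s \<delta> (\<Union>F) \<le> (\<Sum>k. diam_powr \<rho> s (G k))"
      unfolding hausdorff_premeasure_def using E(2)
      by (intro Inf_lower) (auto simp: G_def split: prod.split)
    also have "\<dots> = (\<Sum>n. \<Sum>i. diam_powr \<rho> s (E n i))"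
      using suminf_ennreal_2dimen[of "\<lambda>n. \<Sum>i. diam_powr \<rho> s (E n i)" "\<lambda>(n, i). diam_powr \<rho> s (E n i)"]
      by (simp add: o_def G_def case_prod_beta)
    also have "\<dots> \<le> (\<Sum>n. ennreal (e * (1/2) ^ Suc n))"
      using E(3) by (intro suminf_le) (auto intro: less_imp_le)
    also have "\<dots> = ennreal e"
    proof (rule suminf_ennreal_eq)
      show "(\<lambda>n. e * (1/2) ^ Suc n) sums e"
        using sums_mult[OF power_half_series, of e] by simp
    qed (use e in auto)
    finally show False using e(2) by simp
  qed
qed

lemma hausdorff_measure_mono:
  assumes "A \<subseteq> B" "hausdorff_measure \<rho> s B = 0"
  shows "hausdorff_measure \<rho> s A = 0"
proof -
  have "hausdorff_premeasure \<rho> s \<delta> A \<le> hausdorff_premeasure \<rho> s \<delta> B" for \<delta>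
    unfolding hausdorff_premeasure_def using assms(1) by (intro Inf_superset_mono) blast
  then show ?thesis
    using assms(2) unfolding hausdorff_measure_eq_0_iff by (metis le_zero_eq)
qed

text \<open>Balls of radius \<open>r\<close> about \<open>2 r\<close>-separated points of \<open>A\<close> are disjoint and have mass at least
  \<open>c r ^ D\<close>, so there are at most \<open>M(K) / (c r ^ D)\<close> such points, and the balls of radius \<open>2 r\<close> about a
  maximal family of them cover \<open>A\<close>.\<close>

lemma hausdorff_measure_eq_0_of_density:
  fixes f :: "'b \<Rightarrow> 'a"
  assumes met: "Metric_space UNIV \<rho>"
    and fin: "emeasure M K < \<infinity>" "K \<in> sets M"
    and c: "0 < c" "0 < R"
    and meas: "\<And>x r. x \<in> A \<Longrightarrow> {t \<in> K. \<rho> x (f t) < r} \<in> sets M"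
    and dens: "\<And>x r. x \<in> A \<Longrightarrow> 0 < r \<Longrightarrow> r < R \<Longrightarrow> ennreal (c * r ^ D) \<le> emeasure M {t \<in> K. \<rho> x (f t) < r}"
    and s: "real D < s"
  shows "hausdorff_measure \<rho> s A = 0"
  unfolding hausdorff_measure_eq_0_iff
proof (intro allI impI)
  fix \<delta> :: real assume \<delta>: "0 < \<delta>"
  interpret Metric_space UNIV \<rho> by (rule met)
  define m where "m = measure M K"
  have m: "emeasure M K = ennreal m"
    unfolding m_def using fin(1) by (simp add: emeasure_eq_ennreal_measure less_top)
  define cst where "cst = (m / c) * 4 powr s"
  have m0: "0 \<le> m" by (simp add: m_def)
  have cst: "0 \<le> cst" using m0 c by (simp add: cst_def)
  have key: "hausdorff_premeasure \<rho> s \<delta> A \<le> ennreal (cst * r powr (s - D))"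
    if r: "0 < r" "r < R" "4 * r \<le> \<delta>" for r
  proof -
    define sep where "sep F \<longleftrightarrow> finite F \<and> F \<subseteq> A \<and> (\<forall>x\<in>F. \<forall>y\<in>F. x \<noteq> y \<longrightarrow> 2 * r \<le> \<rho> x y)" for F
    have card: "real (card F) \<le> m / (c * r ^ D)" if F: "sep F" for F
    proof -
      let ?B = "\<lambda>x. {t \<in> K. \<rho> x (f t) < r}"
      have "disjoint_family_on ?B F"
        unfolding disjoint_family_on_def
      proof (intro ballI impI)
        fix x y assume xy: "x \<in> F" "y \<in> F" "x \<noteq> y"
        have "2 * r \<le> \<rho> x y"
          using F xy unfolding sep_def by blast
        then have "\<not> (\<rho> x (f t) < r \<and> \<rho> y (f t) < r)" for t
          using triangle[of x "f t" y] commute[of "f t" y] by auto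
        then show "?B x \<inter> ?B y = {}" by auto
      qed
      moreover have "?B ` F \<subseteq> sets M" "finite F"
        using F meas by (auto simp: sep_def)
      ultimately have "(\<Sum>x\<in>F. emeasure M (?B x)) = emeasure M (\<Union>x\<in>F. ?B x)"
        by (intro sum_emeasure)
      also have "\<dots> \<le> emeasure M K"
        using fin(2) by (intro emeasure_mono) auto
      finally have 1: "(\<Sum>x\<in>F. emeasure M (?B x)) \<le> ennreal m" using m by simp
      have "ennreal (real (card F) * (c * r ^ D)) = (\<Sum>x\<in>F. ennreal (c * r ^ D))"
        using c r by (simp add: ennreal_mult ennreal_of_nat_eq_real_of_nat)
      also have "\<dots> \<le> (\<Sum>x\<in>F. emeasure M (?B x))"
        using F r by (intro sum_mono dens) (auto simp: sep_def)
      also note 1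
      finally have "ennreal (real (card F) * (c * r ^ D)) \<le> ennreal m" .
      then have "real (card F) * (c * r ^ D) \<le> m"
        using m0 by simp
      then show ?thesis
        using c r by (simp add: pos_le_divide_eq)
    qed
    have "sep {}" by (simp add: sep_def)
    moreover have "\<forall>F. sep F \<longrightarrow> card F \<le> nat \<lfloor>m / (c * r ^ D)\<rfloor>"
      using card by (auto simp: le_nat_floor)
    ultimately obtain F where F: "sep F" and max: "\<And>G. sep G \<Longrightarrow> card G \<le> card F"
      using ex_has_greatest_nat[of sep "{}" card] by (metis le_imp_less_Suc)
    have cover: "\<exists>x\<in>F. \<rho> x y < 2 * r" if y: "y \<in> A" for y
    proof (rule ccontr)
      assume "\<not> ?thesis"
      then have far: "\<And>x. x \<in> F \<Longrightarrow> 2 * r \<le> \<rho> x y" by (auto simp: not_less)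
      then have "y \<notin> F" using r by fastforce
      have "sep (insert y F)"
        using F far y commute unfolding sep_def by (metis (no_types, lifting) finite_insert insertE insert_subset)
      then show False
        using max[of "insert y F"] \<open>y \<notin> F\<close> F by (simp add: sep_def)
    qed
    obtain e where e: "bij_betw e {..<card F} F"
      using F finite_same_card_bij[of "{..<card F}" F] by (auto simp: sep_def)
    define E where "E i = (if i < card F then {y \<in> A. \<rho> (e i) y < 2 * r} else {})" for i
    have dE: "diam_wrt \<rho> (E i) \<le> ennreal (4 * r)" for i
      unfolding diam_wrt_def
    proof (intro SUP_least ennreal_leI)
      fix x y assume "x \<in> E i" "y \<in> E i"
      then have "\<rho> (e i) x < 2 * r" "\<rho> (e i) y < 2 * r"
        by (auto simp: E_def split: if_splits)
      then show "\<rho> x y \<le> 4 * r"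
        using triangle[of x "e i" y] commute[of x "e i"] by auto
    qed
    have "A \<subseteq> (\<Union>i. E i)"
    proof
      fix y assume y: "y \<in> A"
      then obtain x where "x \<in> F" "\<rho> x y < 2 * r" using cover by blast
      moreover then obtain i where "i < card F" "x = e i"
        using e by (auto simp: bij_betw_def)
      ultimately show "y \<in> (\<Union>i. E i)" using y by (auto simp: E_def)
    qed
    moreover have "diam_wrt \<rho> (E i) \<le> ennreal \<delta>" for i
      using dE[of i] r(3) by (meson ennreal_leI order_trans)
    ultimately have "hausdorff_premeasure \<rho> s \<delta> A \<le> (\<Sum>i. diam_powr \<rho> s (E i))"
      unfolding hausdorff_premeasure_def by (intro Inf_lower) blast
    also have "\<dots> = (\<Sum>i<card F. diam_powr \<rho> s (E i))"
      by (intro suminf_finite) (auto simp: E_def diam_powr_def)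
    also have "\<dots> \<le> (\<Sum>i<card F. ennreal ((4 * r) powr s))"
    proof (intro sum_mono)
      fix i
      have "enn2real (diam_wrt \<rho> (E i)) \<le> 4 * r"
        using dE[of i] r(1) by (intro enn2real_leI) auto
      then have "enn2real (diam_wrt \<rho> (E i)) powr s \<le> (4 * r) powr s"
        using s by (intro powr_mono2) auto
      then show "diam_powr \<rho> s (E i) \<le> ennreal ((4 * r) powr s)"
        using s by (auto simp: diam_powr_def)
    qed
    also have "\<dots> = ennreal (real (card F) * (4 * r) powr s)"
      by (simp add: ennreal_mult ennreal_of_nat_eq_real_of_nat)
    also have "\<dots> \<le> ennreal (cst * r powr (s - D))"
    proof (intro ennreal_leI)
      have "real (card F) * (4 * r) powr s \<le> m / (c * r ^ D) * (4 * r) powr s"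
        using card[OF F] by (intro mult_right_mono) auto
      also have "\<dots> = cst * r powr (s - D)"
        using r(1) by (simp add: cst_def powr_mult powr_diff powr_realpow)
      finally show "real (card F) * (4 * r) powr s \<le> cst * r powr (s - D)" .
    qed
    finally show ?thesis .
  qed
  have "((\<lambda>r. ennreal (cst * r powr (s - D))) \<longlongrightarrow> ennreal (cst * 0)) (at_right 0)"
  proof (intro tendsto_intros tendsto_ennrealI)
    have "((\<lambda>r. r powr (s - D)) \<longlongrightarrow> 0 powr (s - D)) (at_right 0)"
      using s by (intro tendsto_powr2 tendsto_intros) (auto intro!: eventually_mono[OF eventually_at_right_less])
    then show "((\<lambda>r. r powr (s - D)) \<longlongrightarrow> 0) (at_right 0)" by simp
  qed
  moreover have "eventually (\<lambda>r. hausdorff_premeasure \<rho> s \<delta> A \<le> ennreal (cst * r powr (s - D))) (at_right 0)"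
    unfolding eventually_at_right_field
    by (intro exI[of _ "min R (\<delta> / 4)"]) (use \<delta> c in \<open>auto intro!: key\<close>)
  ultimately have "hausdorff_premeasure \<rho> s \<delta> A \<le> ennreal (cst * 0)"
    by (intro tendsto_lowerbound) auto
  then show "hausdorff_premeasure \<rho> s \<delta> A = 0" by simp
qed

section \<open>Preimages of boxes under nearly linear maps\<close>

lemma continuous_on_det_matrix:
  fixes F :: "'a::topological_space \<Rightarrow> (real^'q) \<Rightarrow>\<^sub>L (real^'q)"
  assumes "continuous_on S F"
  shows "continuous_on S (\<lambda>t. det (matrix (blinfun_apply (F t))))"
  unfolding det_def matrix_def using assms by (auto intro!: continuous_intros)

lemma measure_image_bounds:
  fixes G :: "real^'q::{finite,wellorder} \<Rightarrow> real^'q::_"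
    and G' :: "real^'q::_ \<Rightarrow> (real^'q::_) \<Rightarrow>\<^sub>L (real^'q::_)"
  assumes S: "compact S" and der: "\<And>t. t \<in> S \<Longrightarrow> (G has_derivative blinfun_apply (G' t)) (at t)"
    and cont: "continuous_on S G'" and inj: "inj_on G S"
    and c: "\<And>t. t \<in> S \<Longrightarrow> c \<le> \<bar>det (matrix (blinfun_apply (G' t)))\<bar>"
    and K: "\<And>t. t \<in> S \<Longrightarrow> \<bar>det (matrix (blinfun_apply (G' t)))\<bar> \<le> K"
  shows "c * measure lebesgue S \<le> measure lebesgue (G ` S)"
    and "measure lebesgue (G ` S) \<le> K * measure lebesgue S"
proof -
  let ?J = "\<lambda>t. \<bar>det (matrix (blinfun_apply (G' t)))\<bar>"
  have Sm: "S \<in> lmeasurable"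
    using S by (rule lmeasurable_compact)
  have "continuous_on S ?J"
    by (intro continuous_intros continuous_on_det_matrix cont)
  then have "set_integrable lborel S ?J"
    unfolding set_integrable_def using S by (rule borel_integrable_compact[rotated])
  then have int: "?J integrable_on S"
    by (rule set_borel_integral_eq_integral(1))
  have eq: "measure lebesgue (G ` S) = integral S ?J"
    using Sm der inj int by (intro measure_differentiable_image_eq) (auto intro: has_derivative_at_withinI)
  have const: "(\<lambda>t. b) integrable_on S" "integral S (\<lambda>t. b) = b * measure lebesgue S" for b :: real
    using Sm lmeasure_integral[OF Sm] integral_mult_right[of S b "\<lambda>_. 1"]
    by (auto intro: integrable_on_const)
  show "c * measure lebesgue S \<le> measure lebesgue (G ` S)"
    unfolding eq const(2)[symmetric] by (intro integral_le const int c)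
  show "measure lebesgue (G ` S) \<le> K * measure lebesgue S"
    unfolding eq const(2)[symmetric] by (intro integral_le const int K)
qed

text \<open>The closed ball of radius \<open>m\<close> about \<open>N0\<close> is compact and consists of injective maps; the constants
  come from the extrema of the determinant on it.\<close>

lemma blinfun_det_near:
  fixes N0 :: "(real^'q) \<Rightarrow>\<^sub>L (real^'q)"
  assumes "inj (blinfun_apply N0)"
  obtains m c K where "0 < m" "0 < c" "0 < K" "\<And>h. 2 * m * norm h \<le> norm (N0 h)"
    "\<And>N. norm (N - N0) \<le> m \<Longrightarrow> c \<le> \<bar>det (matrix (blinfun_apply N))\<bar>"
    "\<And>N. norm (N - N0) \<le> m \<Longrightarrow> \<bar>det (matrix (blinfun_apply N))\<bar> \<le> K"
proof -
  have lin: "linear (blinfun_apply N)" for N :: "(real^'q) \<Rightarrow>\<^sub>L (real^'q)"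
    by (rule bounded_linear.linear[OF blinfun.bounded_linear_right])
  obtain B where B: "0 < B" "\<And>h. B * norm h \<le> norm (N0 h)"
    using linear_inj_bounded_below_pos[OF lin assms] by metis
  define m where "m = B / 2"
  have m: "0 < m" "\<And>h. 2 * m * norm h \<le> norm (N0 h)"
    using B by (auto simp: m_def)
  let ?J = "\<lambda>N::(real^'q) \<Rightarrow>\<^sub>L (real^'q). \<bar>det (matrix (blinfun_apply N))\<bar>"
  have nz: "0 < ?J N" if "N \<in> cball N0 m" for N
  proof -
    have "N h = 0 \<Longrightarrow> h = 0" for h
    proof -
      assume "N h = 0"
      then have "norm (N0 h) = norm ((N0 - N) h)" by (simp add: blinfun.diff_left)
      also have "\<dots> \<le> norm (N0 - N) * norm h" by (rule norm_blinfun)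
      also have "\<dots> \<le> m * norm h" using that by (intro mult_right_mono) (auto simp: dist_norm)
      finally have "2 * m * norm h \<le> m * norm h" using m(2)[of h] by linarith
      then show "h = 0" using m(1) by (simp add: mult_le_0_iff)
    qed
    then have "inj (blinfun_apply N)"
      by (simp add: linear_injective_0[OF lin])
    then show ?thesis using det_nz_iff_inj[OF lin[of N]] by simp
  qed
  have cont: "continuous_on (cball N0 m) ?J"
    by (intro continuous_intros continuous_on_det_matrix)
  have ne: "cball N0 m \<noteq> {}" using m by auto
  obtain a where a: "a \<in> cball N0 m" "\<And>N. N \<in> cball N0 m \<Longrightarrow> ?J a \<le> ?J N"
    using continuous_attains_inf[OF compact_cball ne cont] by blast
  obtain b where b: "b \<in> cball N0 m" "\<And>N. N \<in> cball N0 m \<Longrightarrow> ?J N \<le> ?J b"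
    using continuous_attains_sup[OF compact_cball ne cont] by blast
  show thesis
    using that[of m "?J a" "?J b"] m a b nz[OF a(1)] nz[OF b(1)] by (simp add: dist_norm norm_minus_commute)
qed

lemma expanding_of_derivative_near:
  fixes G :: "'a::real_normed_vector \<Rightarrow> 'b::real_normed_vector" and N0 :: "'a \<Rightarrow>\<^sub>L 'b"
  assumes S: "convex S" and der: "\<And>t. t \<in> S \<Longrightarrow> (G has_derivative blinfun_apply (G' t)) (at t)"
    and near: "\<And>t. t \<in> S \<Longrightarrow> norm (G' t - N0) \<le> m" and N0: "\<And>h. 2 * m * norm h \<le> norm (N0 h)"
    and t: "t \<in> S" "t' \<in> S"
  shows "m * norm (t - t') \<le> norm (G t - G t')"
proof -
  have "norm ((G t - N0 t) - (G t' - N0 t')) \<le> m * norm (t - t')"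
  proof (rule differentiable_bound[OF S _ _ t])
    fix u assume u: "u \<in> S"
    show "((\<lambda>t. G t - N0 t) has_derivative blinfun_apply (G' u - N0)) (at u within S)"
      unfolding blinfun.diff_left
      by (intro derivative_intros has_derivative_at_withinI[OF der[OF u]]
          bounded_linear_imp_has_derivative blinfun.bounded_linear_right)
    show "onorm (blinfun_apply (G' u - N0)) \<le> m"
      using near[OF u] by (simp add: norm_blinfun.rep_eq)
  qed
  moreover have "(G t - N0 t) - (G t' - N0 t') = (G t - G t') - N0 (t - t')"
    by (simp add: blinfun.diff_right)
  ultimately show ?thesis
    using N0[of "t - t'"] norm_triangle_ineq2[of "N0 (t - t')" "G t - G t'"]
    by (simp add: norm_minus_commute)
qed

definition weighted_box :: "('q \<Rightarrow> nat) \<Rightarrow> real \<Rightarrow> (real^'q) set" where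
  "weighted_box e s = {q. \<forall>k. \<bar>q $ k\<bar> \<le> s ^ e k}"

lemma weighted_box_cbox: "weighted_box e s = cbox (\<chi> k. - (s ^ e k)) (\<chi> k. s ^ e k)"
  by (auto simp: weighted_box_def mem_box_cart abs_le_iff minus_le_iff)

lemma measure_weighted_box:
  fixes e :: "'q::finite \<Rightarrow> nat"
  assumes "0 \<le> s"
  shows "measure lebesgue (weighted_box e s) = 2 ^ CARD('q) * s ^ (\<Sum>k\<in>UNIV. e k)"
proof -
  have "0 \<in> weighted_box e s"
    using assms by (simp add: weighted_box_def)
  then have "cbox (\<chi> k. - (s ^ e k)) (\<chi> k. s ^ e k) \<noteq> {}"
    unfolding weighted_box_cbox by blast
  then have "measure lborel (weighted_box e s) = (\<Prod>k\<in>UNIV. 2 * s ^ e k)"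
    unfolding weighted_box_cbox by (subst content_cbox_cart) simp_all
  also have "\<dots> = 2 ^ CARD('q) * s ^ (\<Sum>k\<in>UNIV. e k)"
    by (simp add: prod.distrib power_sum)
  finally show ?thesis
    unfolding weighted_box_cbox by (simp add: measure_completion)
qed

lemma compact_weighted_box: "compact (weighted_box e s)"
  unfolding weighted_box_cbox by (rule compact_cbox)

lemma compact_preimage:
  fixes G :: "'a::euclidean_space \<Rightarrow> 'b::euclidean_space"
  assumes "compact S" "continuous_on S G" "closed Q"
  shows "compact {t \<in> S. G t \<in> Q}"
proof -
  have "closedin (top_of_set S) (S \<inter> G -` Q)"
    using assms(2,3) by (rule continuous_closedin_preimage)
  then have "compact (S \<inter> G -` Q)"
    using assms(1) closedin_compact by blast
  moreover have "S \<inter> G -` Q = {t \<in> S. G t \<in> Q}" by auto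
  ultimately show ?thesis by simp
qed

text \<open>The preimage \<open>P\<close> satisfies \<open>c |P| \<le> |G(P)| \<le> |Q|\<close>.\<close>

lemma measure_preimage_le:
  fixes G :: "real^'q::{finite,wellorder} \<Rightarrow> real^'q::_"
    and G' :: "real^'q::_ \<Rightarrow> (real^'q::_) \<Rightarrow>\<^sub>L (real^'q::_)"
  assumes S: "compact S" and der: "\<And>t. t \<in> S \<Longrightarrow> (G has_derivative blinfun_apply (G' t)) (at t)"
    and cont: "continuous_on S G'" and inj: "inj_on G S" and c0: "0 < c"
    and c: "\<And>t. t \<in> S \<Longrightarrow> c \<le> \<bar>det (matrix (blinfun_apply (G' t)))\<bar>"
    and K: "\<And>t. t \<in> S \<Longrightarrow> \<bar>det (matrix (blinfun_apply (G' t)))\<bar> \<le> K"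
    and Q: "compact Q"
  shows "measure lebesgue {t \<in> S. G t \<in> Q} \<le> measure lebesgue Q / c"
proof -
  let ?P = "{t \<in> S. G t \<in> Q}"
  have "continuous_on S G"
    using der has_derivative_continuous by (intro continuous_at_imp_continuous_on) blast
  then have P: "compact ?P"
    using S Q by (intro compact_preimage compact_imp_closed)
  have "c * measure lebesgue ?P \<le> measure lebesgue (G ` ?P)"
    using P der cont inj c K
    by (intro measure_image_bounds(1)[of _ _ G' _ K]) (auto intro: continuous_on_subset inj_on_subset)
  also have "\<dots> \<le> measure lebesgue Q"
  proof (intro measure_mono_fmeasurable)
    have "compact (G ` ?P)"
      using P \<open>continuous_on S G\<close> by (intro compact_continuous_image) (auto intro: continuous_on_subset)
    then show "G ` ?P \<in> sets lebesgue"
      by (auto dest: lmeasurable_compact)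
  qed (use Q in \<open>auto dest: lmeasurable_compact\<close>)
  finally show ?thesis
    using c0 by (simp add: field_simps)
qed

text \<open>The image of the ball contains a neighbourhood of \<open>G u\<close> by the open mapping property at \<open>u\<close>, so a
  small \<open>Q\<close> is the image of its whole preimage.\<close>

lemma measure_preimage_ge:
  fixes G :: "real^'q::{finite,wellorder} \<Rightarrow> real^'q::_"
    and G' :: "real^'q::_ \<Rightarrow> (real^'q::_) \<Rightarrow>\<^sub>L (real^'q::_)"
  assumes \<delta>: "0 < \<delta>" and der: "\<And>t. t \<in> cball u \<delta> \<Longrightarrow> (G has_derivative blinfun_apply (G' t)) (at t)"
    and cont: "continuous_on (cball u \<delta>) G'" and inj: "inj_on G (cball u \<delta>)"
    and inj': "inj (blinfun_apply (G' u))"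
    and K: "\<And>t. t \<in> cball u \<delta> \<Longrightarrow> \<bar>det (matrix (blinfun_apply (G' t)))\<bar> \<le> K"
  obtains \<eta> where "0 < \<eta>"
    "\<And>Q. compact Q \<Longrightarrow> Q \<subseteq> ball (G u) \<eta> \<Longrightarrow> measure lebesgue Q \<le> K * measure lebesgue {t \<in> cball u \<delta>. G t \<in> Q}"
proof -
  have lin: "linear (blinfun_apply (G' u))"
    by (rule bounded_linear.linear[OF blinfun.bounded_linear_right])
  obtain g where g: "linear g" "blinfun_apply (G' u) \<circ> g = id"
    using linear_surjective_right_inverse[OF lin linear_injective_imp_surjective[OF lin inj']] by blast
  have contG: "continuous_on (cball u \<delta>) G"
    using der has_derivative_continuous by (intro continuous_at_imp_continuous_on) blast
  have "G u \<in> interior (G ` cball u (\<delta> / 2))"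
  proof (rule sussmann_open_mapping[where S = "ball u \<delta>" and f' = "blinfun_apply (G' u)" and g' = g])
    show "continuous_on (ball u \<delta>) G"
      using contG ball_subset_cball by (rule continuous_on_subset)
    show "cball u (\<delta> / 2) \<subseteq> ball u \<delta>"
      using \<delta> by auto
  qed (use \<delta> der g in \<open>auto simp: linear_conv_bounded_linear\<close>)
  moreover have "G ` cball u (\<delta> / 2) \<subseteq> G ` cball u \<delta>"
    using \<delta> by (intro image_mono) auto
  ultimately have "G u \<in> interior (G ` cball u \<delta>)"
    using interior_mono by blast
  then obtain \<eta> where \<eta>: "0 < \<eta>" "ball (G u) \<eta> \<subseteq> G ` cball u \<delta>"
    by (auto simp: mem_interior)
  show thesis
  proof (rule that[OF \<eta>(1)])
    fix Q assume Q: "compact Q" "Q \<subseteq> ball (G u) \<eta>"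
    let ?P = "{t \<in> cball u \<delta>. G t \<in> Q}"
    have P: "compact ?P"
      using contG Q by (intro compact_preimage compact_imp_closed) auto
    have "Q = G ` ?P" using Q(2) \<eta>(2) by blast
    moreover have "measure lebesgue (G ` ?P) \<le> K * measure lebesgue ?P"
      using P der cont inj K
      by (intro measure_image_bounds(2)[of _ _ G' 0]) (auto intro: continuous_on_subset inj_on_subset)
    ultimately show "measure lebesgue Q \<le> K * measure lebesgue ?P" by simp
  qed
qed

section \<open>Lower bound for the dimension\<close>

text \<open>The frame coordinates at \<open>x\<close> with indices \<open>j k\<close>; the elements of an index set are
  enumerated by the index type of the parameter space, so that Jacobians are square matrices.\<close>

definition chart_coords :: "('q \<Rightarrow> nat) \<Rightarrow> real^4 \<Rightarrow> (real^4) \<Rightarrow>\<^sub>L (real^'q::finite)" where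
  "chart_coords j x = Blinfun (\<lambda>v. \<chi> k. engel_coords x v $ of_nat (j k))"

lemma chart_coords_apply [simp]: "chart_coords j x v = (\<chi> k. engel_coords x v $ of_nat (j k))"
proof -
  have "linear (\<lambda>v. \<chi> k. engel_coords x v $ of_nat (j k))"
    using linear_engel_coords[of x] by (intro linearI) (simp_all add: vec_eq_iff linear_add linear_scale)
  then show ?thesis
    unfolding chart_coords_def by (subst bounded_linear_Blinfun_apply) (simp_all add: linear_conv_bounded_linear)
qed

lemma continuous_on_chart_coords: "continuous_on A (chart_coords j)"
proof (rule continuous_on_blinfun_componentwise)
  fix i :: "real^4"
  have "continuous_on A (\<lambda>x. engel_coords x i $ m)" for m
  proof -
    consider "m = 1" | "m = 2" | "m = 3" | "m = 4" using exhaust_4 by blast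
    then show ?thesis by cases (auto intro!: continuous_intros)
  qed
  then show "continuous_on A (\<lambda>x. chart_coords j x i)"
    by (simp add: continuous_on_vec_lambda)
qed

lemma chart_coords_translate_derivative:
  assumes "(\<phi> has_derivative blinfun_apply D) (at t)"
  shows "((\<lambda>t. chart_coords j x (\<phi> t - x)) has_derivative blinfun_apply (chart_coords j x o\<^sub>L D)) (at t)"
proof -
  have "((\<lambda>t. \<phi> t - x) has_derivative blinfun_apply D) (at t)"
    using has_derivative_diff[OF assms has_derivative_const[of x]] by simp
  from bounded_linear.has_derivative[OF blinfun.bounded_linear_right[of "chart_coords j x"] this]
  show ?thesis by (simp only: blinfun_compose.rep_eq o_def)
qed

lemma coordinate_sets_bij:
  fixes D :: "(real^'q::finite) \<Rightarrow>\<^sub>L (real^4)"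
  assumes "I \<in> coordinate_sets x (blinfun_apply D)"
  obtains j :: "'q \<Rightarrow> nat" where "bij_betw j UNIV I" "I \<subseteq> {1..4}" "inj (blinfun_apply (chart_coords j x o\<^sub>L D))"
    "(\<Sum>k\<in>UNIV. engel_weight (j k)) = index_weight I"
proof -
  have I: "I \<subseteq> {1..4}" "card I = CARD('q)" "\<And>h. (\<forall>i\<in>I. engel_coords x (D h) $ of_nat i = 0) \<Longrightarrow> h = 0"
    using assms by (auto simp: coordinate_sets_def multi_indices_def)
  then obtain j :: "'q \<Rightarrow> nat" where j: "bij_betw j UNIV I"
    using finite_same_card_bij[of "UNIV :: 'q set" I] finite_subset[OF I(1)] by auto
  have "h = 0" if "(chart_coords j x o\<^sub>L D) h = 0" for h
  proof (rule I(3))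
    have "\<forall>k. engel_coords x (D h) $ of_nat (j k) = 0"
      using that by (simp add: vec_eq_iff)
    then show "\<forall>i\<in>I. engel_coords x (D h) $ of_nat i = 0"
      using j unfolding bij_betw_def by blast
  qed
  then have "inj (blinfun_apply (chart_coords j x o\<^sub>L D))"
    by (subst linear_injective_0) (auto intro: bounded_linear.linear blinfun.bounded_linear_right)
  moreover have "(\<Sum>k\<in>UNIV. engel_weight (j k)) = index_weight I"
    unfolding index_weight_def by (rule sum.reindex_bij_betw[OF j])
  ultimately show thesis
    using that j I(1) by blast
qed

text \<open>The derivative of \<open>t' \<mapsto> chart_coords j (\<phi> t) (\<phi> t' - \<phi> t)\<close> at \<open>t'\<close> depends continuously on the
  centre \<open>t\<close> and on \<open>t'\<close>, and it is invertible for \<open>t = t' = u\<close>. On a small ball about \<open>u\<close> it is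
  thus uniformly close to one invertible map, which gives constants independent of the centre.\<close>

lemma hausdorff_measure_submanifold_nonzero:
  fixes \<phi> :: "real^'q::{finite,wellorder} \<Rightarrow> real^4"
    and \<phi>' :: "real^'q::_ \<Rightarrow> (real^'q::_) \<Rightarrow>\<^sub>L (real^4)"
  assumes \<rho>: "homogeneous_distance \<rho>"
    and U: "open U" and der: "\<And>u. u \<in> U \<Longrightarrow> (\<phi> has_derivative blinfun_apply (\<phi>' u)) (at u)"
    and cont: "continuous_on U \<phi>'" and sub: "\<phi> ` U \<subseteq> \<Sigma>" and u: "u \<in> U"
    and I: "I \<in> coordinate_sets (\<phi> u) (blinfun_apply (\<phi>' u))"
    and s: "0 \<le> s" "s < real (index_weight I)"
  shows "hausdorff_measure \<rho> s \<Sigma> \<noteq> 0"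
proof -
  obtain j :: "'q \<Rightarrow> nat" where j: "bij_betw j UNIV I" "I \<subseteq> {1..4}"
    "inj (blinfun_apply (chart_coords j (\<phi> u) o\<^sub>L \<phi>' u))" "(\<Sum>k\<in>UNIV. engel_weight (j k)) = index_weight I"
    using coordinate_sets_bij[OF I] by blast
  define N where "N y t = chart_coords j (\<phi> y) o\<^sub>L \<phi>' t" for y t
  obtain m c K where mcK: "0 < m" "0 < c" "0 < K" "\<And>h. 2 * m * norm h \<le> norm (N u u h)"
    "\<And>L. norm (L - N u u) \<le> m \<Longrightarrow> c \<le> \<bar>det (matrix (blinfun_apply L))\<bar>"
    "\<And>L. norm (L - N u u) \<le> m \<Longrightarrow> \<bar>det (matrix (blinfun_apply L))\<bar> \<le> K"
    by (rule blinfun_det_near[of "N u u"]) (use j(3) in \<open>simp_all add: N_def\<close>)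
  have cont\<phi>: "continuous_on U \<phi>"
    using der has_derivative_continuous by (intro continuous_at_imp_continuous_on) blast
  have contN: "continuous_on (U \<times> U) (\<lambda>p. N (fst p) (snd p))"
    unfolding N_def
    by (intro bounded_bilinear.continuous_on[OF bounded_bilinear_blinfun_compose]
        continuous_on_compose2[OF continuous_on_chart_coords[of UNIV]] continuous_on_compose2[OF cont\<phi>]
        continuous_on_compose2[OF cont] continuous_intros) auto
  then have "open ((U \<times> U) \<inter> (\<lambda>p. N (fst p) (snd p)) -` ball (N u u) m)"
    using U by (intro continuous_open_preimage open_Times) auto
  moreover have "(u, u) \<in> (U \<times> U) \<inter> (\<lambda>p. N (fst p) (snd p)) -` ball (N u u) m"
    using u mcK(1) by simp
  ultimately obtain A B where AB: "open A" "open B" "u \<in> A" "u \<in> B"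
    "A \<times> B \<subseteq> (U \<times> U) \<inter> (\<lambda>p. N (fst p) (snd p)) -` ball (N u u) m"
    by (rule open_prod_elim) auto
  obtain \<delta> where \<delta>: "0 < \<delta>" "cball u \<delta> \<subseteq> A \<inter> B"
    using AB open_contains_cball[of "A \<inter> B"] by (metis IntI open_Int)
  let ?S = "cball u \<delta>"
  have SU: "?S \<subseteq> U" using \<delta>(2) AB(5) by auto
  have near: "norm (N y t - N u u) \<le> m" if "y \<in> ?S" "t \<in> ?S" for y t
  proof -
    have "(y, t) \<in> A \<times> B"
      using that \<delta>(2) by blast
    then have "(y, t) \<in> (\<lambda>p. N (fst p) (snd p)) -` ball (N u u) m"
      using AB(5) by blast
    then have "dist (N u u) (N y t) < m" by simp
    then show ?thesis by (simp add: dist_norm norm_minus_commute)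
  qed
  obtain C where C: "0 < C" "\<And>z r i. \<rho> 0 z \<le> r \<Longrightarrow> i \<in> {1..4} \<Longrightarrow> \<bar>z $ of_nat i\<bar> \<le> (C * r) ^ engel_weight i"
    using homogeneous_distance_ge[OF \<rho>] by blast
  define w where "w k = engel_weight (j k)" for k
  have cl: "compact {t' \<in> ?S. \<rho> (\<phi> t) (\<phi> t') \<le> r}" for t r
  proof -
    have "continuous_on ?S (\<lambda>t'. \<rho> (\<phi> t) (\<phi> t'))"
      by (intro continuous_on_compose2[OF continuous_homogeneous_distance_0[OF \<rho>, of UNIV]]
          continuous_on_subset[OF cont\<phi> SU]) auto
    from compact_preimage[OF compact_cball this closed_atMost]
    show ?thesis by simp
  qed
  have bound: "emeasure lborel {t' \<in> ?S. \<rho> (\<phi> t) (\<phi> t') \<le> r} \<le> ennreal ((2 ^ CARD('q) * C ^ index_weight I / c) * r ^ index_weight I)"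
    if t: "t \<in> ?S" and r: "0 \<le> r" for t r
  proof -
    define G where "G t' = chart_coords j (\<phi> t) (\<phi> t' - \<phi> t)" for t'
    have G: "(G has_derivative blinfun_apply (N t t')) (at t')" if "t' \<in> ?S" for t'
      unfolding G_def N_def by (intro chart_coords_translate_derivative der) (use that SU in blast)
    then have contG: "continuous_on ?S G"
      by (intro continuous_at_imp_continuous_on ballI has_derivative_continuous)
    have "inj_on G ?S"
    proof (rule inj_onI)
      fix a b assume ab: "a \<in> ?S" "b \<in> ?S" "G a = G b"
      have "m * norm (a - b) \<le> norm (G a - G b)"
        by (rule expanding_of_derivative_near[OF convex_cball G near[OF t] mcK(4) ab(1,2)])
      then show "a = b" using ab(3) mcK(1) by (simp add: mult_le_0_iff)
    qed
    moreover have "continuous_on ?S (N t)"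
      unfolding N_def
      by (intro bounded_bilinear.continuous_on[OF bounded_bilinear_blinfun_compose]
        continuous_intros continuous_on_subset[OF cont SU])
    ultimately have 1: "measure lebesgue {t' \<in> ?S. G t' \<in> weighted_box w (C * r)} \<le> measure lebesgue (weighted_box w (C * r)) / c"
      by (intro measure_preimage_le[where G' = "N t" and K = K] G mcK(2) mcK(5,6) near t compact_cball compact_weighted_box)
    have "compact {t' \<in> ?S. G t' \<in> weighted_box w (C * r)}"
      by (intro compact_preimage compact_cball contG compact_imp_closed compact_weighted_box)
    moreover have "{t' \<in> ?S. \<rho> (\<phi> t) (\<phi> t') \<le> r} \<subseteq> {t' \<in> ?S. G t' \<in> weighted_box w (C * r)}"
    proof clarify
      fix t' assume "\<rho> (\<phi> t) (\<phi> t') \<le> r"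
      then have "\<rho> 0 (engel_coords (\<phi> t) (\<phi> t' - \<phi> t)) \<le> r"
        using homogeneous_distance_coords[OF \<rho>] by simp
      moreover have "j k \<in> {1..4}" for k
        using bij_betwE[OF j(1)] j(2) by blast
      ultimately show "G t' \<in> weighted_box w (C * r)"
        using C(2) by (simp add: weighted_box_def G_def w_def)
    qed
    ultimately have "measure lebesgue {t' \<in> ?S. \<rho> (\<phi> t) (\<phi> t') \<le> r} \<le> measure lebesgue {t' \<in> ?S. G t' \<in> weighted_box w (C * r)}"
      using lmeasurable_compact[OF cl[of t r]]
      by (intro measure_mono_fmeasurable) (auto dest: lmeasurable_compact)
    also note 1
    also have "measure lebesgue (weighted_box w (C * r)) / c = (2 ^ CARD('q) * C ^ index_weight I / c) * r ^ index_weight I"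
      using C(1) r j(4) by (simp add: measure_weighted_box w_def power_mult_distrib)
    finally have "measure lborel {t' \<in> ?S. \<rho> (\<phi> t) (\<phi> t') \<le> r} \<le> (2 ^ CARD('q) * C ^ index_weight I / c) * r ^ index_weight I"
      using cl[of t r] by (simp add: measure_completion borel_compact)
    then show ?thesis
      using emeasure_compact_finite[OF cl[of t r]]
      by (subst emeasure_eq_ennreal_measure) (auto intro: ennreal_leI)
  qed
  have pos: "emeasure lborel ?S \<noteq> 0"
  proof -
    have "emeasure lborel (ball u \<delta>) \<le> emeasure lborel ?S"
      by (intro emeasure_mono) auto
    moreover have "emeasure lborel (ball u \<delta>) \<noteq> 0"
      using \<delta>(1) less_imp_neq[OF unit_ball_vol_pos[OF of_nat_0_le_iff, of "CARD('q)"]]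
      by (auto simp: emeasure_ball)
    ultimately show ?thesis by auto
  qed
  show ?thesis
  proof (rule hausdorff_measure_nonzero[where M = lborel and K = ?S and f = \<phi> and \<rho> = \<rho>
        and C = "2 ^ CARD('q) * C ^ index_weight I / c" and D = "index_weight I"])
    show "\<phi> ` ?S \<subseteq> \<Sigma>" using sub SU by blast
    show "{t' \<in> ?S. \<rho> (\<phi> t) (\<phi> t') \<le> r} \<in> sets lborel" for t r
      using borel_compact[OF cl[of t r]] by simp
    show "0 < 2 ^ CARD('q) * C ^ index_weight I / c" using C(1) mcK(2) by simp
  qed (use pos bound s in auto)
qed

section \<open>Second order estimates at a point\<close>

text \<open>Exchange argument: the coordinate \<open>a\<close> is a linear combination of those in \<open>I\<close>, and if \<open>i\<close> occurs in
  it with nonzero coefficient, then \<open>i\<close> can be replaced by \<open>a\<close>, which by maximality of \<open>I\<close> does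
  not increase the weight.\<close>

lemma top_coordinate_set:
  fixes D :: "(real^'q::finite) \<Rightarrow>\<^sub>L (real^4)"
  assumes I: "I \<in> coordinate_sets x (blinfun_apply D)"
    and top: "\<And>J. J \<in> coordinate_sets x (blinfun_apply D) \<Longrightarrow> index_weight J \<le> index_weight I"
    and a: "a \<in> {1..4}" "a \<notin> I"
  obtains c where "\<And>h. engel_coords x (D h) $ of_nat a = (\<Sum>i\<in>I. c i * engel_coords x (D h) $ of_nat i)"
    "\<And>i. i \<in> I \<Longrightarrow> c i \<noteq> 0 \<Longrightarrow> engel_weight a \<le> engel_weight i"
proof -
  let ?L = "\<lambda>h i. engel_coords x (D h) $ of_nat i"
  obtain j :: "'q \<Rightarrow> nat" where j: "bij_betw j UNIV I" "I \<subseteq> {1..4}"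
    "inj (blinfun_apply (chart_coords j x o\<^sub>L D))" "(\<Sum>k\<in>UNIV. engel_weight (j k)) = index_weight I"
    using coordinate_sets_bij[OF I] by blast
  let ?T = "blinfun_apply (chart_coords j x o\<^sub>L D)"
  have lin: "linear ?T"
    by (rule bounded_linear.linear[OF blinfun.bounded_linear_right])
  obtain g where g: "linear g" "g \<circ> ?T = id"
    using linear_injective_left_inverse[OF lin j(3)] by blast
  have linL: "linear (\<lambda>q. engel_coords x (D q))"
    using linear_compose[OF bounded_linear.linear[OF blinfun.bounded_linear_right[of D]] linear_engel_coords]
    by (simp add: o_def)
  define b where "b k = ?L (g (axis k 1)) a" for k
  define c where "c i = b (inv j i)" for i
  have "?L h a = (\<Sum>i\<in>I. c i * ?L h i)" for h
  proof -
    have "h = g (?T h)" using g(2) by (metis comp_apply id_apply)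
    also have "?T h = (\<Sum>k\<in>UNIV. ?L h (j k) *\<^sub>R axis k 1)"
      by (simp add: vec_eq_iff axis_def if_distrib cong: if_cong)
    finally have "h = (\<Sum>k\<in>UNIV. ?L h (j k) *\<^sub>R g (axis k 1))"
      using g(1) by (simp add: linear_sum linear_scale)
    then have "engel_coords x (D h) = engel_coords x (D (\<Sum>k\<in>UNIV. ?L h (j k) *\<^sub>R g (axis k 1)))"
      by (rule arg_cong)
    also have "\<dots> = (\<Sum>k\<in>UNIV. ?L h (j k) *\<^sub>R engel_coords x (D (g (axis k 1))))"
      using linL by (simp add: linear_sum[OF linL] linear_scale[OF linL])
    finally have "?L h a = (\<Sum>k\<in>UNIV. ?L h (j k) *\<^sub>R engel_coords x (D (g (axis k 1)))) $ of_nat a"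
      by (rule arg_cong)
    then have "?L h a = (\<Sum>k\<in>UNIV. b k * ?L h (j k))"
      by (simp only: b_def sum_component vector_scaleR_component real_scaleR_def mult.commute)
    also have "\<dots> = (\<Sum>k\<in>UNIV. c (j k) * ?L h (j k))"
      using j(1) by (simp add: c_def bij_betw_def)
    also have "\<dots> = (\<Sum>i\<in>I. c i * ?L h i)"
      by (rule sum.reindex_bij_betw[OF j(1)])
    finally show ?thesis .
  qed
  moreover have "engel_weight a \<le> engel_weight i" if i: "i \<in> I" "c i \<noteq> 0" for i
  proof -
    have fin: "finite I" using j(2) finite_subset by blast
    define J where "J = insert a (I - {i})"
    have "J \<in> coordinate_sets x (blinfun_apply D)"
      unfolding coordinate_sets_def multi_indices_def
    proof (intro CollectI conjI allI impI)
      show "J \<subseteq> {1..4}" using j(2) a(1) by (auto simp: J_def)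
      have "card J = card I"
        unfolding J_def card.remove[OF fin i(1)] using a(2) fin by (intro card_insert_disjoint) auto
      then show "card J = CARD('q)"
        using I by (simp add: coordinate_sets_def multi_indices_def)
      fix h assume h: "\<forall>i\<in>J. ?L h i = 0"
      have "0 = ?L h a" using h by (simp add: J_def)
      also have "\<dots> = (\<Sum>i\<in>I. c i * ?L h i)" by fact
      also have "\<dots> = c i * ?L h i"
        using h i(1) fin by (subst sum.remove[of I i]) (auto simp: J_def)
      finally have "?L h i = 0" using i(2) by simp
      then have "\<forall>i\<in>I. ?L h i = 0" using h by (auto simp: J_def)
      then show "h = 0" using I by (auto simp: coordinate_sets_def)
    qed
    then have "index_weight J \<le> index_weight I" by (rule top)
    moreover have "index_weight J = engel_weight a + index_weight (I - {i})"
      using a(2) fin by (simp add: index_weight_def J_def)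
    moreover have "index_weight I = engel_weight i + index_weight (I - {i})"
      using i(1) fin by (simp add: index_weight_def sum.remove)
    ultimately show ?thesis by simp
  qed
  ultimately show thesis using that by blast
qed

lemma top_coordinate_set_cases:
  fixes D :: "(real^'q::finite) \<Rightarrow>\<^sub>L (real^4)"
  assumes I: "I \<in> coordinate_sets x (blinfun_apply D)"
    and top: "\<And>J. J \<in> coordinate_sets x (blinfun_apply D) \<Longrightarrow> index_weight J \<le> index_weight I"
  shows "4 \<notin> I \<Longrightarrow> engel_coords x (D h) $ 4 = 0"
    and "3 \<notin> I \<Longrightarrow> \<exists>c. \<forall>h. engel_coords x (D h) $ 3 = c * engel_coords x (D h) $ 4"
proof -
  have I4: "I \<subseteq> {1..4}" "finite I"
    using I finite_subset by (auto simp: coordinate_sets_def multi_indices_def)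
  show 4: "engel_coords x (D h) $ 4 = 0" if n4: "4 \<notin> I" for h
  proof -
    obtain c where c: "\<And>h. engel_coords x (D h) $ of_nat 4 = (\<Sum>i\<in>I. c i * engel_coords x (D h) $ of_nat i)"
      "\<And>i. i \<in> I \<Longrightarrow> c i \<noteq> 0 \<Longrightarrow> engel_weight 4 \<le> engel_weight i"
 by (rule top_coordinate_set[OF I top _ n4]) auto
    have "c i = 0" if "i \<in> I" for i
    proof (rule ccontr)
      assume "c i \<noteq> 0"
      then have "engel_weight 4 \<le> engel_weight i" by (rule c(2)[OF that])
      then show False using that n4 by (auto simp: engel_weight_def split: if_splits)
    qed
    then show ?thesis using c(1)[of h] by simp
  qed
  show "\<exists>c. \<forall>h. engel_coords x (D h) $ 3 = c * engel_coords x (D h) $ 4" if n3: "3 \<notin> I"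
  proof -
    obtain c where c: "\<And>h. engel_coords x (D h) $ of_nat 3 = (\<Sum>i\<in>I. c i * engel_coords x (D h) $ of_nat i)"
      "\<And>i. i \<in> I \<Longrightarrow> c i \<noteq> 0 \<Longrightarrow> engel_weight 3 \<le> engel_weight i"
 by (rule top_coordinate_set[OF I top _ n3]) auto
    have z: "c i = 0" if "i \<in> I" "i \<noteq> 4" for i
    proof (rule ccontr)
      assume "c i \<noteq> 0"
      then have "engel_weight 3 \<le> engel_weight i" by (rule c(2)[OF that(1)])
      then show False using that n3 by (auto simp: engel_weight_def split: if_splits)
    qed
    have "(\<Sum>i\<in>I. c i * engel_coords x (D h) $ of_nat i)
        = (\<Sum>i\<in>I \<inter> {4}. c i * engel_coords x (D h) $ of_nat i)" for h
      using I4 z by (intro sum.mono_neutral_right) auto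
    then have "engel_coords x (D h) $ 3 = (\<Sum>i\<in>I \<inter> {4}. c i * engel_coords x (D h) $ of_nat i)" for h
      using c(1)[of h] by simp
    then have "engel_coords x (D h) $ 3 = (if 4 \<in> I then c 4 else 0) * engel_coords x (D h) $ 4" for h
      by (cases "4 \<in> I") auto
    then show ?thesis by blast
  qed
qed

lemma weight_power_le:
  assumes "1 \<le> C" "K \<le> C" "0 \<le> (r::real)" "i \<in> {1..4}" "a \<le> K * r ^ engel_weight i"
  shows "a \<le> (C * r) ^ engel_weight i"
proof -
  have "C ^ 1 \<le> C ^ engel_weight i"
    using assms(1) engel_weight_pos[OF assms(4)] by (intro power_increasing) auto
  then have "K * r ^ engel_weight i \<le> C ^ engel_weight i * r ^ engel_weight i"
    using assms(2,3) by (intro mult_right_mono) auto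
  then show ?thesis using assms(5) by (simp add: power_mult_distrib)
qed

text \<open>Taylor expansion at \<open>u\<close> in the coordinates centred at \<open>\<phi> u\<close>; the quadratic remainder is where the
  local Lipschitz condition on the derivative enters.\<close>

lemma second_order_estimate:
  fixes \<phi> :: "real^'q::finite \<Rightarrow> real^4" and \<phi>' :: "real^'q::_ \<Rightarrow> (real^'q::_) \<Rightarrow>\<^sub>L (real^4)"
  assumes U: "open U" and der: "\<And>u. u \<in> U \<Longrightarrow> (\<phi> has_derivative blinfun_apply (\<phi>' u)) (at u)"
    and lip: "\<And>u. u \<in> U \<Longrightarrow> \<exists>e>0. \<exists>L. L-lipschitz_on (ball u e \<inter> U) \<phi>'" and u: "u \<in> U"
  obtains \<epsilon> C where "0 < \<epsilon>" "\<epsilon> \<le> 1" "0 < C" "cball u \<epsilon> \<subseteq> U"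
    "\<And>t i. t \<in> cball u \<epsilon> \<Longrightarrow>
      \<bar>engel_coords (\<phi> u) (\<phi> t - \<phi> u) $ i - engel_coords (\<phi> u) (\<phi>' u (t - u)) $ i\<bar> \<le> C * (norm (t - u))\<^sup>2"
    "\<And>t i k. t \<in> cball u \<epsilon> \<Longrightarrow>
      \<bar>engel_coords (\<phi> u) (\<phi>' t k) $ i - engel_coords (\<phi> u) (\<phi>' u k) $ i\<bar> \<le> C * norm (t - u) * norm k"
    "\<And>k i. \<bar>engel_coords (\<phi> u) (\<phi>' u k) $ i\<bar> \<le> C * norm k"
proof -
  obtain e L where e: "0 < e" "L-lipschitz_on (ball u e \<inter> U) \<phi>'"
    using lip[OF u] by blast
  obtain e' where e': "0 < e'" "ball u e' \<subseteq> U" using U u openE by blast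
  define \<epsilon> where "\<epsilon> = min 1 (min e e' / 2)"
  have \<epsilon>: "0 < \<epsilon>" "\<epsilon> \<le> 1" "\<epsilon> < e" "\<epsilon> < e'" using e(1) e'(1) by (auto simp: \<epsilon>_def)
  have in_U: "cball u \<epsilon> \<subseteq> ball u e \<inter> U" using \<epsilon> e' by auto
  have L0: "0 \<le> L" using e(2) by (rule lipschitz_on_nonneg)
  have lip': "norm (\<phi>' t - \<phi>' u) \<le> L * norm (t - u)" if "t \<in> cball u \<epsilon>" for t
  proof -
    have "t \<in> ball u e \<inter> U" "u \<in> ball u e \<inter> U"
      using that in_U e(1) u by auto
    then show ?thesis by (rule lipschitz_on_normD[OF e(2)])
  qed
  obtain B where B: "0 < B" "\<And>v. norm (engel_coords (\<phi> u) v) \<le> B * norm v"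
    using bounded_linear.pos_bounded[OF bounded_linear_engel_coords[of "\<phi> u"]] by (auto simp: mult.commute)
  have comp: "\<bar>engel_coords (\<phi> u) v $ i\<bar> \<le> B * norm v" for v i
    using B(2)[of v] component_le_norm_cart[of "engel_coords (\<phi> u) v" i] by linarith
  have diff: "engel_coords (\<phi> u) v $ i - engel_coords (\<phi> u) w $ i = engel_coords (\<phi> u) (v - w) $ i" for v w i
    using linear_diff[OF linear_engel_coords, of "\<phi> u" v w] by simp
  define C where "C = max (B * L) (B * norm (\<phi>' u)) + 1"
  have C: "B * L \<le> C" "B * norm (\<phi>' u) \<le> C" "0 < C"
    using mult_nonneg_nonneg[OF less_imp_le[OF B(1)] L0] by (auto simp: C_def)
  show thesis
  proof (rule that[OF \<epsilon>(1,2) C(3)])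
    show "cball u \<epsilon> \<subseteq> U" using in_U by blast
  next
    fix t i assume t: "t \<in> cball u \<epsilon>"
    let ?S = "cball u (norm (t - u))"
    have S: "?S \<subseteq> cball u \<epsilon>" using t by (auto simp: dist_norm norm_minus_commute)
    have "norm (\<phi> t - \<phi> u - \<phi>' u (t - u)) \<le> norm (t - u) * (L * norm (t - u))"
    proof (rule differentiable_bound_linearization[where S = ?S and f' = "\<lambda>t. blinfun_apply (\<phi>' t)"])
      show "u + s *\<^sub>R (t - u) \<in> ?S" if "s \<in> {0..1}" for s
        using that mult_right_mono[of s 1 "norm (t - u)"] by (simp add: dist_norm)
      show "(\<phi> has_derivative blinfun_apply (\<phi>' y)) (at y within ?S)" if "y \<in> ?S" for y
      proof -
        have "y \<in> U" using that S in_U by blast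
        then show ?thesis by (rule has_derivative_at_withinI[OF der])
      qed
      show "onorm (blinfun_apply (\<phi>' y) - blinfun_apply (\<phi>' u)) \<le> L * norm (t - u)" if "y \<in> ?S" for y
      proof -
        have "y \<in> cball u \<epsilon>" using that S by blast
        then have "norm (\<phi>' y - \<phi>' u) \<le> L * norm (y - u)" by (rule lip')
        also have "\<dots> \<le> L * norm (t - u)"
          using that L0 by (intro mult_left_mono) (auto simp: dist_norm norm_minus_commute)
        finally show ?thesis by (simp add: norm_blinfun.rep_eq minus_blinfun.rep_eq fun_diff_def)
      qed
    qed auto
    from mult_left_mono[OF this less_imp_le[OF B(1)]]
    have "B * norm (\<phi> t - \<phi> u - \<phi>' u (t - u)) \<le> B * L * (norm (t - u))\<^sup>2"
      by (simp add: power2_eq_square mult_ac)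
    also have "\<dots> \<le> C * (norm (t - u))\<^sup>2"
      using C(1) by (intro mult_right_mono) auto
    finally show "\<bar>engel_coords (\<phi> u) (\<phi> t - \<phi> u) $ i - engel_coords (\<phi> u) (\<phi>' u (t - u)) $ i\<bar> \<le> C * (norm (t - u))\<^sup>2"
      unfolding diff by (rule order_trans[OF comp])
  next
    fix t i k assume t: "t \<in> cball u \<epsilon>"
    have "norm (\<phi>' t k - \<phi>' u k) \<le> L * norm (t - u) * norm k"
      using norm_blinfun[of "\<phi>' t - \<phi>' u" k] mult_right_mono[OF lip'[OF t], of "norm k"]
      by (simp add: blinfun.diff_left)
    from mult_left_mono[OF this less_imp_le[OF B(1)]]
    have "B * norm (\<phi>' t k - \<phi>' u k) \<le> B * L * (norm (t - u) * norm k)"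
      by (simp add: mult_ac)
    also have "\<dots> \<le> C * (norm (t - u) * norm k)"
      using C(1) by (intro mult_right_mono) auto
    finally have "B * norm (\<phi>' t k - \<phi>' u k) \<le> C * norm (t - u) * norm k"
      by (simp add: mult_ac)
    then show "\<bar>engel_coords (\<phi> u) (\<phi>' t k) $ i - engel_coords (\<phi> u) (\<phi>' u k) $ i\<bar> \<le> C * norm (t - u) * norm k"
      unfolding diff by (rule order_trans[OF comp])
  next
    fix k i
    have "B * norm (\<phi>' u k) \<le> B * (norm (\<phi>' u) * norm k)"
      using B(1) by (simp add: norm_blinfun)
    also have "\<dots> \<le> C * norm k"
      using mult_right_mono[OF C(2), of "norm k"] by (simp add: mult_ac)
    finally show "\<bar>engel_coords (\<phi> u) (\<phi>' u k) $ i\<bar> \<le> C * norm k"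
      by (rule order_trans[OF comp])
  qed
qed

text \<open>If the tangent vectors have no component along \<open>X\<^sub>4\<close>, then \<open>z\<^sub>4' = z\<^sub>1 z\<^sub>3' - z\<^sub>1\<^sup>2/2 z\<^sub>2'\<close> along the
  segment from \<open>u\<close> to \<open>t\<close>, and the mean value theorem applies. With \<open>a\<close> of order \<open>r\<close> and \<open>b\<close> of order \<open>r\<^sup>2\<close>
  this makes \<open>z\<^sub>4\<close> of order \<open>r\<^sup>3\<close>, where a Taylor expansion only gives \<open>r\<^sup>2\<close>.\<close>

lemma flat_curve_estimate:
  fixes \<phi> :: "real^'q::finite \<Rightarrow> real^4" and \<phi>' :: "real^'q::_ \<Rightarrow> (real^'q::_) \<Rightarrow>\<^sub>L (real^4)"
  assumes der: "\<And>s. s \<in> cball u \<epsilon> \<Longrightarrow> (\<phi> has_derivative blinfun_apply (\<phi>' s)) (at s)"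
    and flat: "\<And>s k. s \<in> cball u \<epsilon> \<Longrightarrow> engel_coords (\<phi> s) (\<phi>' s k) $ 4 = 0"
    and t: "t \<in> cball u \<epsilon>"
    and z1: "\<And>s. s \<in> cball u (norm (t - u)) \<Longrightarrow> \<bar>engel_coords (\<phi> u) (\<phi> s - \<phi> u) $ 1\<bar> \<le> a"
    and d2: "\<And>s. s \<in> cball u (norm (t - u)) \<Longrightarrow> \<bar>engel_coords (\<phi> u) (\<phi>' s (t - u)) $ 2\<bar> \<le> a"
    and d3: "\<And>s. s \<in> cball u (norm (t - u)) \<Longrightarrow> \<bar>engel_coords (\<phi> u) (\<phi>' s (t - u)) $ 3\<bar> \<le> b"
  shows "\<bar>engel_coords (\<phi> u) (\<phi> t - \<phi> u) $ 4\<bar> \<le> a * b + a ^ 3 / 2"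
proof -
  let ?x = "\<phi> u"
  define \<gamma> where "\<gamma> r = u + r *\<^sub>R (t - u)" for r
  have \<gamma>S: "\<gamma> r \<in> cball u (norm (t - u))" if "r \<in> {0..1}" for r
    using that mult_right_mono[of r 1 "norm (t - u)"] by (simp add: dist_norm \<gamma>_def)
  have S: "cball u (norm (t - u)) \<subseteq> cball u \<epsilon>"
    using t by (auto simp: dist_norm norm_minus_commute)
  define f where "f r = engel_coords ?x (\<phi> (\<gamma> r) - ?x) $ 4" for r
  define f' where "f' r = engel_coords ?x (\<phi>' (\<gamma> r) (t - u)) $ 4" for r
  have f: "(f has_real_derivative f' r) (at r)" if r: "r \<in> {0..1}" for r
  proof -
    have "(\<gamma> has_derivative (\<lambda>h. h *\<^sub>R (t - u))) (at r)"
      unfolding \<gamma>_def by (auto intro!: derivative_eq_intros)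
    moreover have "(\<phi> has_derivative blinfun_apply (\<phi>' (\<gamma> r))) (at (\<gamma> r))"
      using \<gamma>S[OF r] S by (intro der) blast
    ultimately have "(\<phi> \<circ> \<gamma> has_derivative blinfun_apply (\<phi>' (\<gamma> r)) \<circ> (\<lambda>h. h *\<^sub>R (t - u))) (at r)"
      by (rule diff_chain_at)
    then have "((\<lambda>r. \<phi> (\<gamma> r) - ?x) has_derivative (\<lambda>h. h *\<^sub>R \<phi>' (\<gamma> r) (t - u))) (at r)"
      by (auto simp: o_def blinfun.scaleR_right intro!: derivative_eq_intros)
    from bounded_linear.has_derivative[OF bounded_linear_vec_nth[of 4]
        bounded_linear.has_derivative[OF bounded_linear_engel_coords[of ?x] this]]
    have "(f has_derivative (\<lambda>h. h * f' r)) (at r)"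
      unfolding f_def f'_def by (simp only: linear_scale[OF linear_engel_coords] vector_scaleR_component real_scaleR_def)
    moreover have "(*) (f' r) = (\<lambda>h. h * f' r)"
      by (simp add: fun_eq_iff mult.commute)
    ultimately show ?thesis
      by (simp only: has_field_derivative_def)
  qed
  obtain r where r: "0 < r" "r < 1" "f 1 - f 0 = (1 - 0) * f' r"
    using MVT2[of 0 1 f f', OF zero_less_one f] by auto
  let ?z = "engel_coords ?x (\<phi> (\<gamma> r) - ?x)" and ?d = "engel_coords ?x (\<phi>' (\<gamma> r) (t - u))"
  have \<gamma>r: "\<gamma> r \<in> cball u (norm (t - u))" using \<gamma>S r by simp
  then have "engel_coords (\<phi> (\<gamma> r)) (\<phi>' (\<gamma> r) (t - u)) $ 4 = 0"
    using S by (intro flat) blast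
  \<comment> \<open>the contact form is left invariant, so it may be evaluated in the coordinates centred at \<open>\<phi> u\<close>\<close>
  then have "?d $ 4 = ?z $ 1 * ?d $ 3 - (?z $ 1)\<^sup>2 / 2 * ?d $ 2"
    by (subst (asm) engel_coords_shift[of _ _ ?x]) simp
  moreover have "\<bar>?z $ 1\<bar> * \<bar>?d $ 3\<bar> \<le> a * b"
    using z1[OF \<gamma>r] d3[OF \<gamma>r] by (intro mult_mono) auto
  moreover have "(?z $ 1)\<^sup>2 / 2 * \<bar>?d $ 2\<bar> \<le> a\<^sup>2 / 2 * a"
    using z1[OF \<gamma>r] d2[OF \<gamma>r] by (intro mult_mono divide_right_mono) (auto simp: abs_le_square_iff[symmetric])
  ultimately have "\<bar>?d $ 4\<bar> \<le> a * b + a\<^sup>2 / 2 * a"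
    using abs_triangle_ineq4[of "?z $ 1 * ?d $ 3" "(?z $ 1)\<^sup>2 / 2 * ?d $ 2"]
    by (simp only: abs_mult abs_divide abs_power2 abs_numeral)
  moreover have "f 1 = engel_coords ?x (\<phi> t - ?x) $ 4" "f 0 = 0"
    by (simp_all add: f_def \<gamma>_def)
  ultimately show ?thesis
    using r(3) by (simp add: f'_def power3_eq_cube power2_eq_square)
qed

text \<open>With \<open>r = s\<^sup>2\<close>, the exponents \<open>2 w\<close> describe the box with sides \<open>r ^ w\<close> and the exponents \<open>w + 2\<close>, used
  for \<open>w \<le> 2\<close>, the sides \<open>r\<^bsup>3/2\<^esup>\<close> and \<open>r\<^sup>2\<close>; in terms of \<open>s\<close> all of them are natural
  numbers. On the preimage of the box \<open>\<bar>t - u\<bar>\<close> is at most a multiple of \<open>r\<close>, respectively of \<open>s\<^sup>3\<close>, and the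
  coordinates outside \<open>I\<close> are their linear parts, governed by \<open>L3\<close> and \<open>L4\<close>, up to a quadratic error.\<close>

lemma weighted_box_in_ball:
  fixes \<phi> :: "real^'q::finite \<Rightarrow> real^4" and \<phi>' :: "real^'q::_ \<Rightarrow> (real^'q::_) \<Rightarrow>\<^sub>L (real^4)"
    and j e :: "'q \<Rightarrow> nat"
  assumes \<epsilon>: "0 < \<epsilon>" "\<epsilon> \<le> 1" and C: "0 < C"
    and der: "\<And>t. t \<in> cball u \<epsilon> \<Longrightarrow> (\<phi> has_derivative blinfun_apply (\<phi>' t)) (at t)"
    and E1: "\<And>t i. t \<in> cball u \<epsilon> \<Longrightarrow>
      \<bar>engel_coords (\<phi> u) (\<phi> t - \<phi> u) $ i - engel_coords (\<phi> u) (\<phi>' u (t - u)) $ i\<bar> \<le> C * (norm (t - u))\<^sup>2"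
    and E2: "\<And>t i k. t \<in> cball u \<epsilon> \<Longrightarrow>
      \<bar>engel_coords (\<phi> u) (\<phi>' t k) $ i - engel_coords (\<phi> u) (\<phi>' u k) $ i\<bar> \<le> C * norm (t - u) * norm k"
    and E3: "\<And>k i. \<bar>engel_coords (\<phi> u) (\<phi>' u k) $ i\<bar> \<le> C * norm k"
    and j: "bij_betw j UNIV I" "I \<subseteq> {1..4}"
    and m: "0 < m" "\<And>t. t \<in> cball u \<epsilon> \<Longrightarrow> m * norm (t - u) \<le> norm (chart_coords j (\<phi> u) (\<phi> t - \<phi> u))"
    and L4: "\<And>h. 4 \<notin> I \<Longrightarrow> engel_coords (\<phi> u) (\<phi>' u h) $ 4 = 0"
    and L3: "3 \<notin> I \<Longrightarrow> \<exists>c. \<forall>h. engel_coords (\<phi> u) (\<phi>' u h) $ 3 = c * engel_coords (\<phi> u) (\<phi>' u h) $ 4"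
    and e: "(\<forall>k. e k = 2 * engel_weight (j k)) \<and>
        (4 \<in> I \<or> (\<forall>t\<in>cball u \<epsilon>. \<forall>k. engel_coords (\<phi> t) (\<phi>' t k) $ 4 = 0))
      \<or> (\<forall>k. e k = engel_weight (j k) + 2) \<and> 4 \<notin> I"
  obtains B where "1 \<le> B"
    "\<And>s t i. \<lbrakk>0 < s; s \<le> 1; t \<in> cball u \<epsilon>; chart_coords j (\<phi> u) (\<phi> t - \<phi> u) \<in> weighted_box e s; i \<in> {1..4}\<rbrakk>
       \<Longrightarrow> \<bar>engel_coords (\<phi> u) (\<phi> t - \<phi> u) $ of_nat i\<bar> \<le> (B * s\<^sup>2) ^ engel_weight i"
proof -
  define z where "z t = engel_coords (\<phi> u) (\<phi> t - \<phi> u)" for t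
  define L where "L h = engel_coords (\<phi> u) (\<phi>' u h)" for h
  obtain c where c: "\<And>h. 3 \<notin> I \<Longrightarrow> L h $ 3 = c * L h $ 4"
    using L3 unfolding L_def by blast
  define C1 where "C1 = CARD('q) / m"
  define C3 where "C3 = \<bar>c\<bar> * (1 + C * C1\<^sup>2) + C * C1\<^sup>2 + 1"
  define C4 where "C4 = 2 * C * C1 * (C3 + 2 * C * C1\<^sup>2) + 4 * C ^ 3 * C1 ^ 3 + C * C1\<^sup>2 + 1"
  define B where "B = 1 + 2 * C * C1 + C3 + C4"
  have C1: "0 < C1" using m by (simp add: C1_def)
  have C3: "1 \<le> C3" using C C1 by (simp add: C3_def)
  have C4: "C * C1\<^sup>2 \<le> C4" "1 \<le> C4"
    "2 * C * C1 * (C3 + 2 * C * C1\<^sup>2) + 4 * C ^ 3 * C1 ^ 3 \<le> C4"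
    using C C1 C3 by (simp_all add: C4_def)
  have B: "1 \<le> B" "2 * C * C1 \<le> B" "C3 \<le> B" "C4 \<le> B"
    using C C1 C3 C4 by (auto simp: B_def)
  show thesis
  proof (rule that[OF B(1)])
    fix s t i
    assume s: "0 < s" "s \<le> 1" and t: "t \<in> cball u \<epsilon>"
      and box: "chart_coords j (\<phi> u) (\<phi> t - \<phi> u) \<in> weighted_box e s" and i: "i \<in> {1..4::nat}"
    define h where "h = norm (t - u)"
    define r where "r = s\<^sup>2"
    have r: "0 < r" "r \<le> 1" using s by (simp_all add: r_def power_le_one)
    have h: "0 \<le> h" "h \<le> 1" using t \<epsilon> by (simp_all add: h_def dist_norm norm_minus_commute)
    have jI: "j k \<in> I" "j k \<in> {1..4}" for k
      using bij_betwE[OF j(1)] j(2) by blast+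
    have zI: "\<bar>z t $ of_nat (j k)\<bar> \<le> s ^ e k" for k
      using box by (simp add: weighted_box_def z_def)
    \<comment> \<open>the exponents \<open>w + 2\<close> are at least \<open>2 w\<close>, as \<open>4 \<notin> I\<close> excludes weight three\<close>
    have w: "2 * engel_weight (j k) \<le> e k" for k
      using e jI(1)[of k] by (auto simp: engel_weight_def)
    have zI': "\<bar>z t $ of_nat a\<bar> \<le> r ^ engel_weight a" if "a \<in> I" for a
    proof -
      have "a \<in> range j" using that j(1) by (simp add: bij_betw_def)
      then obtain k where k: "a = j k" by blast
      have "s ^ e k \<le> s ^ (2 * engel_weight a)"
        unfolding k using s w by (intro power_decreasing) auto
      then show ?thesis using zI[of k] unfolding k r_def power_mult by linarith
    qed
    have small: "h \<le> C1 * s ^ b" if "\<And>k. b \<le> e k" for b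
    proof -
      have "norm (chart_coords j (\<phi> u) (\<phi> t - \<phi> u)) \<le> (\<Sum>k\<in>UNIV. \<bar>z t $ of_nat (j k)\<bar>)"
        using norm_le_l1_cart[of "chart_coords j (\<phi> u) (\<phi> t - \<phi> u)"] by (simp add: z_def)
      also have "\<dots> \<le> (\<Sum>k::'q\<in>UNIV. s ^ b)"
      proof (rule sum_mono)
        fix k
        have "s ^ e k \<le> s ^ b" using s that by (intro power_decreasing) auto
        then show "\<bar>z t $ of_nat (j k)\<bar> \<le> s ^ b" using zI[of k] by linarith
      qed
      finally have "m * h \<le> CARD('q) * s ^ b"
        using m(2)[OF t] by (simp add: h_def)
      then show ?thesis using m(1) by (simp add: C1_def field_simps)
    qed
    have hr: "h \<le> C1 * r"
      unfolding r_def
    proof (rule small)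
      show "2 \<le> e k" for k
        using w[of k] engel_weight_pos[OF jI(2)[of k]] by linarith
    qed
    have h2: "h\<^sup>2 \<le> C1\<^sup>2 * r\<^sup>2"
      using power_mono[OF hr h(1), of 2] by (simp add: power_mult_distrib)
    have h3: "h ^ 3 \<le> C1 ^ 3 * r ^ 3"
      using power_mono[OF hr h(1), of 3] by (simp add: power_mult_distrib)
    have hC: "2 * C * h \<le> 2 * C * C1 * r"
      using mult_left_mono[OF hr, of "2 * C"] C by (simp add: mult_ac)
    have Ch2: "C * h\<^sup>2 \<le> C * C1\<^sup>2 * r\<^sup>2"
      using mult_left_mono[OF h2, of C] C by (simp add: mult_ac)
    have zL: "\<bar>z t $ a - L (t - u) $ a\<bar> \<le> C * h\<^sup>2" for a
      using E1[OF t] by (simp add: z_def L_def h_def)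
    have z_le: "\<bar>engel_coords (\<phi> u) (\<phi> y - \<phi> u) $ a\<bar> \<le> 2 * C * h"
      if "y \<in> cball u h" for y a
    proof -
      have y: "norm (y - u) \<le> h" "y \<in> cball u \<epsilon>"
        using that t by (simp_all add: dist_norm norm_minus_commute h_def)
      have "(norm (y - u))\<^sup>2 \<le> h * 1"
        unfolding power2_eq_square using y(1) h by (intro mult_mono) auto
      then have "C * (norm (y - u))\<^sup>2 \<le> C * h" using C by simp
      moreover have "C * norm (y - u) \<le> C * h" using y(1) C by simp
      ultimately show ?thesis
        using E1[OF y(2), of a] E3[of "y - u" a] by linarith
    qed
    have z3: "\<bar>z t $ 3\<bar> \<le> C3 * r\<^sup>2"
    proof (cases "3 \<in> I")
      case True
      then have "\<bar>z t $ 3\<bar> \<le> 1 * r\<^sup>2" using zI'[OF True] by (simp add: engel_weight_def)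
      also have "\<dots> \<le> C3 * r\<^sup>2" using C3 by (intro mult_right_mono) auto
      finally show ?thesis .
    next
      case False
      have "\<bar>L (t - u) $ 4\<bar> \<le> (1 + C * C1\<^sup>2) * r\<^sup>2"
      proof (cases "4 \<in> I")
        case True
        have "r ^ 3 \<le> r\<^sup>2" using r by (intro power_decreasing) auto
        then have "\<bar>z t $ 4\<bar> \<le> r\<^sup>2" using zI'[OF True] by (simp add: engel_weight_def)
        then show ?thesis using zL[of 4] Ch2 by (simp add: algebra_simps)
      qed (use L4 C in \<open>simp add: L_def\<close>)
      then have "\<bar>c\<bar> * \<bar>L (t - u) $ 4\<bar> \<le> \<bar>c\<bar> * ((1 + C * C1\<^sup>2) * r\<^sup>2)"
        by (intro mult_left_mono) auto
      then have "\<bar>L (t - u) $ 3\<bar> \<le> \<bar>c\<bar> * (1 + C * C1\<^sup>2) * r\<^sup>2"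
        by (simp add: c[OF False] abs_mult mult.assoc)
      then have "\<bar>z t $ 3\<bar> \<le> \<bar>c\<bar> * (1 + C * C1\<^sup>2) * r\<^sup>2 + C * C1\<^sup>2 * r\<^sup>2"
        using zL[of 3] Ch2 by linarith
      moreover have "C3 * r\<^sup>2 = \<bar>c\<bar> * (1 + C * C1\<^sup>2) * r\<^sup>2 + C * C1\<^sup>2 * r\<^sup>2 + r\<^sup>2"
        by (simp add: C3_def algebra_simps)
      ultimately show ?thesis using zero_le_power2[of r] by linarith
    qed
    have z4: "\<bar>z t $ 4\<bar> \<le> C4 * r ^ 3"
    proof (cases "4 \<in> I")
      case True
      then have "\<bar>z t $ 4\<bar> \<le> 1 * r ^ 3" using zI'[OF True] by (simp add: engel_weight_def)
      also have "\<dots> \<le> C4 * r ^ 3" using C4(2) r by (intro mult_right_mono) auto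
      finally show ?thesis .
    next
      case False
      from e consider "\<And>k. e k = engel_weight (j k) + 2"
        | "\<And>t k. t \<in> cball u \<epsilon> \<Longrightarrow> engel_coords (\<phi> t) (\<phi>' t k) $ 4 = 0"
        using False by auto
      then show ?thesis
      proof cases
        case 1
        have "h \<le> C1 * s ^ 3"
          using 1 engel_weight_pos jI(2) by (intro small) (auto simp: Suc_leI)
        from power_mono[OF this h(1), of 2] have "h\<^sup>2 \<le> C1\<^sup>2 * (s ^ 3)\<^sup>2"
          by (simp only: power_mult_distrib)
        also have "(s ^ 3)\<^sup>2 = r ^ 3"
          by (simp add: r_def flip: power_mult)
        finally have "C * h\<^sup>2 \<le> C * (C1\<^sup>2 * r ^ 3)" using C by simp
        then have "\<bar>z t $ 4\<bar> \<le> C * C1\<^sup>2 * r ^ 3"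
          using zL[of 4] L4[OF False] by (simp add: L_def mult.assoc)
        also have "\<dots> \<le> C4 * r ^ 3" using C4(1) r by (intro mult_right_mono) auto
        finally show ?thesis .
      next
        case 2
        have "\<bar>z t $ 4\<bar> \<le> (2 * C * h) * (C3 * r\<^sup>2 + 2 * (C * h\<^sup>2)) + (2 * C * h) ^ 3 / 2"
          unfolding z_def
        proof (rule flat_curve_estimate[where \<phi>' = \<phi>', OF der 2 t], unfold h_def[symmetric])
          fix y assume y: "y \<in> cball u h"
          then show "\<bar>engel_coords (\<phi> u) (\<phi> y - \<phi> u) $ 1\<bar> \<le> 2 * C * h" by (rule z_le)
          have y': "norm (y - u) \<le> h" "y \<in> cball u \<epsilon>"
            using y t by (simp_all add: dist_norm norm_minus_commute h_def)
          have "C * norm (y - u) * h \<le> C * h * h"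
            using y'(1) C h(1) by (intro mult_right_mono) auto
          then have d: "\<bar>engel_coords (\<phi> u) (\<phi>' y (t - u)) $ a - L (t - u) $ a\<bar> \<le> C * h\<^sup>2" for a
            using E2[OF y'(2), of "t - u" a] by (simp add: h_def[symmetric] L_def power2_eq_square mult.assoc)
          have "h\<^sup>2 \<le> h * 1"
            unfolding power2_eq_square using h by (intro mult_mono) auto
          then have "C * h\<^sup>2 \<le> C * h" using C by simp
          then show "\<bar>engel_coords (\<phi> u) (\<phi>' y (t - u)) $ 2\<bar> \<le> 2 * C * h"
            using d[of 2] E3[of "t - u" 2] by (simp add: h_def[symmetric] L_def)
          show "\<bar>engel_coords (\<phi> u) (\<phi>' y (t - u)) $ 3\<bar> \<le> C3 * r\<^sup>2 + 2 * (C * h\<^sup>2)"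
            using d[of 3] zL[of 3] z3 by linarith
        qed
        also have "\<dots> \<le> (2 * C * C1 * r) * (C3 * r\<^sup>2 + 2 * (C * C1\<^sup>2 * r\<^sup>2)) + 4 * C ^ 3 * (C1 ^ 3 * r ^ 3)"
        proof (rule add_mono)
          show "2 * C * h * (C3 * r\<^sup>2 + 2 * (C * h\<^sup>2)) \<le> 2 * C * C1 * r * (C3 * r\<^sup>2 + 2 * (C * C1\<^sup>2 * r\<^sup>2))"
            by (rule mult_mono[OF hC]) (use Ch2 C C1 C3 r in auto)
          have "(2 * C * h) ^ 3 / 2 = 4 * C ^ 3 * h ^ 3"
            by (simp add: power_mult_distrib)
          also have "\<dots> \<le> 4 * C ^ 3 * (C1 ^ 3 * r ^ 3)"
            using h3 C by (intro mult_left_mono) auto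
          finally show "(2 * C * h) ^ 3 / 2 \<le> 4 * C ^ 3 * (C1 ^ 3 * r ^ 3)" .
        qed
        also have "\<dots> = (2 * C * C1 * (C3 + 2 * C * C1\<^sup>2) + 4 * C ^ 3 * C1 ^ 3) * r ^ 3"
          by (simp add: power2_eq_square power3_eq_cube algebra_simps)
        also have "\<dots> \<le> C4 * r ^ 3" using C4(3) r by (intro mult_right_mono) auto
        finally show ?thesis .
      qed
    qed
    have "\<bar>z t $ of_nat i\<bar> \<le> B * r ^ engel_weight i"
    proof -
      have "\<bar>z t $ a\<bar> \<le> 2 * C * C1 * r" for a
      proof -
        have "t \<in> cball u h" by (simp add: h_def dist_norm norm_minus_commute)
        from z_le[OF this, of a] show ?thesis using hC unfolding z_def by linarith
      qed
      moreover have "2 * C * C1 * r \<le> B * r" "C3 * r\<^sup>2 \<le> B * r\<^sup>2" "C4 * r ^ 3 \<le> B * r ^ 3"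
        using B r by (auto intro!: mult_right_mono)
      ultimately have "\<bar>z t $ 1\<bar> \<le> B * r" "\<bar>z t $ 2\<bar> \<le> B * r" "\<bar>z t $ 3\<bar> \<le> B * r\<^sup>2" "\<bar>z t $ 4\<bar> \<le> B * r ^ 3"
        using z3 z4 by (meson order_trans)+
      then show ?thesis
        using i unfolding atLeastAtMost_1_4 by (elim insertE) (auto simp: engel_weight_def)
    qed
    then show "\<bar>engel_coords (\<phi> u) (\<phi> t - \<phi> u) $ of_nat i\<bar> \<le> (B * s\<^sup>2) ^ engel_weight i"
      using r i B(1) unfolding z_def r_def by (intro weight_power_le[OF B(1) order_refl]) auto
  qed
qed

section \<open>Density of the surface measure\<close>

lemma continuous_on_locally_lipschitz:
  fixes F :: "'a::metric_space \<Rightarrow> 'b::metric_space"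
  assumes U: "open U" and lip: "\<And>u. u \<in> U \<Longrightarrow> \<exists>e>0. \<exists>L. L-lipschitz_on (ball u e \<inter> U) F"
  shows "continuous_on U F"
proof (rule continuous_at_imp_continuous_on, rule ballI)
  fix u assume u: "u \<in> U"
  then obtain e L where e: "0 < e" "L-lipschitz_on (ball u e \<inter> U) F"
    using lip by blast
  have "open (ball u e \<inter> U)" "u \<in> ball u e \<inter> U"
    using U u e(1) by auto
  then show "isCont F u"
    using lipschitz_on_continuous_on[OF e(2)] continuous_on_eq_continuous_at by blast
qed

lemma finite_coordinate_sets: "finite (coordinate_sets x f)"
  by (rule finite_subset[OF _ multi_indices_finite]) (auto simp: coordinate_sets_def)

lemma obtain_top_coordinate_set:
  fixes f :: "real^'q::finite \<Rightarrow> real^4"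
  assumes "linear f" "inj f"
  obtains I where "I \<in> coordinate_sets x f" "\<And>J. J \<in> coordinate_sets x f \<Longrightarrow> index_weight J \<le> index_weight I"
proof -
  have fin: "finite (index_weight ` coordinate_sets x f)"
    by (intro finite_imageI finite_coordinate_sets)
  have "Max (index_weight ` coordinate_sets x f) \<in> index_weight ` coordinate_sets x f"
    using fin coordinate_sets_nonempty[OF assms] by (intro Max_in) auto
  then obtain I where "I \<in> coordinate_sets x f" "index_weight I = Max (index_weight ` coordinate_sets x f)"
    by force
  with fin show thesis by (intro that[of I]) (auto intro: Max_ge)
qed

text \<open>Replacing an index set without \<open>4\<close> by one that contains \<open>4\<close> raises the weight so much that the box with
  exponents \<open>w + 2\<close> still has measure at least that of a box of weight \<open>index_weight J\<close>.\<close>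

lemma index_weight_compare:
  assumes I: "I \<in> multi_indices n" "4 \<notin> I" and J: "J \<in> multi_indices n" "4 \<in> J"
  shows "index_weight I + 2 * n \<le> 2 * index_weight J"
proof -
  note lI = multi_indices_list[OF I(1)] and lJ = multi_indices_list[OF J(1)]
  have cI: "card I = n" and cJ: "card J = n"
    using I(1) J(1) by (auto simp: multi_indices_def)
  have sub: "I \<subseteq> {1, 2, 3}"
    using lI(4) I(2) unfolding atLeastAtMost_1_4 by blast
  have "card I \<le> card {1, 2, 3 :: nat}"
    using sub by (intro card_mono) auto
  then have n3: "n \<le> 3" using cI by simp
  have "index_weight I \<le> (\<Sum>i\<in>I. 1 + (if i = 3 then 1 else 0))"
    unfolding index_weight_def using sub by (intro sum_mono) (auto simp: engel_weight_def)
  also have "\<dots> \<le> n + 1"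
    using lI(1) cI by (simp add: sum.distrib del: One_nat_def)
  finally have 1: "index_weight I \<le> n + 1" .
  have "n + 2 = 3 + card (J - {4})"
    using card.remove[OF lJ(1) J(2)] cJ by simp
  also have "card (J - {4}) \<le> (\<Sum>i\<in>J - {4}. engel_weight i)"
  proof -
    have "(\<Sum>i\<in>J - {4}. 1) \<le> (\<Sum>i\<in>J - {4}. engel_weight i)"
    proof (rule sum_mono)
      fix i assume "i \<in> J - {4}"
      then have "i \<in> {1..4}" using lJ(4) by blast
      from engel_weight_pos[OF this] show "1 \<le> engel_weight i" by simp
    qed
    then show ?thesis by simp
  qed
  also have "3 + (\<Sum>i\<in>J - {4}. engel_weight i) = index_weight J"
    unfolding index_weight_def using sum.remove[OF lJ(1) J(2), of engel_weight]
    by (simp add: engel_weight_def)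
  finally have "n + 2 \<le> index_weight J" by simp
  then show ?thesis using 1 n3 by linarith
qed

lemma borel_sublevel:
  fixes g :: "'a::euclidean_space \<Rightarrow> real"
  assumes "compact K" "continuous_on K g"
  shows "{t \<in> K. g t < r} \<in> sets borel"
proof -
  have "compact {t \<in> K. g t \<in> {r..}}"
    using assms by (intro compact_preimage) auto
  then have "K - {t \<in> K. g t \<in> {r..}} \<in> sets borel"
    using assms(1) by (intro sets.Diff borel_compact)
  moreover have "K - {t \<in> K. g t \<in> {r..}} = {t \<in> K. g t < r}" by auto
  ultimately show ?thesis by simp
qed

text \<open>The bound \<open>D\<close> is assumed at all points of the chart, because the case with exponents \<open>w + 2\<close>
  compares the weight at \<open>u\<close> with the one at another point. The constants depend on \<open>u\<close>.\<close>

lemma ball_density: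
  fixes \<phi> :: "real^'q::{finite,wellorder} \<Rightarrow> real^4"
    and \<phi>' :: "real^'q::_ \<Rightarrow> (real^'q::_) \<Rightarrow>\<^sub>L (real^4)"
  assumes \<rho>: "homogeneous_distance \<rho>" and U: "open U"
    and der: "\<And>t. t \<in> U \<Longrightarrow> (\<phi> has_derivative blinfun_apply (\<phi>' t)) (at t)"
    and inj: "\<And>t. t \<in> U \<Longrightarrow> inj (blinfun_apply (\<phi>' t))"
    and lip: "\<And>u. u \<in> U \<Longrightarrow> \<exists>e>0. \<exists>L. L-lipschitz_on (ball u e \<inter> U) \<phi>'"
    and D: "\<And>t J. t \<in> U \<Longrightarrow> J \<in> coordinate_sets (\<phi> t) (blinfun_apply (\<phi>' t)) \<Longrightarrow> index_weight J \<le> D"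
    and K0: "compact K0" "K0 \<subseteq> U" "u \<in> interior K0"
  obtains c r0 where "0 < c" "0 < r0"
    "\<And>r. 0 < r \<Longrightarrow> r < r0 \<Longrightarrow> ennreal (c * r ^ D) \<le> emeasure lborel {t \<in> K0. \<rho> (\<phi> u) (\<phi> t) < r}"
proof -
  have u: "u \<in> U" using K0 interior_subset by blast
  have linD: "linear (blinfun_apply (\<phi>' t))" for t
    by (rule bounded_linear.linear[OF blinfun.bounded_linear_right])
  obtain I where I: "I \<in> coordinate_sets (\<phi> u) (blinfun_apply (\<phi>' u))"
    and top: "\<And>J. J \<in> coordinate_sets (\<phi> u) (blinfun_apply (\<phi>' u)) \<Longrightarrow> index_weight J \<le> index_weight I"
    using obtain_top_coordinate_set[OF linD inj[OF u]] by blast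
  have Im: "I \<in> multi_indices CARD('q)" using I by (simp add: coordinate_sets_def)
  obtain j :: "'q \<Rightarrow> nat" where j: "bij_betw j UNIV I" "I \<subseteq> {1..4}"
    "inj (blinfun_apply (chart_coords j (\<phi> u) o\<^sub>L \<phi>' u))" "(\<Sum>k\<in>UNIV. engel_weight (j k)) = index_weight I"
    using coordinate_sets_bij[OF I] by blast
  define N where "N t = chart_coords j (\<phi> u) o\<^sub>L \<phi>' t" for t
  define G where "G t = chart_coords j (\<phi> u) (\<phi> t - \<phi> u)" for t
  obtain m c K where mcK: "0 < m" "0 < c" "0 < K" "\<And>h. 2 * m * norm h \<le> norm (N u h)"
    "\<And>L. norm (L - N u) \<le> m \<Longrightarrow> c \<le> \<bar>det (matrix (blinfun_apply L))\<bar>"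
    "\<And>L. norm (L - N u) \<le> m \<Longrightarrow> \<bar>det (matrix (blinfun_apply L))\<bar> \<le> K"
    by (rule blinfun_det_near[of "N u"]) (use j(3) in \<open>simp_all add: N_def\<close>)
  obtain \<epsilon> C where \<epsilon>: "0 < \<epsilon>" "\<epsilon> \<le> 1" and C: "0 < C" and \<epsilon>U: "cball u \<epsilon> \<subseteq> U"
    and E1: "\<And>t i. t \<in> cball u \<epsilon> \<Longrightarrow>
      \<bar>engel_coords (\<phi> u) (\<phi> t - \<phi> u) $ i - engel_coords (\<phi> u) (\<phi>' u (t - u)) $ i\<bar> \<le> C * (norm (t - u))\<^sup>2"
    and E2: "\<And>t i k. t \<in> cball u \<epsilon> \<Longrightarrow>
      \<bar>engel_coords (\<phi> u) (\<phi>' t k) $ i - engel_coords (\<phi> u) (\<phi>' u k) $ i\<bar> \<le> C * norm (t - u) * norm k"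
    and E3: "\<And>k i. \<bar>engel_coords (\<phi> u) (\<phi>' u k) $ i\<bar> \<le> C * norm k"
    by (rule second_order_estimate[OF U der lip u]) auto
  have cont\<phi>: "continuous_on U \<phi>"
    using der has_derivative_continuous by (intro continuous_at_imp_continuous_on) blast
  have contN: "continuous_on U N"
    unfolding N_def
    by (intro bounded_bilinear.continuous_on[OF bounded_bilinear_blinfun_compose]
        continuous_intros continuous_on_locally_lipschitz[OF U lip])
  have "open (U \<inter> N -` ball (N u) m)"
    using contN U by (intro continuous_open_preimage) auto
  then have "open (U \<inter> N -` ball (N u) m \<inter> interior K0 \<inter> ball u \<epsilon>)" by auto
  moreover have "u \<in> U \<inter> N -` ball (N u) m \<inter> interior K0 \<inter> ball u \<epsilon>"
    using u mcK(1) K0(3) \<epsilon>(1) by simp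
  ultimately obtain \<delta> where \<delta>: "0 < \<delta>" "cball u \<delta> \<subseteq> U \<inter> N -` ball (N u) m \<inter> interior K0 \<inter> ball u \<epsilon>"
    using open_contains_cball by blast
  let ?S = "cball u \<delta>"
  have SU: "?S \<subseteq> U" and SK: "?S \<subseteq> K0" and S\<epsilon>: "?S \<subseteq> cball u \<epsilon>"
    using \<delta>(2) interior_subset ball_subset_cball by blast+
  have near: "norm (N t - N u) \<le> m" if "t \<in> ?S" for t
  proof -
    have "N t \<in> ball (N u) m" using \<delta>(2) that by blast
    then show ?thesis by (simp add: dist_norm norm_minus_commute)
  qed
  have "u + \<delta> *\<^sub>R axis undefined 1 \<in> cball u \<delta>"
    using \<delta>(1) by (simp add: dist_norm norm_axis_1)
  then have "u + \<delta> *\<^sub>R axis undefined 1 \<in> cball u \<epsilon>" using S\<epsilon> by blast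
  then have \<delta>1: "\<delta> \<le> 1" using \<delta>(1) \<epsilon>(2) by (simp add: dist_norm norm_axis_1)
  have derG: "(G has_derivative blinfun_apply (N t)) (at t)" if "t \<in> ?S" for t
  proof -
    have "t \<in> U" using that SU by blast
    then show ?thesis
      unfolding G_def N_def by (intro chart_coords_translate_derivative der)
  qed
  have expand: "m * norm (a - b) \<le> norm (G a - G b)" if "a \<in> ?S" "b \<in> ?S" for a b
    by (rule expanding_of_derivative_near[OF convex_cball derG near mcK(4) that])
  have injG: "inj_on G ?S"
  proof (rule inj_onI)
    fix a b assume ab: "a \<in> ?S" "b \<in> ?S" "G a = G b"
    then show "a = b" using expand[OF ab(1,2)] mcK(1) by (simp add: mult_le_0_iff)
  qed
  have G0: "G u = 0" unfolding G_def by (simp add: blinfun.zero_right del: chart_coords_apply)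
  have injN: "inj (blinfun_apply (N u))" using j(3) by (simp add: N_def)
  obtain \<eta> where \<eta>: "0 < \<eta>" "\<And>Q. compact Q \<Longrightarrow> Q \<subseteq> ball (G u) \<eta> \<Longrightarrow>
      measure lebesgue Q \<le> K * measure lebesgue {t \<in> ?S. G t \<in> Q}"
    by (rule measure_preimage_ge[OF \<delta>(1) derG continuous_on_subset[OF contN SU] injG injN mcK(6)[OF near]]) blast+
  \<comment> \<open>\<open>flat\<close> says that the box with sides \<open>r ^ w\<close> can be used\<close>
  define flat where "flat \<longleftrightarrow> 4 \<in> I \<or> (\<forall>t\<in>U. \<forall>k. engel_coords (\<phi> t) (\<phi>' t k) $ 4 = 0)"
  define e where "e k = (if flat then 2 * engel_weight (j k) else engel_weight (j k) + 2)" for k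
  have e1: "1 \<le> e k" for k
  proof -
    have "j k \<in> {1..4}" using bij_betwE[OF j(1)] j(2) by blast
    then show ?thesis using engel_weight_pos by (fastforce simp: e_def)
  qed
  have sum_e: "(\<Sum>k\<in>UNIV. e k) \<le> 2 * D"
  proof (cases flat)
    case True
    then have "(\<Sum>k\<in>UNIV. e k) = 2 * index_weight I"
      by (simp add: e_def j(4) flip: sum_distrib_left)
    then show ?thesis using D[OF u I] by simp
  next
    case False
    then obtain t k where t: "t \<in> U" "engel_coords (\<phi> t) (\<phi>' t k) $ 4 \<noteq> 0" and I4: "4 \<notin> I"
      unfolding flat_def by blast
    obtain J where J: "J \<in> coordinate_sets (\<phi> t) (blinfun_apply (\<phi>' t))"
      "\<And>J'. J' \<in> coordinate_sets (\<phi> t) (blinfun_apply (\<phi>' t)) \<Longrightarrow> index_weight J' \<le> index_weight J"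
      using obtain_top_coordinate_set[OF linD inj[OF t(1)]] by blast
    have "4 \<in> J"
      using top_coordinate_set_cases(1)[OF J] t(2) by blast
    moreover have "J \<in> multi_indices CARD('q)" using J by (simp add: coordinate_sets_def)
    ultimately have "index_weight I + 2 * CARD('q) \<le> 2 * index_weight J"
      using Im I4 by (intro index_weight_compare)
    also have "\<dots> \<le> 2 * D" using D[OF t(1) J(1)] by simp
    finally show ?thesis
      using False by (simp add: e_def sum.distrib j(4) del: add_2_eq_Suc')
  qed
  have derS: "(\<phi> has_derivative blinfun_apply (\<phi>' t)) (at t)" if "t \<in> ?S" for t
  proof -
    have "t \<in> U" using that SU by blast
    then show ?thesis by (rule der)
  qed
  have in\<epsilon>: "t \<in> cball u \<epsilon>" if "t \<in> ?S" for t using that S\<epsilon> by blast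
  have expand_u: "m * norm (t - u) \<le> norm (chart_coords j (\<phi> u) (\<phi> t - \<phi> u))" if "t \<in> ?S" for t
    using expand[OF that, of u] \<delta>(1) G0 by (simp add: G_def del: chart_coords_apply)
  have e_cases: "(\<forall>k. e k = 2 * engel_weight (j k)) \<and>
        (4 \<in> I \<or> (\<forall>t\<in>?S. \<forall>k. engel_coords (\<phi> t) (\<phi>' t k) $ 4 = 0))
      \<or> (\<forall>k. e k = engel_weight (j k) + 2) \<and> 4 \<notin> I"
    using SU by (auto simp: e_def flat_def)
  obtain B where B: "1 \<le> B"
    "\<And>s t i. \<lbrakk>0 < s; s \<le> 1; t \<in> ?S; G t \<in> weighted_box e s; i \<in> {1..4}\<rbrakk>
       \<Longrightarrow> \<bar>engel_coords (\<phi> u) (\<phi> t - \<phi> u) $ of_nat i\<bar> \<le> (B * s\<^sup>2) ^ engel_weight i"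
    unfolding G_def
    by (rule weighted_box_in_ball[OF \<delta>(1) \<delta>1 C derS E1[OF in\<epsilon>] E2[OF in\<epsilon>] E3 j(1,2) mcK(1) expand_u
      top_coordinate_set_cases[OF I top] e_cases]) blast+
  obtain C0 where C0: "0 < C0"
    "\<And>z r. 0 < r \<Longrightarrow> (\<And>i. i \<in> {1..4} \<Longrightarrow> \<bar>z $ of_nat i\<bar> \<le> r ^ engel_weight i) \<Longrightarrow> \<rho> 0 z \<le> C0 * r"
    using homogeneous_distance_le[OF \<rho>] by blast
  define n where "n = real CARD('q)"
  have n: "0 < n" by (simp add: n_def)
  define s0 where "s0 = min 1 (\<eta> / (2 * n))"
  have s0: "0 < s0" "s0 \<le> 1" "n * s0 < \<eta>"
  proof -
    show "0 < s0" "s0 \<le> 1" using \<eta>(1) n by (auto simp: s0_def)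
    have "n * s0 \<le> n * (\<eta> / (2 * n))" using n by (intro mult_left_mono) (auto simp: s0_def)
    also have "\<dots> < \<eta>" using n \<eta>(1) by simp
    finally show "n * s0 < \<eta>" .
  qed
  define A where "A = 2 * (C0 * B)"
  have A: "0 < A" using C0(1) B(1) by (simp add: A_def)
  show thesis
  proof (rule that)
    show "0 < 2 ^ CARD('q) / K / A ^ D" using mcK(3) A by simp
    show "0 < A * s0\<^sup>2" using A s0 by simp
    fix r :: real assume r: "0 < r" "r < A * s0\<^sup>2"
    \<comment> \<open>chosen so that the distance bound \<open>C0 * (B * s\<^sup>2)\<close> equals \<open>r / 2 < r\<close>\<close>
    define s where "s = sqrt (r / A)"
    have s2: "s\<^sup>2 = r / A" using r A by (simp add: s_def)
    have s: "0 < s" using r A by (simp add: s_def)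
    have "s\<^sup>2 \<le> s0\<^sup>2" using r A by (simp add: s2 field_simps)
    then have ss0: "s \<le> s0" using s0(1) by (rule power2_le_imp_le[OF _ less_imp_le])
    then have s1: "s \<le> 1" using s0(2) by simp
    let ?P = "{t \<in> ?S. G t \<in> weighted_box e s}"
    have "weighted_box e s \<subseteq> ball (G u) \<eta>"
    proof
      fix q assume q: "q \<in> weighted_box e s"
      have "norm q \<le> (\<Sum>k\<in>UNIV. \<bar>q $ k\<bar>)" by (rule norm_le_l1_cart)
      also have "\<dots> \<le> (\<Sum>k::'q\<in>UNIV. s ^ 1)"
      proof (rule sum_mono)
        fix k
        have "s ^ e k \<le> s ^ 1" using s s1 e1[of k] by (intro power_decreasing) auto
        then show "\<bar>q $ k\<bar> \<le> s ^ 1" using q by (auto simp: weighted_box_def intro: order_trans)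
      qed
      also have "\<dots> \<le> n * s0" using ss0 n by (simp add: n_def)
      also have "\<dots> < \<eta>" by (rule s0(3))
      finally show "q \<in> ball (G u) \<eta>" by (simp add: G0)
    qed
    from \<eta>(2)[OF compact_weighted_box this]
    have "2 ^ CARD('q) * s ^ (\<Sum>k\<in>UNIV. e k) \<le> K * measure lebesgue ?P"
      using s by (simp add: measure_weighted_box)
    moreover have "s ^ (2 * D) \<le> s ^ (\<Sum>k\<in>UNIV. e k)"
      using s s1 sum_e by (intro power_decreasing) auto
    ultimately have "2 ^ CARD('q) * s ^ (2 * D) \<le> K * measure lebesgue ?P"
      by (smt (verit) mult_left_mono zero_le_power)
    moreover have "s ^ (2 * D) = r ^ D / A ^ D"
      by (simp only: power_mult s2 power_divide)
    ultimately have "2 ^ CARD('q) * (r ^ D / A ^ D) \<le> K * measure lebesgue ?P"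
      by simp
    then have 1: "2 ^ CARD('q) / K / A ^ D * r ^ D \<le> measure lebesgue ?P"
      using mcK(3) A by (simp add: field_simps)
    have P: "compact ?P"
      using derG by (intro compact_preimage compact_cball compact_imp_closed[OF compact_weighted_box]
          continuous_at_imp_continuous_on ballI has_derivative_continuous)
    have "?P \<subseteq> {t \<in> K0. \<rho> (\<phi> u) (\<phi> t) < r}"
    proof clarify
      fix t assume t: "t \<in> ?S" "G t \<in> weighted_box e s"
      have "\<rho> 0 (engel_coords (\<phi> u) (\<phi> t - \<phi> u)) \<le> C0 * (B * s\<^sup>2)"
        using B(1) s by (intro C0(2) B(2)[OF s s1 t]) auto
      also have "\<dots> = r / 2" using C0(1) B(1) by (simp add: s2 A_def)
      also have "\<dots> < r" using r by simp
      finally show "t \<in> K0 \<and> \<rho> (\<phi> u) (\<phi> t) < r"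
        using SK t(1) homogeneous_distance_coords[OF \<rho>, of "\<phi> u" "\<phi> t"] by auto
    qed
    moreover have "{t \<in> K0. \<rho> (\<phi> u) (\<phi> t) < r} \<in> sets borel"
      using K0(1)
    proof (rule borel_sublevel)
      show "continuous_on K0 (\<lambda>t. \<rho> (\<phi> u) (\<phi> t))"
        by (intro continuous_on_compose2[OF continuous_homogeneous_distance_0[OF \<rho>, of UNIV]]
          continuous_on_subset[OF cont\<phi> K0(2)]) auto
    qed
    ultimately have "emeasure lborel ?P \<le> emeasure lborel {t \<in> K0. \<rho> (\<phi> u) (\<phi> t) < r}"
      by (intro emeasure_mono) auto
    moreover have "emeasure lborel ?P = ennreal (measure lebesgue ?P)"
      using P emeasure_compact_finite[OF P] by (simp add: emeasure_eq_ennreal_measure measure_completion borel_compact)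
    ultimately show "ennreal (2 ^ CARD('q) / K / A ^ D * r ^ D) \<le> emeasure lborel {t \<in> K0. \<rho> (\<phi> u) (\<phi> t) < r}"
      by (intro order_trans[OF ennreal_leI[OF 1]]) simp
  qed
qed

lemma hausdorff_measure_chart_eq_0:
  fixes \<phi> :: "real^'q::{finite,wellorder} \<Rightarrow> real^4"
    and \<phi>' :: "real^'q::_ \<Rightarrow> (real^'q::_) \<Rightarrow>\<^sub>L (real^4)"
  assumes \<rho>: "homogeneous_distance \<rho>" and U: "open U"
    and der: "\<And>t. t \<in> U \<Longrightarrow> (\<phi> has_derivative blinfun_apply (\<phi>' t)) (at t)"
    and inj: "\<And>t. t \<in> U \<Longrightarrow> inj (blinfun_apply (\<phi>' t))"
    and lip: "\<And>u. u \<in> U \<Longrightarrow> \<exists>e>0. \<exists>L. L-lipschitz_on (ball u e \<inter> U) \<phi>'"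
    and D: "\<And>t J. t \<in> U \<Longrightarrow> J \<in> coordinate_sets (\<phi> t) (blinfun_apply (\<phi>' t)) \<Longrightarrow> index_weight J \<le> D"
    and K0: "compact K0" "K0 \<subseteq> U" and s: "real D < s"
  shows "hausdorff_measure \<rho> s (\<phi> ` interior K0) = 0"
proof -
  define c where "c n = 1 / real (Suc n)" for n
  have c0: "0 < c n" for n by (simp add: c_def)
  \<comment> \<open>the pieces with uniform constants\<close>
  define A where "A n = {x \<in> \<phi> ` interior K0. \<forall>r. 0 < r \<longrightarrow> r < c n \<longrightarrow>
      ennreal (c n * r ^ D) \<le> emeasure lborel {t \<in> K0. \<rho> x (\<phi> t) < r}}" for n
  have cont\<phi>: "continuous_on U \<phi>"
    using der has_derivative_continuous by (intro continuous_at_imp_continuous_on) blast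
  have meas: "{t \<in> K0. \<rho> x (\<phi> t) < r} \<in> sets lborel" for x r
    unfolding sets_lborel using K0(1)
  proof (rule borel_sublevel)
    show "continuous_on K0 (\<lambda>t. \<rho> x (\<phi> t))"
      by (intro continuous_on_compose2[OF continuous_homogeneous_distance_0[OF \<rho>, of UNIV]]
          continuous_on_subset[OF cont\<phi> K0(2)]) auto
  qed
  have "hausdorff_measure \<rho> s (A n) = 0" for n
  proof (rule hausdorff_measure_eq_0_of_density[where M = lborel and K = K0 and f = \<phi> and c = "c n" and R = "c n"])
    show "Metric_space UNIV \<rho>" using \<rho> by (simp add: homogeneous_distance_def)
    show "emeasure lborel K0 < \<infinity>" using emeasure_compact_finite[OF K0(1)] by simp
    show "K0 \<in> sets lborel" using borel_compact[OF K0(1)] by simp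
  qed (use c0 meas s in \<open>auto simp: A_def\<close>)
  then have "hausdorff_measure \<rho> s (\<Union>(range A)) = 0"
    by (intro hausdorff_measure_countable_Union) auto
  moreover have "\<phi> ` interior K0 \<subseteq> \<Union>(range A)"
  proof
    fix x assume x: "x \<in> \<phi> ` interior K0"
    then obtain u where u: "u \<in> interior K0" "x = \<phi> u" by blast
    obtain b r0 where b: "0 < b" "0 < r0"
      "\<And>r. 0 < r \<Longrightarrow> r < r0 \<Longrightarrow> ennreal (b * r ^ D) \<le> emeasure lborel {t \<in> K0. \<rho> (\<phi> u) (\<phi> t) < r}"
      by (rule ball_density[OF \<rho> U der inj lip D K0 u(1)]) (assumption | blast)+
    obtain n where n: "c n < min b r0"
      using reals_Archimedean[of "min b r0"] b(1,2) by (auto simp: c_def inverse_eq_divide)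
    have "ennreal (c n * r ^ D) \<le> emeasure lborel {t \<in> K0. \<rho> x (\<phi> t) < r}" if "0 < r" "r < c n" for r
    proof -
      have "ennreal (c n * r ^ D) \<le> ennreal (b * r ^ D)"
        using n that by (intro ennreal_leI mult_right_mono) auto
      also have "\<dots> \<le> emeasure lborel {t \<in> K0. \<rho> x (\<phi> t) < r}"
        unfolding u(2) using that n by (intro b(3)) auto
      finally show ?thesis .
    qed
    then have "x \<in> A n" using x by (simp add: A_def)
    then show "x \<in> \<Union>(range A)" by blast
  qed
  ultimately show ?thesis by (rule hausdorff_measure_mono[rotated])
qed

section \<open>Degree and Hausdorff dimension\<close>

text \<open>The estimates for preimages of boxes refer to a well-ordered index type. Since the notion of a
  submanifold depends on the index type only through its cardinality, the parameter space can be
  moved to a numeral type, which is well-ordered.\<close>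

lemma C11_submanifold_reindex:
  fixes S :: "(real^'n::finite) set"
  assumes S: "C11_submanifold TYPE('p::finite) S" and card: "CARD('p) = CARD('q::finite)"
  shows "C11_submanifold TYPE('q) S"
proof -
  obtain b :: "'p \<Rightarrow> 'q" where b: "bij b"
    using finite_same_card_bij[of "UNIV :: 'p set" "UNIV :: 'q set"] card by auto
  define g where "g y = (\<chi> i. y $ b i)" for y :: "real^'q"
  define g' where "g' x = (\<chi> k. x $ inv b k)" for x :: "real^'p"
  have gg': "g (g' x) = x" "g' (g y) = y" for x y
    using b by (simp_all add: g_def g'_def vec_eq_iff bij_is_inj bij_is_surj surj_f_inv_f)
  have ling: "linear g" "linear g'"
    by (auto simp: g_def g'_def vec_eq_iff intro!: linearI)
  have norm: "norm (g y) = norm y" for y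
    unfolding norm_vec_def L2_set_def g_def
    using sum.reindex_bij_betw[OF b, of "\<lambda>k. (norm (y $ k))\<^sup>2"] by simp
  have blg: "bounded_linear g" using ling linear_conv_bounded_linear by blast
  define gb where "gb = Blinfun g"
  have gb: "blinfun_apply gb = g" unfolding gb_def using blg by (rule bounded_linear_Blinfun_apply)
  have contg: "continuous_on A g" "continuous_on B g'" for A B
    using ling linear_continuous_on linear_conv_bounded_linear by blast+
  have param: "\<exists>(V :: (real^'q) set) \<psi>. C11_parametrization V \<psi> W"
    if W: "C11_parametrization U \<phi> W" for U :: "(real^'p) set" and \<phi> W
  proof (intro exI)
    obtain \<psi> \<phi>' where U: "open U" and hom: "homeomorphism U W \<phi> \<psi>"
      and der: "\<And>u. u \<in> U \<Longrightarrow> (\<phi> has_derivative blinfun_apply (\<phi>' u)) (at u)"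
      and inj: "\<And>u. u \<in> U \<Longrightarrow> inj (blinfun_apply (\<phi>' u))"
      and lip: "\<And>u. u \<in> U \<Longrightarrow> \<exists>e>0. \<exists>L. L-lipschitz_on (ball u e \<inter> U) \<phi>'"
      using W unfolding C11_parametrization_def by blast
    define V where "V = g -` U"
    have VU: "g y \<in> U" if "y \<in> V" for y using that by (simp add: V_def)
    have openV: "open V"
      unfolding V_def using U contg(1)[of UNIV] by (rule open_vimage)
    have homV: "homeomorphism V W (\<phi> \<circ> g) (g' \<circ> \<psi>)"
    proof (rule homeomorphism_compose[OF _ hom])
      show "homeomorphism V U g g'"
        by (rule homeomorphismI) (use contg gg' in \<open>auto simp: V_def\<close>)
    qed
    have derV: "(\<phi> \<circ> g has_derivative blinfun_apply (\<phi>' (g y) o\<^sub>L gb)) (at y)"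
      and injV: "inj (blinfun_apply (\<phi>' (g y) o\<^sub>L gb))" if "y \<in> V" for y
    proof -
      show "(\<phi> \<circ> g has_derivative blinfun_apply (\<phi>' (g y) o\<^sub>L gb)) (at y)"
        unfolding blinfun_compose.rep_eq gb
        by (rule diff_chain_at[OF bounded_linear_imp_has_derivative[OF blg] der[OF VU[OF that]]])
      have "inj g" using gg'(2) by (metis injI)
      then show "inj (blinfun_apply (\<phi>' (g y) o\<^sub>L gb))"
        unfolding blinfun_compose.rep_eq gb by (rule inj_compose[OF inj[OF VU[OF that]]])
    qed
    have lipV: "\<exists>e>0. \<exists>L. L-lipschitz_on (ball y e \<inter> V) (\<lambda>y. \<phi>' (g y) o\<^sub>L gb)" if y: "y \<in> V" for y
    proof -
      obtain e L where e: "0 < e" "L-lipschitz_on (ball (g y) e \<inter> U) \<phi>'"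
        using lip[OF VU[OF y]] by blast
      have dg: "dist (g a) (g c) = dist a c" for a c
        using norm[of "a - c"] ling(1) by (simp add: dist_norm linear_diff)
      have "norm gb \<le> 1"
        by (rule norm_blinfun_bound) (simp_all add: gb norm)
      have "L-lipschitz_on (ball y e \<inter> V) (\<lambda>y. \<phi>' (g y) o\<^sub>L gb)"
      proof (rule lipschitz_onI)
        fix a c assume a: "a \<in> ball y e \<inter> V" and c: "c \<in> ball y e \<inter> V"
        have "dist (\<phi>' (g a) o\<^sub>L gb) (\<phi>' (g c) o\<^sub>L gb) = norm ((\<phi>' (g a) - \<phi>' (g c)) o\<^sub>L gb)"
          by (simp add: dist_norm blinfun_eqI blinfun.diff_left
              bounded_bilinear.diff_left[OF bounded_bilinear_blinfun_compose])
        also have "\<dots> \<le> norm (\<phi>' (g a) - \<phi>' (g c)) * norm gb"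
          by (rule norm_blinfun_compose)
        also have "\<dots> \<le> norm (\<phi>' (g a) - \<phi>' (g c)) * 1"
          using \<open>norm gb \<le> 1\<close> by (intro mult_left_mono) auto
        also have "\<dots> \<le> L * dist (g a) (g c)"
          using lipschitz_onD[OF e(2), of "g a" "g c"] a c VU dg by (simp add: dist_norm)
        finally show "dist (\<phi>' (g a) o\<^sub>L gb) (\<phi>' (g c) o\<^sub>L gb) \<le> L * dist a c"
          by (simp add: dg)
      qed (rule lipschitz_on_nonneg[OF e(2)])
      then show ?thesis using e(1) by blast
    qed
    show "C11_parametrization V (\<phi> \<circ> g) W"
      unfolding C11_parametrization_def
      by (intro conjI exI[of _ "g' \<circ> \<psi>"] exI[of _ "\<lambda>y. \<phi>' (g y) o\<^sub>L gb"] ballI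
          openV homV derV injV lipV)
  qed
  show ?thesis
    unfolding C11_submanifold_def
  proof
    fix x assume "x \<in> S"
    then obtain W and U :: "(real^'p) set" and \<phi>
      where W: "x \<in> W" "openin (top_of_set S) W" "C11_parametrization U \<phi> W"
      using S unfolding C11_submanifold_def by blast
    show "\<exists>W. x \<in> W \<and> openin (top_of_set S) W \<and>
        (\<exists>(U :: (real^'q) set) \<phi>. C11_parametrization U \<phi> W)"
      by (intro exI[of _ W] conjI W(1,2) param[OF W(3)])
  qed
qed

lemma submanifold_chart:
  fixes \<Sigma> :: "(real^4) set"
  assumes "C11_submanifold TYPE('q::finite) \<Sigma>" "x \<in> \<Sigma>"
  obtains U :: "(real^'q) set" and \<phi> \<phi>' u where "open U" "u \<in> U" "\<phi> u = x" "\<phi> ` U \<subseteq> \<Sigma>"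
    "\<And>V. open V \<Longrightarrow> V \<subseteq> U \<Longrightarrow> openin (top_of_set \<Sigma>) (\<phi> ` V)"
    "\<And>u. u \<in> U \<Longrightarrow> (\<phi> has_derivative blinfun_apply (\<phi>' u)) (at u)"
    "\<And>u. u \<in> U \<Longrightarrow> inj (blinfun_apply (\<phi>' u))"
    "\<And>u. u \<in> U \<Longrightarrow> \<exists>e>0. \<exists>L. L-lipschitz_on (ball u e \<inter> U) \<phi>'"
    "\<And>u. u \<in> U \<Longrightarrow> pointwise_degree \<Sigma> (\<phi> u) = Max (index_weight ` coordinate_sets (\<phi> u) (blinfun_apply (\<phi>' u)))"
proof -
  obtain W and U :: "(real^'q) set" and \<phi> where W: "x \<in> W" "openin (top_of_set \<Sigma>) W" "C11_parametrization U \<phi> W"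
    using assms unfolding C11_submanifold_def by blast
  then obtain \<psi> \<phi>' where U: "open U" and hom: "homeomorphism U W \<phi> \<psi>"
    and der: "\<And>u. u \<in> U \<Longrightarrow> (\<phi> has_derivative blinfun_apply (\<phi>' u)) (at u)"
    and inj: "\<And>u. u \<in> U \<Longrightarrow> inj (blinfun_apply (\<phi>' u))"
    and lip: "\<And>u. u \<in> U \<Longrightarrow> \<exists>e>0. \<exists>L. L-lipschitz_on (ball u e \<inter> U) \<phi>'"
    unfolding C11_parametrization_def by blast
  have im: "\<phi> ` U = W" using hom by (simp add: homeomorphism_def)
  then obtain u where u: "u \<in> U" "\<phi> u = x" using W(1) by blast
  have sub: "\<phi> ` U \<subseteq> \<Sigma>" using im W(2) openin_imp_subset by blast
  have op: "openin (top_of_set \<Sigma>) (\<phi> ` V)" if V: "open V" "V \<subseteq> U" for V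
  proof -
    have "openin (top_of_set U) V"
      using V by (auto simp: openin_open)
    then have "openin (top_of_set W) (\<phi> ` V)"
      by (rule homeomorphism_imp_open_map[OF hom])
    then show ?thesis using W(2) openin_trans by blast
  qed
  have deg: "pointwise_degree \<Sigma> (\<phi> t) = Max (index_weight ` coordinate_sets (\<phi> t) (blinfun_apply (\<phi>' t)))"
    if t: "t \<in> U" for t
  proof (rule pointwise_degree_eq)
    show "linear (blinfun_apply (\<phi>' t))"
      by (rule bounded_linear.linear[OF blinfun.bounded_linear_right])
    show "inj (blinfun_apply (\<phi>' t))" by (rule inj[OF t])
    show "tangent_space \<Sigma> (\<phi> t) = range (blinfun_apply (\<phi>' t))"
      by (rule tangent_space_parametrization[OF W(2) U hom der continuous_on_locally_lipschitz[OF U lip] t inj[OF t]])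
  qed
  show thesis
    by (rule that[OF U u sub op der inj lip deg])
qed

lemma index_weight_le_7:
  assumes "I \<subseteq> {1..4}"
  shows "index_weight I \<le> 7"
proof -
  have "index_weight I \<le> index_weight {1..4}"
    unfolding index_weight_def using assms by (intro sum_mono2) auto
  also have "\<dots> = 7"
    unfolding atLeastAtMost_1_4 index_weight_def by (simp add: engel_weight_def)
  finally show ?thesis .
qed

text \<open>The degree is attained at some point because pointwise degrees are at most \<open>7\<close>; the lower bound is
  local at such a point, the upper bound holds on each chart and countably many charts suffice.\<close>

lemma submanifold_degree_eq_hausdorff_dimension:
  fixes \<Sigma> :: "(real^4) set"
  assumes \<rho>: "homogeneous_distance \<rho>" and \<Sigma>: "C11_submanifold TYPE('q::{finite,wellorder}) \<Sigma>" and ne: "\<Sigma> \<noteq> {}"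
  shows "of_nat (submanifold_degree \<Sigma>) = hausdorff_dimension \<rho> \<Sigma>"
proof -
  have linD: "linear (blinfun_apply F)" for F :: "(real^'q::_) \<Rightarrow>\<^sub>L (real^4)"
    by (rule bounded_linear.linear[OF blinfun.bounded_linear_right])
  define D where "D = submanifold_degree \<Sigma>"
  have "pointwise_degree \<Sigma> x \<le> 7" if x: "x \<in> \<Sigma>" for x
  proof (rule submanifold_chart[OF \<Sigma> x])
    fix U :: "(real^'q::_) set" and \<phi> u
      and \<phi>' :: "real^'q::_ \<Rightarrow> (real^'q::_) \<Rightarrow>\<^sub>L (real^4)"
    assume u: "u \<in> U" "\<phi> u = x" and inj: "\<And>u. u \<in> U \<Longrightarrow> inj (blinfun_apply (\<phi>' u))"
      and deg: "\<And>u. u \<in> U \<Longrightarrow> pointwise_degree \<Sigma> (\<phi> u) = Max (index_weight ` coordinate_sets (\<phi> u) (blinfun_apply (\<phi>' u)))"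
    have "index_weight J \<le> 7" if "J \<in> coordinate_sets (\<phi> u) (blinfun_apply (\<phi>' u))" for J
      using that by (intro index_weight_le_7) (simp add: coordinate_sets_def multi_indices_def)
    then have "Max (index_weight ` coordinate_sets (\<phi> u) (blinfun_apply (\<phi>' u))) \<le> 7"
      using coordinate_sets_nonempty[OF linD inj[OF u(1)]]
      by (intro Max.boundedI finite_imageI finite_coordinate_sets) blast+
    then show ?thesis
      using deg[OF u(1)] u(2) by simp
  qed
  then have fin: "finite (pointwise_degree \<Sigma> ` \<Sigma>)"
    by (intro finite_subset[OF image_subsetI finite_atMost[of 7]]) auto
  have Dle: "pointwise_degree \<Sigma> x \<le> D" if "x \<in> \<Sigma>" for x
    unfolding D_def submanifold_degree_def using fin that by (intro Max_ge) auto
  have "D \<in> pointwise_degree \<Sigma> ` \<Sigma>"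
    unfolding D_def submanifold_degree_def using fin ne by (intro Max_in) auto
  then obtain x where x: "x \<in> \<Sigma>" "pointwise_degree \<Sigma> x = D" by blast

  have lower: "hausdorff_measure \<rho> s \<Sigma> \<noteq> 0" if s: "0 \<le> s" "s < real D" for s
  proof (rule submanifold_chart[OF \<Sigma> x(1)])
    fix U :: "(real^'q::_) set" and \<phi> u
      and \<phi>' :: "real^'q::_ \<Rightarrow> (real^'q::_) \<Rightarrow>\<^sub>L (real^4)"
    assume U: "open U" "u \<in> U" "\<phi> u = x" "\<phi> ` U \<subseteq> \<Sigma>"
      and der: "\<And>u. u \<in> U \<Longrightarrow> (\<phi> has_derivative blinfun_apply (\<phi>' u)) (at u)"
      and inj: "\<And>u. u \<in> U \<Longrightarrow> inj (blinfun_apply (\<phi>' u))"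
      and lip: "\<And>u. u \<in> U \<Longrightarrow> \<exists>e>0. \<exists>L. L-lipschitz_on (ball u e \<inter> U) \<phi>'"
      and deg: "\<And>u. u \<in> U \<Longrightarrow> pointwise_degree \<Sigma> (\<phi> u) = Max (index_weight ` coordinate_sets (\<phi> u) (blinfun_apply (\<phi>' u)))"
    have "D \<in> index_weight ` coordinate_sets (\<phi> u) (blinfun_apply (\<phi>' u))"
      unfolding x(2)[symmetric] U(3)[symmetric] deg[OF U(2)]
      using coordinate_sets_nonempty[OF linD inj[OF U(2)]]
      by (intro Max_in finite_imageI finite_coordinate_sets) auto
    then obtain I where I: "I \<in> coordinate_sets (\<phi> u) (blinfun_apply (\<phi>' u))" "D = index_weight I" by blast
    show ?thesis
      by (rule hausdorff_measure_submanifold_nonzero[OF \<rho> U(1) der continuous_on_locally_lipschitz[OF U(1) lip] U(4,2) I(1)])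
        (use s I(2) in auto)
  qed

  have upper: "hausdorff_measure \<rho> s \<Sigma> = 0" if s: "real D < s" for s
  proof -
    have "\<exists>W. y \<in> W \<and> openin (top_of_set \<Sigma>) W \<and> hausdorff_measure \<rho> s W = 0" if y: "y \<in> \<Sigma>" for y
    proof (rule submanifold_chart[OF \<Sigma> y])
      fix U :: "(real^'q::_) set" and \<phi> u
      and \<phi>' :: "real^'q::_ \<Rightarrow> (real^'q::_) \<Rightarrow>\<^sub>L (real^4)"
      assume U: "open U" "u \<in> U" "\<phi> u = y" "\<phi> ` U \<subseteq> \<Sigma>"
        and op: "\<And>V. open V \<Longrightarrow> V \<subseteq> U \<Longrightarrow> openin (top_of_set \<Sigma>) (\<phi> ` V)"
        and der: "\<And>u. u \<in> U \<Longrightarrow> (\<phi> has_derivative blinfun_apply (\<phi>' u)) (at u)"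
        and inj: "\<And>u. u \<in> U \<Longrightarrow> inj (blinfun_apply (\<phi>' u))"
        and lip: "\<And>u. u \<in> U \<Longrightarrow> \<exists>e>0. \<exists>L. L-lipschitz_on (ball u e \<inter> U) \<phi>'"
        and deg: "\<And>u. u \<in> U \<Longrightarrow> pointwise_degree \<Sigma> (\<phi> u) = Max (index_weight ` coordinate_sets (\<phi> u) (blinfun_apply (\<phi>' u)))"
      have wD: "index_weight J \<le> D" if "t \<in> U" "J \<in> coordinate_sets (\<phi> t) (blinfun_apply (\<phi>' t))" for t J
      proof -
        have "index_weight J \<le> pointwise_degree \<Sigma> (\<phi> t)"
          unfolding deg[OF that(1)] using that(2) by (intro Max_ge finite_imageI finite_coordinate_sets) auto
        also have "\<dots> \<le> D" using U(4) that(1) by (intro Dle) blast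
        finally show ?thesis .
      qed
      obtain \<delta> where \<delta>: "0 < \<delta>" "cball u \<delta> \<subseteq> U"
        using U(1,2) open_contains_cball by blast
      have "hausdorff_measure \<rho> s (\<phi> ` interior (cball u \<delta>)) = 0"
        by (rule hausdorff_measure_chart_eq_0[OF \<rho> U(1) der inj lip wD compact_cball \<delta>(2) s])
      moreover have "openin (top_of_set \<Sigma>) (\<phi> ` interior (cball u \<delta>))"
        using \<delta>(2) interior_subset by (intro op open_interior) blast
      moreover have "y \<in> \<phi> ` interior (cball u \<delta>)"
        using \<delta>(1) U(3) by auto
      ultimately show ?thesis by blast
    qed
    then have "\<Sigma> \<subseteq> \<Union>{W. openin (top_of_set \<Sigma>) W \<and> hausdorff_measure \<rho> s W = 0}" by blast
    moreover obtain F where F: "F \<subseteq> {W. openin (top_of_set \<Sigma>) W \<and> hausdorff_measure \<rho> s W = 0}" "countable F"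
      "\<Union>F = \<Union>{W. openin (top_of_set \<Sigma>) W \<and> hausdorff_measure \<rho> s W = 0}"
      by (rule Lindelof_openin[of "{W. openin (top_of_set \<Sigma>) W \<and> hausdorff_measure \<rho> s W = 0}" \<Sigma>]) auto
    moreover have "hausdorff_measure \<rho> s (\<Union>F) = 0"
      using F(1,2) by (intro hausdorff_measure_countable_Union) auto
    ultimately show ?thesis
      by (intro hausdorff_measure_mono[of \<Sigma> "\<Union>F"]) simp_all
  qed

  have "of_nat D \<le> hausdorff_dimension \<rho> \<Sigma>"
    unfolding hausdorff_dimension_def
  proof (rule Inf_greatest, clarify)
    fix s :: real assume s: "0 \<le> s" "hausdorff_measure \<rho> s \<Sigma> = 0"
    then have "real D \<le> s" using lower by (meson not_le)
    then show "of_nat D \<le> ennreal s"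
      by (simp add: ennreal_of_nat_eq_real_of_nat ennreal_leI)
  qed
  moreover have "hausdorff_dimension \<rho> \<Sigma> \<le> of_nat D"
  proof (rule ennreal_le_epsilon)
    fix \<epsilon> :: real assume \<epsilon>: "0 < \<epsilon>"
    have "hausdorff_dimension \<rho> \<Sigma> \<le> ennreal (real D + \<epsilon>)"
      unfolding hausdorff_dimension_def
    proof (intro Inf_lower CollectI exI[of _ "real D + \<epsilon>"] conjI refl)
      show "hausdorff_measure \<rho> (real D + \<epsilon>) \<Sigma> = 0" using \<epsilon> by (intro upper) simp
    qed (use \<epsilon> in simp)
    also have "\<dots> = of_nat D + ennreal \<epsilon>"
      using \<epsilon> by (simp add: ennreal_of_nat_eq_real_of_nat)
    finally show "hausdorff_dimension \<rho> \<Sigma> \<le> of_nat D + ennreal \<epsilon>" .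
  qed
  ultimately show ?thesis unfolding D_def by (rule antisym)
qed

theorem mainTheorem4:
  fixes \<rho> :: "real^4 \<Rightarrow> real^4 \<Rightarrow> real"
    and \<Sigma> :: "(real^4) set"
  assumes "homogeneous_distance \<rho>"
    and "1 \<le> CARD('p::finite)" and "CARD('p) \<le> 4"
    and "C11_submanifold TYPE('p) \<Sigma>"
    and "\<Sigma> \<noteq> {}"
  shows "of_nat (submanifold_degree \<Sigma>) = hausdorff_dimension \<rho> \<Sigma>"
proof -
  consider "CARD('p) = CARD(1)" | "CARD('p) = CARD(2)" | "CARD('p) = CARD(3)" | "CARD('p) = CARD(4)"
  proof -
    have "CARD('p) = 1 \<or> CARD('p) = 2 \<or> CARD('p) = 3 \<or> CARD('p) = 4"
      using assms(2,3) by linarith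
    then show thesis using that by auto
  qed
  then show ?thesis
  proof cases
    case 1
    from C11_submanifold_reindex[OF assms(4) this] show ?thesis
      by (rule submanifold_degree_eq_hausdorff_dimension[OF assms(1) _ assms(5)])
  next
    case 2
    from C11_submanifold_reindex[OF assms(4) this] show ?thesis
      by (rule submanifold_degree_eq_hausdorff_dimension[OF assms(1) _ assms(5)])
  next
    case 3
    from C11_submanifold_reindex[OF assms(4) this] show ?thesis
      by (rule submanifold_degree_eq_hausdorff_dimension[OF assms(1) _ assms(5)])
  next
    case 4
    from C11_submanifold_reindex[OF assms(4) this] show ?thesis
      by (rule submanifold_degree_eq_hausdorff_dimension[OF assms(1) _ assms(5)])
  qed
qed

end
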